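(* Let $\mathcal H$ be an internal complex Hilbert space and $\mathcal M\subseteq\mathcal B(\mathcal H)$ an internal unital $C^*$-algebra. Suppose there exists a sequence $\{\widehat p_n\}_{n\in\mathbb N}$ of projections in the nonstandard hull $\widehat{\mathcal M}$ having strictly increasing ranges. Then $\widehat{\mathcal M}$ is not a von Neumann algebra.
   Context: Work in a nonstandard universe (in the sense of Robinson's nonstandard analysis) that is $\kappa$-saturated for a sufficiently large uncountable cardinal $\kappa$. All $C^*$-algebras are unital. For $r,s\in{}^*\mathbb R$, $r\approx s$ means $|r-s|<1/n$ for all standard $n\ge1$; $r$ is finite if $|r|<n$ for some standard $n$; ${}^\circ r$ is the standard part of a finite $r$. For an internal normed space $X$ (such as $\mathcal M$ or $\mathcal H$), $\mathrm{Fin}(X)=\{x\in X:\|x\|\text{ finite}\}$, $x\approx y$ means $\|x-y\|\approx0$, $\widehat x=\{y\in X:y\approx x\}$, and the nonstandard hull is $\widehat X=\{\widehat x:x\in\mathrm{Fin}(X)\}$ with operations induced from representatives and $\|\widehat x\|={}^\circ\|x\|$. Then $\widehat{\mathcal M}$ is an ordinary $C^*$-algebra, $\widehat{\mathcal H}$ is an ordinary Hilbert space with inner product $\langle\widehat x,\widehat y\rangle={}^\circ\langle x,y\rangle$, and $\widehat{\mathcal M}$ is regarded as a $C^*$-subalgebra of $\mathcal B(\widehat{\mathcal H})$ via $\widehat a(\widehat x)=\widehat{a(x)}$; ranges of projections of $\widehat{\mathcal M}$ are subspaces of $\widehat{\mathcal H}$. "$\widehat{\mathcal M}$ is a von Neumann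 algebra" means that $\widehat{\mathcal M}$ is closed in $\mathcal B(\widehat{\mathcal H})$ in the strong (equivalently weak) operator topology. *)

theory Defs
  imports "HOL-Analysis.Analysis"
begin

unbundle cardinal_syntax

section \<open>Superstructures\<close>

text \<open>
  A superstructure is given by a membership relation \<open>E\<close> on a type and a set \<open>X\<close> of individuals:
  \<open>V 0 = X\<close>, \<open>V (n+1) = V n \<union> Pow (V n)\<close>. For \<open>h = \<infinity>\<close> the predicate below describes
  \<open>V(X) = (\<Union>n. V n)\<close>. A finite \<open>h\<close> describes the truncation \<open>V h\<close>; it is admitted because
  HOL without further axioms cannot provide a type large enough to carry all of \<open>V(X)\<close>.
\<close>

definition elts :: "('a \<Rightarrow> 'a \<Rightarrow> bool) \<Rightarrow> 'a \<Rightarrow> 'a set" where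
  "elts E a = {x. E x a}"

primrec level :: "('a \<Rightarrow> 'a \<Rightarrow> bool) \<Rightarrow> 'a set \<Rightarrow> nat \<Rightarrow> 'a set" where
  "level E X 0 = X"
| "level E X (Suc n) = level E X n \<union> {a. a \<notin> X \<and> elts E a \<subseteq> level E X n}"

definition superstructure :: "('a \<Rightarrow> 'a \<Rightarrow> bool) \<Rightarrow> 'a set \<Rightarrow> enat \<Rightarrow> bool" where
  "superstructure E X h \<longleftrightarrow>
     (\<forall>x\<in>X. elts E x = {}) \<and>
     inj_on (elts E) (- X) \<and>
     (\<forall>a. \<exists>n. enat n \<le> h \<and> a \<in> level E X n) \<and>
     (\<forall>n S. enat n < h \<and> S \<subseteq> level E X n \<longrightarrow> (\<exists>a. a \<notin> X \<and> elts E a = S))"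

text \<open>\<open>is_pair E p x y\<close>: \<open>p\<close> is the Kuratowski pair \<open>{{x}, {x, y}}\<close>.\<close>

definition is_pair :: "('a \<Rightarrow> 'a \<Rightarrow> bool) \<Rightarrow> 'a \<Rightarrow> 'a \<Rightarrow> 'a \<Rightarrow> bool" where
  "is_pair E p x y \<longleftrightarrow>
     (\<exists>s t. elts E s = {x} \<and> elts E t = {x, y} \<and> elts E p = {s, t})"

definition is_triple :: "('a \<Rightarrow> 'a \<Rightarrow> bool) \<Rightarrow> 'a \<Rightarrow> 'a \<Rightarrow> 'a \<Rightarrow> 'a \<Rightarrow> bool" where
  "is_triple E p x y z \<longleftrightarrow> (\<exists>q. is_pair E q x y \<and> is_pair E p q z)"

text \<open>Functions as sets of pairs, and functions on a product as sets of triples.\<close>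

definition app :: "('a \<Rightarrow> 'a \<Rightarrow> bool) \<Rightarrow> 'a \<Rightarrow> 'a \<Rightarrow> 'a" where
  "app E f x = (THE y. \<exists>p\<in>elts E f. is_pair E p x y)"

definition app2 :: "('a \<Rightarrow> 'a \<Rightarrow> bool) \<Rightarrow> 'a \<Rightarrow> 'a \<Rightarrow> 'a \<Rightarrow> 'a" where
  "app2 E f x y = (THE z. \<exists>p\<in>elts E f. is_triple E p x y z)"

definition is_fun :: "('a \<Rightarrow> 'a \<Rightarrow> bool) \<Rightarrow> 'a \<Rightarrow> 'a \<Rightarrow> 'a \<Rightarrow> bool" where
  "is_fun E f A B \<longleftrightarrow>
     (\<forall>p\<in>elts E f. \<exists>x\<in>elts E A. \<exists>y\<in>elts E B. is_pair E p x y) \<and>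
     (\<forall>x\<in>elts E A. \<exists>!y. \<exists>p\<in>elts E f. is_pair E p x y)"

definition is_fun2 :: "('a \<Rightarrow> 'a \<Rightarrow> bool) \<Rightarrow> 'a \<Rightarrow> 'a \<Rightarrow> 'a \<Rightarrow> 'a \<Rightarrow> bool" where
  "is_fun2 E f A B C \<longleftrightarrow>
     (\<forall>p\<in>elts E f. \<exists>x\<in>elts E A. \<exists>y\<in>elts E B. \<exists>z\<in>elts E C. is_triple E p x y z) \<and>
     (\<forall>x\<in>elts E A. \<forall>y\<in>elts E B. \<exists>!z. \<exists>p\<in>elts E f. is_triple E p x y z)"

section \<open>Nonstandard universes\<close>

text \<open>
  Formulas with bounded quantifiers, in named variables \<open>v 0, v 1, \<dots>\<close>. Constants need no syntax:
  they are supplied by the assignment. \<open>FBAll i j \<phi>\<close> is \<open>\<forall>v i \<in> v j. \<phi>\<close>.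
\<close>

datatype bfm = FMem nat nat | FEq nat nat | FNeg bfm | FConj bfm bfm | FBAll nat nat bfm

primrec sat :: "('a \<Rightarrow> 'a \<Rightarrow> bool) \<Rightarrow> (nat \<Rightarrow> 'a) \<Rightarrow> bfm \<Rightarrow> bool" where
  "sat E e (FMem i j) \<longleftrightarrow> E (e i) (e j)"
| "sat E e (FEq i j) \<longleftrightarrow> e i = e j"
| "sat E e (FNeg \<phi>) \<longleftrightarrow> \<not> sat E e \<phi>"
| "sat E e (FConj \<phi> \<psi>) \<longleftrightarrow> sat E e \<phi> \<and> sat E e \<psi>"
| "sat E e (FBAll i j \<phi>) \<longleftrightarrow> (\<forall>a\<in>elts E (e j). sat E (e(i := a)) \<phi>)"

text \<open>
  \<open>indiv\<close> and \<open>smem\<close> are the individuals and the membership relation of the standard superstructure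
  \<open>V(X)\<close> on \<open>'u\<close>; \<open>cnum\<close> embeds the complex numbers as individuals (with the reals and the natural
  numbers among them); \<open>nmem\<close> is the membership relation of the superstructure \<open>V(*X)\<close> on \<open>'w\<close>.
\<close>

record ('u, 'w) nsu =
  height :: enat
  indiv :: "'u set"
  smem :: "'u \<Rightarrow> 'u \<Rightarrow> bool"
  cnum :: "complex \<Rightarrow> 'u"
  nmem :: "'w \<Rightarrow> 'w \<Rightarrow> bool"
  star :: "'u \<Rightarrow> 'w"

definition code :: "('u, 'w) nsu \<Rightarrow> 'u set \<Rightarrow> 'u" where
  "code U S = (THE a. a \<notin> indiv U \<and> elts (smem U) a = S)"

abbreviation nelts :: "('u, 'w) nsu \<Rightarrow> 'w \<Rightarrow> 'w set" where
  "nelts U \<equiv> elts (nmem U)"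

text \<open>
  Height 5 is what the graphs of binary operations on individuals need; the
  base set of the nonstandard superstructure is \<open>*X\<close>.
\<close>

definition nonstandard_universe :: "('u, 'w) nsu \<Rightarrow> bool" where
  "nonstandard_universe U \<longleftrightarrow>
     5 \<le> height U \<and>
     superstructure (smem U) (indiv U) (height U) \<and>
     inj (cnum U) \<and> range (cnum U) \<subseteq> indiv U \<and>
     superstructure (nmem U) (nelts U (star U (code U (indiv U)))) (height U) \<and>
     (\<forall>\<phi> e. sat (smem U) e \<phi> \<longleftrightarrow> sat (nmem U) (star U \<circ> e) \<phi>)"

definition internal :: "('u, 'w) nsu \<Rightarrow> 'w \<Rightarrow> bool" where
  "internal U a \<longleftrightarrow> (\<exists>s. a \<in> nelts U (star U s))"

definition saturated :: "('u, 'w) nsu \<Rightarrow> 'k rel \<Rightarrow> bool" where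
  "saturated U \<kappa> \<longleftrightarrow>
     (\<forall>F. F \<noteq> {} \<and> (\<forall>A\<in>F. internal U A) \<and> |F| <o \<kappa> \<and>
          (\<forall>G. G \<subseteq> F \<and> finite G \<and> G \<noteq> {} \<longrightarrow> (\<Inter>A\<in>G. nelts U A) \<noteq> {}) \<longrightarrow>
          (\<Inter>A\<in>F. nelts U A) \<noteq> {})"

section \<open>Nonstandard numbers\<close>

definition nset :: "('u, 'w) nsu \<Rightarrow> complex set \<Rightarrow> 'w" where
  "nset U S = star U (code U (cnum U ` S))"

definition nfun :: "('u, 'w) nsu \<Rightarrow> (complex \<Rightarrow> complex) \<Rightarrow> 'w \<Rightarrow> 'w" where
  "nfun U f = app (nmem U)
     (star U (code U {p. \<exists>x. is_pair (smem U) p (cnum U x) (cnum U (f x))}))"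

definition nfun2 :: "('u, 'w) nsu \<Rightarrow> (complex \<Rightarrow> complex \<Rightarrow> complex) \<Rightarrow> 'w \<Rightarrow> 'w \<Rightarrow> 'w" where
  "nfun2 U f = app2 (nmem U)
     (star U (code U {p. \<exists>x y. is_triple (smem U) p (cnum U x) (cnum U y) (cnum U (f x y))}))"

definition nrel :: "('u, 'w) nsu \<Rightarrow> (complex \<Rightarrow> complex \<Rightarrow> bool) \<Rightarrow> 'w \<Rightarrow> 'w \<Rightarrow> bool" where
  "nrel U R x y \<longleftrightarrow>
     (\<exists>p\<in>nelts U (star U (code U {p. \<exists>x y. R x y \<and> is_pair (smem U) p (cnum U x) (cnum U y)})).
        is_pair (nmem U) p x y)"

abbreviation nC where "nC U \<equiv> nelts U (nset U UNIV)"
abbreviation nR where "nR U \<equiv> nelts U (nset U \<real>)"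
abbreviation nN where "nN U \<equiv> nelts U (nset U \<nat>)"

definition num :: "('u, 'w) nsu \<Rightarrow> complex \<Rightarrow> 'w" where
  "num U c = star U (cnum U c)"

definition nplus :: "('u, 'w) nsu \<Rightarrow> 'w \<Rightarrow> 'w \<Rightarrow> 'w" where "nplus U = nfun2 U (+)"
definition nminus :: "('u, 'w) nsu \<Rightarrow> 'w \<Rightarrow> 'w \<Rightarrow> 'w" where "nminus U = nfun2 U (-)"
definition ntimes :: "('u, 'w) nsu \<Rightarrow> 'w \<Rightarrow> 'w \<Rightarrow> 'w" where "ntimes U = nfun2 U (*)"
definition ncnj :: "('u, 'w) nsu \<Rightarrow> 'w \<Rightarrow> 'w" where "ncnj U = nfun U cnj"
definition nabs :: "('u, 'w) nsu \<Rightarrow> 'w \<Rightarrow> 'w" where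
  "nabs U = nfun U (\<lambda>z. complex_of_real (cmod z))"
definition nle :: "('u, 'w) nsu \<Rightarrow> 'w \<Rightarrow> 'w \<Rightarrow> bool" where
  "nle U = nrel U (\<lambda>x y. x \<in> \<real> \<and> y \<in> \<real> \<and> Re x \<le> Re y)"
definition nless :: "('u, 'w) nsu \<Rightarrow> 'w \<Rightarrow> 'w \<Rightarrow> bool" where
  "nless U = nrel U (\<lambda>x y. x \<in> \<real> \<and> y \<in> \<real> \<and> Re x < Re y)"

definition napprox :: "('u, 'w) nsu \<Rightarrow> 'w \<Rightarrow> 'w \<Rightarrow> bool" where
  "napprox U r s \<longleftrightarrow> (\<forall>n::nat. n \<ge> 1 \<longrightarrow> nless U (nabs U (nminus U r s)) (num U (1 / of_nat n)))"

definition nfinite :: "('u, 'w) nsu \<Rightarrow> 'w \<Rightarrow> bool" where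
  "nfinite U r \<longleftrightarrow> (\<exists>n::nat. nless U (nabs U r) (num U (of_nat n)))"

definition standard_part :: "('u, 'w) nsu \<Rightarrow> 'w \<Rightarrow> real" where
  "standard_part U r = (THE t. napprox U r (num U (complex_of_real t)))"

section \<open>Internal Hilbert spaces\<close>

record 'w ihs =
  hcar :: 'w
  hadd :: 'w
  hscale :: 'w
  hinner :: 'w

definition vecs :: "('u, 'w) nsu \<Rightarrow> 'w ihs \<Rightarrow> 'w set" where
  "vecs U H = nelts U (hcar H)"

definition vadd :: "('u, 'w) nsu \<Rightarrow> 'w ihs \<Rightarrow> 'w \<Rightarrow> 'w \<Rightarrow> 'w" where
  "vadd U H = app2 (nmem U) (hadd H)"

definition vscale :: "('u, 'w) nsu \<Rightarrow> 'w ihs \<Rightarrow> 'w \<Rightarrow> 'w \<Rightarrow> 'w" where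
  "vscale U H = app2 (nmem U) (hscale H)"

definition inn :: "('u, 'w) nsu \<Rightarrow> 'w ihs \<Rightarrow> 'w \<Rightarrow> 'w \<Rightarrow> 'w" where
  "inn U H = app2 (nmem U) (hinner H)"

definition vsub :: "('u, 'w) nsu \<Rightarrow> 'w ihs \<Rightarrow> 'w \<Rightarrow> 'w \<Rightarrow> 'w" where
  "vsub U H x y = vadd U H x (vscale U H (num U (-1)) y)"

definition vnorm :: "('u, 'w) nsu \<Rightarrow> 'w ihs \<Rightarrow> 'w \<Rightarrow> 'w" where
  "vnorm U H x = (THE r. r \<in> nR U \<and> nle U (num U 0) r \<and> ntimes U r r = inn U H x x)"

definition internal_vector_space :: "('u, 'w) nsu \<Rightarrow> 'w ihs \<Rightarrow> bool" where
  "internal_vector_space U H \<longleftrightarrow>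
     internal U (hcar H) \<and> internal U (hadd H) \<and> internal U (hscale H) \<and>
     is_fun2 (nmem U) (hadd H) (hcar H) (hcar H) (hcar H) \<and>
     is_fun2 (nmem U) (hscale H) (nset U UNIV) (hcar H) (hcar H) \<and>
     (\<forall>x\<in>vecs U H. \<forall>y\<in>vecs U H. vadd U H x y = vadd U H y x) \<and>
     (\<forall>x\<in>vecs U H. \<forall>y\<in>vecs U H. \<forall>z\<in>vecs U H.
        vadd U H (vadd U H x y) z = vadd U H x (vadd U H y z)) \<and>
     (\<exists>z0\<in>vecs U H. \<forall>x\<in>vecs U H. vadd U H x z0 = x \<and> (\<exists>y\<in>vecs U H. vadd U H x y = z0)) \<and>
     (\<forall>c\<in>nC U. \<forall>x\<in>vecs U H. \<forall>y\<in>vecs U H.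
        vscale U H c (vadd U H x y) = vadd U H (vscale U H c x) (vscale U H c y)) \<and>
     (\<forall>c\<in>nC U. \<forall>d\<in>nC U. \<forall>x\<in>vecs U H.
        vscale U H (nplus U c d) x = vadd U H (vscale U H c x) (vscale U H d x) \<and>
        vscale U H (ntimes U c d) x = vscale U H c (vscale U H d x)) \<and>
     (\<forall>x\<in>vecs U H. vscale U H (num U 1) x = x)"

definition internal_inner_product :: "('u, 'w) nsu \<Rightarrow> 'w ihs \<Rightarrow> bool" where
  "internal_inner_product U H \<longleftrightarrow>
     internal U (hinner H) \<and>
     is_fun2 (nmem U) (hinner H) (hcar H) (hcar H) (nset U UNIV) \<and>
     (\<forall>x\<in>vecs U H. \<forall>y\<in>vecs U H. inn U H y x = ncnj U (inn U H x y)) \<and>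
     (\<forall>x\<in>vecs U H. \<forall>y\<in>vecs U H. \<forall>z\<in>vecs U H.
        inn U H (vadd U H x y) z = nplus U (inn U H x z) (inn U H y z)) \<and>
     (\<forall>c\<in>nC U. \<forall>x\<in>vecs U H. \<forall>y\<in>vecs U H.
        inn U H (vscale U H c x) y = ntimes U c (inn U H x y)) \<and>
     (\<forall>x\<in>vecs U H. nle U (num U 0) (inn U H x x)) \<and>
     (\<forall>x\<in>vecs U H. inn U H x x = num U 0 \<longrightarrow> (\<forall>y\<in>vecs U H. vadd U H y x = y))"

text \<open>Completeness in the internal sense: it concerns internal sequences \<open>*\<nat> \<rightarrow> H\<close>.\<close>

definition internally_complete :: "('u, 'w) nsu \<Rightarrow> 'w ihs \<Rightarrow> bool" where
  "internally_complete U H \<longleftrightarrow>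
     (\<forall>s. internal U s \<and> is_fun (nmem U) s (nset U \<nat>) (hcar H) \<and>
        (\<forall>e\<in>nR U. nless U (num U 0) e \<longrightarrow>
           (\<exists>N\<in>nN U. \<forall>m\<in>nN U. \<forall>n\<in>nN U. nle U N m \<and> nle U N n \<longrightarrow>
              nless U (vnorm U H (vsub U H (app (nmem U) s m) (app (nmem U) s n))) e)) \<longrightarrow>
        (\<exists>l\<in>vecs U H. \<forall>e\<in>nR U. nless U (num U 0) e \<longrightarrow>
           (\<exists>N\<in>nN U. \<forall>n\<in>nN U. nle U N n \<longrightarrow>
              nless U (vnorm U H (vsub U H (app (nmem U) s n) l)) e)))"

definition internal_hilbert_space :: "('u, 'w) nsu \<Rightarrow> 'w ihs \<Rightarrow> bool" where
  "internal_hilbert_space U H \<longleftrightarrow>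
     internal_vector_space U H \<and> internal_inner_product U H \<and> internally_complete U H"

section \<open>Internal \<open>C\<^sup>*\<close>-algebras of operators\<close>

definition ap :: "('u, 'w) nsu \<Rightarrow> 'w \<Rightarrow> 'w \<Rightarrow> 'w" where
  "ap U a x = app (nmem U) a x"

text \<open>The internal set \<open>B(H)\<close>, as an external set.\<close>

definition int_ops :: "('u, 'w) nsu \<Rightarrow> 'w ihs \<Rightarrow> 'w set" where
  "int_ops U H = {a. internal U a \<and> is_fun (nmem U) a (hcar H) (hcar H) \<and>
     (\<forall>x\<in>vecs U H. \<forall>y\<in>vecs U H. ap U a (vadd U H x y) = vadd U H (ap U a x) (ap U a y)) \<and>
     (\<forall>c\<in>nC U. \<forall>x\<in>vecs U H. ap U a (vscale U H c x) = vscale U H c (ap U a x)) \<and>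
     (\<exists>C\<in>nR U. \<forall>x\<in>vecs U H. nle U (vnorm U H (ap U a x)) (ntimes U C (vnorm U H x)))}"

definition op_bound :: "('u, 'w) nsu \<Rightarrow> 'w ihs \<Rightarrow> 'w \<Rightarrow> 'w \<Rightarrow> bool" where
  "op_bound U H a C \<longleftrightarrow> C \<in> nR U \<and> nle U (num U 0) C \<and>
     (\<forall>x\<in>vecs U H. nle U (vnorm U H (ap U a x)) (ntimes U C (vnorm U H x)))"

definition op_norm :: "('u, 'w) nsu \<Rightarrow> 'w ihs \<Rightarrow> 'w \<Rightarrow> 'w" where
  "op_norm U H a = (THE r. op_bound U H a r \<and> (\<forall>C. op_bound U H a C \<longrightarrow> nle U r C))"

text \<open>The internal operator on \<open>H\<close> with the given values.\<close>

definition op_of :: "('u, 'w) nsu \<Rightarrow> 'w ihs \<Rightarrow> ('w \<Rightarrow> 'w) \<Rightarrow> 'w" where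
  "op_of U H f = (THE a. a \<in> int_ops U H \<and> (\<forall>x\<in>vecs U H. ap U a x = f x))"

definition op_sub :: "('u, 'w) nsu \<Rightarrow> 'w ihs \<Rightarrow> 'w \<Rightarrow> 'w \<Rightarrow> 'w" where
  "op_sub U H a b = op_of U H (\<lambda>x. vsub U H (ap U a x) (ap U b x))"

definition op_mult :: "('u, 'w) nsu \<Rightarrow> 'w ihs \<Rightarrow> 'w \<Rightarrow> 'w \<Rightarrow> 'w" where
  "op_mult U H a b = op_of U H (\<lambda>x. ap U a (ap U b x))"

definition is_adj :: "('u, 'w) nsu \<Rightarrow> 'w ihs \<Rightarrow> 'w \<Rightarrow> 'w \<Rightarrow> bool" where
  "is_adj U H a b \<longleftrightarrow>
     (\<forall>x\<in>vecs U H. \<forall>y\<in>vecs U H. inn U H (ap U a x) y = inn U H x (ap U b y))"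

definition op_adj :: "('u, 'w) nsu \<Rightarrow> 'w ihs \<Rightarrow> 'w \<Rightarrow> 'w" where
  "op_adj U H a = (THE b. b \<in> int_ops U H \<and> is_adj U H a b)"

text \<open>
  A norm-closed *-subalgebra of \<open>B(H)\<close> (in the internal sense) with a multiplicative unit. The unit
  is not required to be the identity operator of \<open>H\<close>.
\<close>

definition internal_cstar_algebra :: "('u, 'w) nsu \<Rightarrow> 'w ihs \<Rightarrow> 'w \<Rightarrow> bool" where
  "internal_cstar_algebra U H M \<longleftrightarrow>
     internal U M \<and> nelts U M \<subseteq> int_ops U H \<and>
     (\<exists>u\<in>nelts U M. \<forall>a\<in>nelts U M. \<forall>x\<in>vecs U H.
        ap U u (ap U a x) = ap U a x \<and> ap U a (ap U u x) = ap U a x) \<and>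
     (\<forall>a\<in>nelts U M. \<forall>b\<in>nelts U M. \<exists>c\<in>nelts U M. \<forall>x\<in>vecs U H.
        ap U c x = vadd U H (ap U a x) (ap U b x)) \<and>
     (\<forall>t\<in>nC U. \<forall>a\<in>nelts U M. \<exists>c\<in>nelts U M. \<forall>x\<in>vecs U H.
        ap U c x = vscale U H t (ap U a x)) \<and>
     (\<forall>a\<in>nelts U M. \<forall>b\<in>nelts U M. \<exists>c\<in>nelts U M. \<forall>x\<in>vecs U H.
        ap U c x = ap U a (ap U b x)) \<and>
     (\<forall>a\<in>nelts U M. \<exists>b\<in>nelts U M. is_adj U H a b) \<and>
     (\<forall>a\<in>int_ops U H.
        (\<forall>e\<in>nR U. nless U (num U 0) e \<longrightarrow>
           (\<exists>b\<in>nelts U M. nless U (op_norm U H (op_sub U H a b)) e)) \<longrightarrow>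
        a \<in> nelts U M)"

section \<open>Nonstandard hulls\<close>

text \<open>
  \<open>X\<close> is an internal normed space with norm \<open>nrm\<close> and subtraction \<open>sub\<close>. Elements of the hull
  are the classes \<open>{y \<in> X. y \<approx> x}\<close> of the finite \<open>x\<close>. An operation is induced from
  representatives by taking the union of the classes obtained from all representatives; for
  a well-defined operation these classes coincide.
\<close>

definition fin_part :: "('u, 'w) nsu \<Rightarrow> 'w set \<Rightarrow> ('w \<Rightarrow> 'w) \<Rightarrow> 'w set" where
  "fin_part U X nrm = {x\<in>X. nfinite U (nrm x)}"

definition hat :: "('u, 'w) nsu \<Rightarrow> 'w set \<Rightarrow> ('w \<Rightarrow> 'w) \<Rightarrow> ('w \<Rightarrow> 'w \<Rightarrow> 'w) \<Rightarrow> 'w \<Rightarrow> 'w set" where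
  "hat U X nrm sub x = {y\<in>X. napprox U (nrm (sub y x)) (num U 0)}"

definition nshull :: "('u, 'w) nsu \<Rightarrow> 'w set \<Rightarrow> ('w \<Rightarrow> 'w) \<Rightarrow> ('w \<Rightarrow> 'w \<Rightarrow> 'w) \<Rightarrow> 'w set set" where
  "nshull U X nrm sub = hat U X nrm sub ` fin_part U X nrm"

subsection \<open>The hull of the Hilbert space\<close>

definition vhat :: "('u, 'w) nsu \<Rightarrow> 'w ihs \<Rightarrow> 'w \<Rightarrow> 'w set" where
  "vhat U H = hat U (vecs U H) (vnorm U H) (vsub U H)"

definition Hhull :: "('u, 'w) nsu \<Rightarrow> 'w ihs \<Rightarrow> 'w set set" where
  "Hhull U H = nshull U (vecs U H) (vnorm U H) (vsub U H)"

definition hh_add :: "('u, 'w) nsu \<Rightarrow> 'w ihs \<Rightarrow> 'w set \<Rightarrow> 'w set \<Rightarrow> 'w set" where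
  "hh_add U H X Y = (\<Union>x\<in>X. \<Union>y\<in>Y. vhat U H (vadd U H x y))"

definition hh_scale :: "('u, 'w) nsu \<Rightarrow> 'w ihs \<Rightarrow> complex \<Rightarrow> 'w set \<Rightarrow> 'w set" where
  "hh_scale U H c X = (\<Union>x\<in>X. vhat U H (vscale U H (num U c) x))"

definition hh_norm :: "('u, 'w) nsu \<Rightarrow> 'w ihs \<Rightarrow> 'w set \<Rightarrow> real" where
  "hh_norm U H X = (THE r. \<forall>x\<in>X. r = standard_part U (vnorm U H x))"

definition hh_dist :: "('u, 'w) nsu \<Rightarrow> 'w ihs \<Rightarrow> 'w set \<Rightarrow> 'w set \<Rightarrow> real" where
  "hh_dist U H X Y = hh_norm U H (hh_add U H X (hh_scale U H (-1) Y))"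

definition hh_ops :: "('u, 'w) nsu \<Rightarrow> 'w ihs \<Rightarrow> ('w set \<Rightarrow> 'w set) set" where
  "hh_ops U H = {T \<in> Hhull U H \<rightarrow>\<^sub>E Hhull U H.
     (\<forall>X\<in>Hhull U H. \<forall>Y\<in>Hhull U H. T (hh_add U H X Y) = hh_add U H (T X) (T Y)) \<and>
     (\<forall>c. \<forall>X\<in>Hhull U H. T (hh_scale U H c X) = hh_scale U H c (T X)) \<and>
     (\<exists>C. \<forall>X\<in>Hhull U H. hh_norm U H (T X) \<le> C * hh_norm U H X)}"

text \<open>The strong operator topology on \<open>B(Hhull)\<close>: pointwise convergence in norm.\<close>

definition hh_sot :: "('u, 'w) nsu \<Rightarrow> 'w ihs \<Rightarrow> ('w set \<Rightarrow> 'w set) topology" where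
  "hh_sot U H = subtopology
     (product_topology (\<lambda>_. Metric_space.mtopology (Hhull U H) (hh_dist U H)) (Hhull U H))
     (hh_ops U H)"

subsection \<open>The hull of the operator algebra\<close>

definition ahat :: "('u, 'w) nsu \<Rightarrow> 'w ihs \<Rightarrow> 'w \<Rightarrow> 'w \<Rightarrow> 'w set" where
  "ahat U H M = hat U (nelts U M) (op_norm U H) (op_sub U H)"

definition Mhull :: "('u, 'w) nsu \<Rightarrow> 'w ihs \<Rightarrow> 'w \<Rightarrow> 'w set set" where
  "Mhull U H M = nshull U (nelts U M) (op_norm U H) (op_sub U H)"

definition mh_mult :: "('u, 'w) nsu \<Rightarrow> 'w ihs \<Rightarrow> 'w \<Rightarrow> 'w set \<Rightarrow> 'w set \<Rightarrow> 'w set" where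
  "mh_mult U H M A B = (\<Union>a\<in>A. \<Union>b\<in>B. ahat U H M (op_mult U H a b))"

definition mh_adj :: "('u, 'w) nsu \<Rightarrow> 'w ihs \<Rightarrow> 'w \<Rightarrow> 'w set \<Rightarrow> 'w set" where
  "mh_adj U H M A = (\<Union>a\<in>A. ahat U H M (op_adj U H a))"

definition Mhull_projection :: "('u, 'w) nsu \<Rightarrow> 'w ihs \<Rightarrow> 'w \<Rightarrow> 'w set \<Rightarrow> bool" where
  "Mhull_projection U H M P \<longleftrightarrow>
     P \<in> Mhull U H M \<and> mh_mult U H M P P = P \<and> mh_adj U H M P = P"

text \<open>The action of the hull of \<open>M\<close> on the hull of \<open>H\<close>: \<open>rep (ahat a) (vhat x) = vhat (a x)\<close>.\<close>

definition rep :: "('u, 'w) nsu \<Rightarrow> 'w ihs \<Rightarrow> 'w set \<Rightarrow> 'w set \<Rightarrow> 'w set" where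
  "rep U H A = (\<lambda>X\<in>Hhull U H. \<Union>a\<in>A. \<Union>x\<in>X. vhat U H (ap U a x))"

definition hull_range :: "('u, 'w) nsu \<Rightarrow> 'w ihs \<Rightarrow> 'w set \<Rightarrow> 'w set set" where
  "hull_range U H A = rep U H A ` Hhull U H"

definition Mhull_von_neumann :: "('u, 'w) nsu \<Rightarrow> 'w ihs \<Rightarrow> 'w \<Rightarrow> bool" where
  "Mhull_von_neumann U H M \<longleftrightarrow> closedin (hh_sot U H) (rep U H ` Mhull U H M)"

end

theory Submission
  imports Defs
begin

text \<open>
  Let \<open>a\<^sub>n \<in> M\<close> represent \<open>p n\<close>. On the hull of \<open>H\<close> the \<open>p n\<close> are increasing orthogonal projections, so
  \<open>p n X\<close> is a Cauchy sequence for every \<open>X\<close>. By saturation of \<open>M\<close>, for finitely many vectors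
  \<open>X\<^sub>1, \<dots>, X\<^sub>k\<close> there is a single \<open>b \<in> M\<close> with \<open>|b| \<le> 2\<close> whose class maps every \<open>X\<^sub>i\<close> exactly to
  \<open>lim p n X\<^sub>i\<close>. Hence the pointwise limit \<open>T\<close> exists and belongs to the closure of the hull of \<open>M\<close> in the
  product topology, whatever the topology of the factors is: metric properties of \<open>hh_dist\<close>, which
  takes junk values outside the hull, are never needed.

  If \<open>T\<close> were the class of some \<open>c \<in> M\<close>, then for each \<open>n\<close> a unit vector in the range of \<open>p (n+1)\<close> orthogonal
  to that of \<open>p n\<close> would satisfy \<open>c x \<approx> x\<close> and \<open>a\<^sub>m x \<approx> 0\<close> for \<open>m \<le> n\<close>. By saturation of \<open>H\<close> there would be a
  finite \<open>x\<close> with \<open>|c x| > 1/2\<close> and \<open>a\<^sub>m x \<approx> 0\<close> up to \<open>1/(m+1)\<close> for all \<open>m\<close>, which contradicts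
  \<open>c x \<approx> lim a\<^sub>m x\<close>.
\<close>

section \<open>Bounded formulas\<close>

text \<open>The only bridge between the two universes is transfer of bounded formulas, while norms,
  operator norms, adjoints and products of operators are descriptions outside that language. The
  sets to which saturation is applied are therefore written with the graphs of the operators and of
  the inner product, and with squared norms. That an operator norm exists at all has to be derived,
  from an internal infimum. Arithmetic in the nonstandard complex numbers is not transferred law by
  law: all numbers in a statement are written as standard functions of one \<open>w\<close>, so that
  a law becomes a pointwise law along an ultrafilter. The constant 2 appears because representatives
  of hull projections have norm at most 1 only up to an infinitesimal, whereas an internal set needs
  a bound that all of them satisfy exactly. In the same way an internal strict inequality becomes a
  weak one under standard parts, so 1/2 is chosen with room below the value 1 reached by the gap
  vectors. Saturation is certain only for countable families; this is why one operator serves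
  finitely many vectors and not all of them.\<close>

definition FImp :: "bfm \<Rightarrow> bfm \<Rightarrow> bfm" where "FImp \<phi> \<psi> = FNeg (FConj \<phi> (FNeg \<psi>))"
definition FOr :: "bfm \<Rightarrow> bfm \<Rightarrow> bfm" where "FOr \<phi> \<psi> = FImp (FNeg \<phi>) \<psi>"
definition FIff :: "bfm \<Rightarrow> bfm \<Rightarrow> bfm" where "FIff \<phi> \<psi> = FConj (FImp \<phi> \<psi>) (FImp \<psi> \<phi>)"
definition FBEx :: "nat \<Rightarrow> nat \<Rightarrow> bfm \<Rightarrow> bfm" where "FBEx i j \<phi> = FNeg (FBAll i j (FNeg \<phi>))"

lemma sat_FImp [simp]: "sat E e (FImp \<phi> \<psi>) \<longleftrightarrow> (sat E e \<phi> \<longrightarrow> sat E e \<psi>)"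
  and sat_FOr [simp]: "sat E e (FOr \<phi> \<psi>) \<longleftrightarrow> sat E e \<phi> \<or> sat E e \<psi>"
  and sat_FIff [simp]: "sat E e (FIff \<phi> \<psi>) \<longleftrightarrow> (sat E e \<phi> \<longleftrightarrow> sat E e \<psi>)"
  and sat_FBEx [simp]: "sat E e (FBEx i j \<phi>) \<longleftrightarrow> (\<exists>a\<in>elts E (e j). sat E (e(i := a)) \<phi>)"
  by (auto simp: FImp_def FOr_def FIff_def FBEx_def)

text \<open>The index \<open>k\<close> is a fresh variable above all those in use, so the quantifier
  introduced here captures nothing.\<close>

definition FUpair :: "nat \<Rightarrow> nat \<Rightarrow> nat \<Rightarrow> nat \<Rightarrow> bfm" where
  "FUpair k t x y = FConj (FMem x t) (FConj (FMem y t) (FBAll k t (FOr (FEq k x) (FEq k y))))"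

lemma sat_FUpair:
  "t < k \<Longrightarrow> x < k \<Longrightarrow> y < k \<Longrightarrow> sat E e (FUpair k t x y) \<longleftrightarrow> elts E (e t) = {e x, e y}"
  by (auto simp: FUpair_def elts_def)

text \<open>The sets \<open>s\<close> and \<open>t\<close> of a Kuratowski pair are elements of the
  pair itself, which bounds their quantifiers.\<close>

definition FPair :: "nat \<Rightarrow> nat \<Rightarrow> nat \<Rightarrow> nat \<Rightarrow> bfm" where
  "FPair k p x y = FBEx k p (FBEx (k+1) p
     (FConj (FUpair (k+2) k x x) (FConj (FUpair (k+2) (k+1) x y) (FUpair (k+2) p k (k+1)))))"

lemma sat_FPair:
  assumes "p < k" "x < k" "y < k"
  shows "sat E e (FPair k p x y) \<longleftrightarrow> is_pair E (e p) (e x) (e y)"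
proof -
  have "sat E e (FPair k p x y) \<longleftrightarrow> (\<exists>s\<in>elts E (e p). \<exists>t\<in>elts E (e p).
      elts E s = {e x} \<and> elts E t = {e x, e y} \<and> elts E (e p) = {s, t})"
    using assms by (simp add: FPair_def sat_FUpair)
  also have "\<dots> \<longleftrightarrow> is_pair E (e p) (e x) (e y)"
    unfolding is_pair_def by (metis insertI1 insertI2)
  finally show ?thesis .
qed

text \<open>The inner pair is an element of an element of \<open>p\<close>; its quantifier is
  bounded by passing through the intermediate set \<open>k\<close>.\<close>

definition FTriple :: "nat \<Rightarrow> nat \<Rightarrow> nat \<Rightarrow> nat \<Rightarrow> nat \<Rightarrow> bfm" where
  "FTriple k p x y z = FBEx k p (FBEx (k+1) k
     (FConj (FPair (k+2) (k+1) x y) (FPair (k+2) p (k+1) z)))"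

lemma sat_FTriple:
  assumes "p < k" "x < k" "y < k" "z < k"
  shows "sat E e (FTriple k p x y z) \<longleftrightarrow> is_triple E (e p) (e x) (e y) (e z)"
proof -
  have "\<exists>s\<in>elts E p'. q \<in> elts E s" if "is_pair E p' q z'" for p' q z'
    using that by (auto simp: is_pair_def)
  then show ?thesis
    using assms by (simp add: FTriple_def is_triple_def sat_FPair) metis
qed

text \<open>Formulas have no terms, so applications \<open>app\<close> and \<open>app2\<close> enter
  them only as membership of a pair or triple in a graph.\<close>

definition grel :: "('a \<Rightarrow> 'a \<Rightarrow> bool) \<Rightarrow> 'a \<Rightarrow> 'a \<Rightarrow> 'a \<Rightarrow> bool" where
  "grel E f x y \<longleftrightarrow> (\<exists>p\<in>elts E f. is_pair E p x y)"

definition grel3 :: "('a \<Rightarrow> 'a \<Rightarrow> bool) \<Rightarrow> 'a \<Rightarrow> 'a \<Rightarrow> 'a \<Rightarrow> 'a \<Rightarrow> bool" where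
  "grel3 E f x y z \<longleftrightarrow> (\<exists>p\<in>elts E f. is_triple E p x y z)"

text \<open>The variables from 50 on are reserved for the encoding of pairs and triples.\<close>

definition FRel :: "nat \<Rightarrow> nat \<Rightarrow> nat \<Rightarrow> bfm" where
  "FRel f x y = FBEx 50 f (FPair 51 50 x y)"

definition FRel3 :: "nat \<Rightarrow> nat \<Rightarrow> nat \<Rightarrow> nat \<Rightarrow> bfm" where
  "FRel3 f x y z = FBEx 50 f (FTriple 51 50 x y z)"

lemma sat_FRel [simp]:
  "f < 50 \<Longrightarrow> x < 50 \<Longrightarrow> y < 50 \<Longrightarrow> sat E e (FRel f x y) \<longleftrightarrow> grel E (e f) (e x) (e y)"
  by (simp add: FRel_def grel_def sat_FPair)

lemma sat_FRel3 [simp]: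
  "f < 50 \<Longrightarrow> x < 50 \<Longrightarrow> y < 50 \<Longrightarrow> z < 50 \<Longrightarrow>
   sat E e (FRel3 f x y z) \<longleftrightarrow> grel3 E (e f) (e x) (e y) (e z)"
  by (simp add: FRel3_def grel3_def sat_FTriple)

lemma sat_FMem' [simp]: "sat E e (FMem i j) \<longleftrightarrow> e i \<in> elts E (e j)"
  by (simp add: elts_def)

declare sat.simps(1) [simp del]

text \<open>A formula mentions finitely many variables. This supplies the fresh slots in which
  \<open>internal_comprehension\<close> stores a level and the set to be formed.\<close>

lemma sat_finite_dependence:
  "\<exists>N. \<forall>e e'. (\<forall>i<N. e i = e' i) \<longrightarrow> sat E e \<phi> = sat E e' \<phi>"
proof (induction \<phi>)
  case (FMem i j)
  show ?case by (rule exI[of _ "Suc (max i j)"]) simp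
next
  case (FEq i j)
  show ?case by (rule exI[of _ "Suc (max i j)"]) simp
next
  case (FNeg \<phi>)
  then show ?case by auto
next
  case (FConj \<phi> \<psi>)
  then obtain N1 N2 where
    "\<And>e e'. (\<forall>i<N1. e i = e' i) \<Longrightarrow> sat E e \<phi> = sat E e' \<phi>"
    "\<And>e e'. (\<forall>i<N2. e i = e' i) \<Longrightarrow> sat E e \<psi> = sat E e' \<psi>" by blast
  then have "\<forall>i<max N1 N2. e i = e' i \<Longrightarrow> sat E e (FConj \<phi> \<psi>) = sat E e' (FConj \<phi> \<psi>)" for e e'
    by (simp only: less_max_iff_disj sat.simps) blast
  then show ?case by blast
next
  case (FBAll i j \<phi>)
  then obtain N where N: "\<And>e e'. (\<forall>i<N. e i = e' i) \<Longrightarrow> sat E e \<phi> = sat E e' \<phi>" by blast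
  show ?case
  proof (intro exI[of _ "max N (Suc j)"] allI impI)
    fix e e' :: "nat \<Rightarrow> 'a"
    assume e: "\<forall>k<max N (Suc j). e k = e' k"
    then have "sat E (e(i := a)) \<phi> = sat E (e'(i := a)) \<phi>" for a
      by (intro N) auto
    then show "sat E e (FBAll i j \<phi>) = sat E e' (FBAll i j \<phi>)"
      using e by simp
  qed
qed

definition FBAlls :: "nat list \<Rightarrow> nat \<Rightarrow> bfm \<Rightarrow> bfm" where
  "FBAlls is j \<phi> = foldr (\<lambda>i. FBAll i j) is \<phi>"

text \<open>All quantifiers share the bound \<open>v j\<close>, which stays fixed because
  \<open>j\<close> is not quantified; a block of them therefore amounts to one simultaneous choice
  of values. It serves to quantify over all parameters before transfer.\<close>

lemma sat_FBAlls:
  assumes "j \<notin> set is"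
  shows "sat E e (FBAlls is j \<phi>) \<longleftrightarrow>
    (\<forall>e'. (\<forall>i\<in>set is. e' i \<in> elts E (e j)) \<longrightarrow> sat E (\<lambda>i. if i \<in> set is then e' i else e i) \<phi>)"
  using assms
proof (induction "is" arbitrary: e)
  case Nil
  then show ?case by (simp add: FBAlls_def)
next
  case (Cons k ks)
  have *: "FBAlls (k # ks) j \<phi> = FBAll k j (FBAlls ks j \<phi>)"
    by (simp add: FBAlls_def)
  have upd: "(\<lambda>i. if i \<in> set ks then e' i else (e(k := a)) i) =
      (\<lambda>i. if i \<in> set (k # ks) then (if i \<in> set ks then e' i else a) else e i)" for e' a
    by auto
  have j: "j \<noteq> k" "j \<notin> set ks" using Cons.prems by auto
  show ?case
  proof
    assume L: "sat E e (FBAlls (k # ks) j \<phi>)"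
    show "\<forall>e'. (\<forall>i\<in>set (k # ks). e' i \<in> elts E (e j)) \<longrightarrow>
        sat E (\<lambda>i. if i \<in> set (k # ks) then e' i else e i) \<phi>"
    proof (intro allI impI)
      fix e'
      assume e': "\<forall>i\<in>set (k # ks). e' i \<in> elts E (e j)"
      then have "sat E (e(k := e' k)) (FBAlls ks j \<phi>)"
        using L * by simp
      then have "sat E (\<lambda>i. if i \<in> set ks then e' i else (e(k := e' k)) i) \<phi>"
        using Cons.IH[OF j(2), of "e(k := e' k)"] e' j by simp
      moreover have "(\<lambda>i. if i \<in> set ks then e' i else (e(k := e' k)) i) =
          (\<lambda>i. if i \<in> set (k # ks) then e' i else e i)"
        by auto
      ultimately show "sat E (\<lambda>i. if i \<in> set (k # ks) then e' i else e i) \<phi>"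
        by simp
    qed
  next
    assume R: "\<forall>e'. (\<forall>i\<in>set (k # ks). e' i \<in> elts E (e j)) \<longrightarrow>
        sat E (\<lambda>i. if i \<in> set (k # ks) then e' i else e i) \<phi>"
    have "sat E (e(k := a)) (FBAlls ks j \<phi>)" if a: "a \<in> elts E (e j)" for a
      unfolding Cons.IH[OF j(2), of "e(k := a)"] upd
    proof (intro allI impI)
      fix e'
      assume "\<forall>i\<in>set ks. e' i \<in> elts E ((e(k := a)) j)"
      then show "sat E (\<lambda>i. if i \<in> set (k # ks) then if i \<in> set ks then e' i else a else e i) \<phi>"
        using R[rule_format, of "\<lambda>i. if i \<in> set ks then e' i else a"] a j by simp
    qed
    then show "sat E e (FBAlls (k # ks) j \<phi>)"
      using * by simp
  qed
qed

section \<open>Superstructures\<close>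

lemma is_pair_inj:
  assumes "is_pair E p x y" "is_pair E p x' y'"
  shows "x = x' \<and> y = y'"
proof -
  from assms obtain s t s' t' where
    s: "elts E s = {x}" "elts E t = {x, y}" "elts E p = {s, t}"
       "elts E s' = {x'}" "elts E t' = {x', y'}" "elts E p = {s', t'}"
    unfolding is_pair_def by auto
  then have "{s, t} = {s', t'}" by simp
  then consider "s = s'" "t = t'" | "s = t'" "t = s'" by (auto simp: doubleton_eq_iff)
  then show ?thesis
  proof cases
    case 1
    then have "{x} = {x'}" "{x, y} = {x', y'}" using s by simp_all
    then show ?thesis by (auto simp: doubleton_eq_iff)
  next
    case 2
    then have "{x} = {x', y'}" "{x, y} = {x'}" using s by simp_all
    then show ?thesis by auto
  qed
qed

lemma is_triple_inj:
  assumes "is_triple E p x y z" "is_triple E p x' y' z'"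
  shows "x = x' \<and> y = y' \<and> z = z'"
  using assms unfolding is_triple_def by (metis is_pair_inj)

lemma level_mono: "m \<le> n \<Longrightarrow> level E X m \<subseteq> level E X n"
  by (induction n) (auto simp: le_Suc_eq)

locale superstr =
  fixes E :: "'a \<Rightarrow> 'a \<Rightarrow> bool" and X :: "'a set" and h :: enat
  assumes superstructure: "superstructure E X h"
begin

lemma elts_indiv: "x \<in> X \<Longrightarrow> elts E x = {}"
  using superstructure by (auto simp: superstructure_def)

lemma elts_inject: "a \<notin> X \<Longrightarrow> b \<notin> X \<Longrightarrow> elts E a = elts E b \<Longrightarrow> a = b"
  using superstructure by (auto simp: superstructure_def inj_on_def)

lemma nonempty_not_indiv: "x \<in> elts E a \<Longrightarrow> a \<notin> X"
  using elts_indiv by blast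

text \<open>Individuals and the empty set all have no members, so extensionality is safe only when a
  member is exhibited.\<close>

lemma elts_eqI: "elts E a = elts E b \<Longrightarrow> x \<in> elts E a \<Longrightarrow> a = b"
  using elts_inject[of a b] nonempty_not_indiv[of x a] nonempty_not_indiv[of x b] by simp

lemma set_exists:
  "enat n < h \<Longrightarrow> S \<subseteq> level E X n \<Longrightarrow> \<exists>a. a \<notin> X \<and> elts E a = S \<and> a \<in> level E X (Suc n)"
proof -
  assume *: "enat n < h" "S \<subseteq> level E X n"
  with superstructure obtain a where "a \<notin> X" "elts E a = S"
    unfolding superstructure_def by blast
  with * show ?thesis by auto
qed

lemma is_pair_unique: "is_pair E p x y \<Longrightarrow> is_pair E p' x y \<Longrightarrow> p = p'"
proof -
  assume "is_pair E p x y" "is_pair E p' x y"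
  then obtain s t s' t' where
    s: "elts E s = {x}" "elts E t = {x, y}" "elts E p = {s, t}"
       "elts E s' = {x}" "elts E t' = {x, y}" "elts E p' = {s', t'}"
    by (force simp: is_pair_def)
  then have "s = s'" "t = t'" using elts_eqI[of s s' x] elts_eqI[of t t' x] by simp_all
  then show ?thesis using s elts_eqI[of p p' s] by simp
qed

lemma in_level: "\<exists>n. enat n \<le> h \<and> a \<in> level E X n"
  using superstructure by (auto simp: superstructure_def)

text \<open>Members of a set lie in a level strictly earlier than the set. The strict bound against
  \<open>h\<close> leaves room to code that level as an object, see \<open>lev\<close>.\<close>

lemma elts_subset_level:
  assumes "b \<in> elts E a"
  shows "\<exists>n. enat n < h \<and> elts E a \<subseteq> level E X n"
proof -
  obtain n where n: "enat n \<le> h" "a \<in> level E X n" using in_level by blast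
  from n(2) have "\<exists>k<n. elts E a \<subseteq> level E X k"
  proof (induction n)
    case 0
    then show ?case using assms elts_indiv by auto
  next
    case (Suc n)
    then show ?case using less_Suc_eq by auto
  qed
  then show ?thesis using n(1) by (metis enat_ord_simps(2) order_less_le_trans)
qed

text \<open>Separation does not climb the hierarchy. At level 0 the only subset is empty and
  \<open>a\<close> itself has that extension, being an individual.\<close>

lemma level_subset_exists:
  assumes "a \<in> level E X n" "enat n \<le> h" "S \<subseteq> elts E a"
  shows "\<exists>b\<in>level E X n. elts E b = S"
  using assms
proof (induction n)
  case 0
  then show ?case using elts_indiv by auto
next
  case (Suc n)
  show ?case
  proof (cases "a \<in> level E X n")
    case True
    then show ?thesis
      using Suc.IH Suc.prems level_mono[of n "Suc n"] by (fastforce simp: Suc_ile_eq)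
  next
    case False
    then have "S \<subseteq> level E X n" using Suc.prems by auto
    then show ?thesis using set_exists[of n S] Suc.prems by (auto simp: Suc_ile_eq)
  qed
qed

lemma is_pair_exists:
  assumes "x \<in> level E X n" "y \<in> level E X n" "enat (Suc n) < h"
  shows "\<exists>p\<in>level E X (n+2). is_pair E p x y"
proof -
  have n: "enat n < h" using assms(3) by (metis Suc_ile_eq order_less_imp_le)
  obtain s where s: "elts E s = {x}" "s \<in> level E X (Suc n)"
    using set_exists[OF n, of "{x}"] assms by auto
  obtain t where t: "elts E t = {x, y}" "t \<in> level E X (Suc n)"
    using set_exists[OF n, of "{x, y}"] assms by auto
  obtain p where "elts E p = {s, t}" "p \<in> level E X (Suc (Suc n))"
    using set_exists[OF assms(3), of "{s, t}"] s t by auto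
  then have "is_pair E p x y" "p \<in> level E X (n+2)" using s t by (auto simp only: is_pair_def add_2_eq_Suc') 
  then show ?thesis by blast
qed

lemma is_pair_level:
  assumes "is_pair E p x y" "x \<in> level E X n" "y \<in> level E X n"
  shows "p \<in> level E X (n+2)"
proof -
  have lev: "a \<in> level E X (Suc k)" if "elts E a \<subseteq> level E X k" "b \<in> elts E a" for a b k
    using that nonempty_not_indiv by auto
  obtain s t where s: "elts E s = {x}" "elts E t = {x, y}" "elts E p = {s, t}"
    using assms(1) by (force simp: is_pair_def)
  have "s \<in> level E X (Suc n)" "t \<in> level E X (Suc n)"
    using lev[of s n x] lev[of t n x] s assms by simp_all
  then show ?thesis using lev[of p "Suc n" s] s by simp
qed

end

lemma app_eq: "app E f x = (THE y. grel E f x y)"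
  by (simp add: app_def grel_def)

lemma app2_eq: "app2 E f x y = (THE z. grel3 E f x y z)"
  by (simp add: app2_def grel3_def)

section \<open>Transfer and standard constants\<close>

locale nonstd =
  fixes U :: "('u, 'w) nsu"
  assumes univ: "nonstandard_universe U"
begin

sublocale S: superstr "smem U" "indiv U" "height U"
  using univ by unfold_locales (simp add: nonstandard_universe_def)

sublocale N: superstr "nmem U" "nelts U (star U (code U (indiv U)))" "height U"
  using univ by unfold_locales (simp add: nonstandard_universe_def)

lemma transfer: "sat (smem U) e \<phi> \<longleftrightarrow> sat (nmem U) (star U \<circ> e) \<phi>"
  using univ by (simp add: nonstandard_universe_def)

lemma height: "n < 5 \<Longrightarrow> enat n < height U"
proof -
  assume "n < 5"
  then have "enat n < enat 5" by simp
  moreover have "enat 5 \<le> height U"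
    using univ by (simp add: nonstandard_universe_def numeral_eq_enat)
  ultimately show ?thesis by (rule order_less_le_trans)
qed

lemma cnum_eq [simp]: "cnum U x = cnum U y \<longleftrightarrow> x = y"
  using univ by (auto simp: nonstandard_universe_def inj_eq)

lemma cnum_image [simp]: "cnum U x \<in> cnum U ` A \<longleftrightarrow> x \<in> A"
  by auto

lemma cnum_indiv: "cnum U x \<in> indiv U"
  using univ by (auto simp: nonstandard_universe_def)

lemma elts_code:
  assumes "A \<subseteq> level (smem U) (indiv U) n" "enat n < height U"
  shows "elts (smem U) (code U A) = A"
proof -
  obtain a where a: "a \<notin> indiv U" "elts (smem U) a = A"
    using S.set_exists[OF assms(2,1)] by blast
  then have "code U A = a"
    unfolding code_def using S.elts_inject a by (intro the_equality) auto
  then show ?thesis using a by simp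
qed

lemma elts_cset [simp]: "elts (smem U) (code U (cnum U ` A)) = cnum U ` A"
  by (rule elts_code[of _ 0]) (use cnum_indiv height in auto)

definition graph2 :: "(complex \<Rightarrow> complex \<Rightarrow> bool) \<Rightarrow> 'u" where
  "graph2 R = code U {p. \<exists>x y. R x y \<and> is_pair (smem U) p (cnum U x) (cnum U y)}"

definition graph3 :: "(complex \<Rightarrow> complex \<Rightarrow> complex \<Rightarrow> bool) \<Rightarrow> 'u" where
  "graph3 R = code U {p. \<exists>x y z. R x y z \<and> is_triple (smem U) p (cnum U x) (cnum U y) (cnum U z)}"

lemma cnum_level: "cnum U x \<in> level (smem U) (indiv U) n"
  using level_mono[of 0 n "smem U" "indiv U"] cnum_indiv by auto

lemma elts_graph2:
  "elts (smem U) (graph2 R) = {p. \<exists>x y. R x y \<and> is_pair (smem U) p (cnum U x) (cnum U y)}"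
  unfolding graph2_def
proof (rule elts_code[of _ 2])
  show "{p. \<exists>x y. R x y \<and> is_pair (smem U) p (cnum U x) (cnum U y)} \<subseteq> level (smem U) (indiv U) 2"
    using S.is_pair_level[of _ _ _ 0, unfolded add_0] cnum_level by blast
qed (simp add: height)

lemma elts_graph3:
  "elts (smem U) (graph3 R) =
    {p. \<exists>x y z. R x y z \<and> is_triple (smem U) p (cnum U x) (cnum U y) (cnum U z)}"
  unfolding graph3_def
\<comment> \<open>A pair of individuals lies in level 2 and a triple in level 4, so the graph needs
  level 5, exactly the height that is assumed.\<close>
proof (rule elts_code[of _ 4])
  have "p \<in> level (smem U) (indiv U) 4"
    if "is_triple (smem U) p (cnum U x) (cnum U y) (cnum U z)" for p x y z
  proof -
    from that obtain q where q: "is_pair (smem U) q (cnum U x) (cnum U y)" "is_pair (smem U) p q (cnum U z)"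
      by (auto simp: is_triple_def)
    have "q \<in> level (smem U) (indiv U) (0 + 2)"
      by (rule S.is_pair_level[OF q(1)]) (rule cnum_level)+
    then have "p \<in> level (smem U) (indiv U) (2 + 2)"
      by (intro S.is_pair_level[OF q(2)]) (simp_all only: cnum_level add_0)
    then show ?thesis by (simp del: level.simps)
  qed
  then show "{p. \<exists>x y z. R x y z \<and> is_triple (smem U) p (cnum U x) (cnum U y) (cnum U z)}
      \<subseteq> level (smem U) (indiv U) 4"
    by blast
qed (simp add: height)

lemma cnum_pair_exists: "\<exists>p. is_pair (smem U) p (cnum U x) (cnum U y)"
  using S.is_pair_exists[OF cnum_level[of x 0] cnum_level[of y 0]] height[of 1] by auto

lemma cnum_triple_exists: "\<exists>p. is_triple (smem U) p (cnum U x) (cnum U y) (cnum U z)"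
proof -
  obtain q where q: "is_pair (smem U) q (cnum U x) (cnum U y)"
    using cnum_pair_exists by blast
  have "q \<in> level (smem U) (indiv U) (0 + 2)"
    by (rule S.is_pair_level[OF q]) (rule cnum_level)+
  then obtain p where "is_pair (smem U) p q (cnum U z)"
    using S.is_pair_exists[OF _ cnum_level, of q 2 z] height[of 3]
    by (auto simp del: level.simps simp: numeral_eq_Suc)
  then show ?thesis using q by (auto simp: is_triple_def)
qed

lemma grel_graph2 [simp]: "grel (smem U) (graph2 R) (cnum U x) (cnum U y) \<longleftrightarrow> R x y"
proof
  assume "grel (smem U) (graph2 R) (cnum U x) (cnum U y)"
  then obtain p x' y' where "is_pair (smem U) p (cnum U x) (cnum U y)"
    "R x' y'" "is_pair (smem U) p (cnum U x') (cnum U y')"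
    by (auto simp: grel_def elts_graph2)
  then show "R x y" using is_pair_inj[of "smem U" p "cnum U x" "cnum U y"] by fastforce
next
  assume "R x y"
  then show "grel (smem U) (graph2 R) (cnum U x) (cnum U y)"
    using cnum_pair_exists[of x y] by (auto simp: grel_def elts_graph2)
qed

lemma grel3_graph3 [simp]:
  "grel3 (smem U) (graph3 R) (cnum U x) (cnum U y) (cnum U z) \<longleftrightarrow> R x y z"
proof
  assume "grel3 (smem U) (graph3 R) (cnum U x) (cnum U y) (cnum U z)"
  then obtain p x' y' z' where "is_triple (smem U) p (cnum U x) (cnum U y) (cnum U z)"
    "R x' y' z'" "is_triple (smem U) p (cnum U x') (cnum U y') (cnum U z')"
    by (auto simp: grel3_def elts_graph3)
  then show "R x y z"
    using is_triple_inj[of "smem U" p "cnum U x" "cnum U y" "cnum U z"] by fastforce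
next
  assume "R x y z"
  then show "grel3 (smem U) (graph3 R) (cnum U x) (cnum U y) (cnum U z)"
    using cnum_triple_exists[of x y z] by (auto simp: grel3_def elts_graph3)
qed

definition nrel3 :: "(complex \<Rightarrow> complex \<Rightarrow> complex \<Rightarrow> bool) \<Rightarrow> 'w \<Rightarrow> 'w \<Rightarrow> 'w \<Rightarrow> bool" where
  "nrel3 R = grel3 (nmem U) (star U (graph3 R))"

lemma star_cset: "star U (code U (cnum U ` A)) = nset U A"
  by (simp add: nset_def)

lemma grel_star_graph2: "grel (nmem U) (star U (graph2 R)) x y \<longleftrightarrow> nrel U R x y"
  by (simp add: nrel_def grel_def graph2_def)

lemma grel3_star_graph3: "grel3 (nmem U) (star U (graph3 R)) x y z \<longleftrightarrow> nrel3 R x y z"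
  by (simp add: nrel3_def)

lemmas star_simps = star_cset grel_star_graph2 grel3_star_graph3

text \<open>The pattern of the transfers below: the constants sit in a list and are the variables 0,
  1, ...; bound variables start at 10, and positions past the list are never consulted.\<close>

lemma nset_compl: "x \<in> nC U \<Longrightarrow> x \<in> nelts U (nset U (- A)) \<longleftrightarrow> x \<notin> nelts U (nset U A)"
  using transfer[of "(!) [code U (cnum U ` UNIV), code U (cnum U ` A), code U (cnum U ` (- A))]"
    "FBAll 10 0 (FIff (FMem 10 2) (FNeg (FMem 10 1)))"]
  by (simp add: star_simps)

lemma nset_Int: "nelts U (nset U (A \<inter> B)) = nelts U (nset U A) \<inter> nelts U (nset U B)"
  using transfer[of "(!) [code U (cnum U ` (A \<inter> B)), code U (cnum U ` A), code U (cnum U ` B)]"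
    "FConj (FBAll 10 0 (FConj (FMem 10 1) (FMem 10 2)))
      (FBAll 10 1 (FImp (FMem 10 2) (FMem 10 0)))"]
  by (auto simp add: star_simps image_iff)

lemma nset_mono: "A \<subseteq> B \<Longrightarrow> nelts U (nset U A) \<subseteq> nelts U (nset U B)"
  by (metis nset_Int Int_absorb1 Int_lower2 inf.orderE)

lemma nset_nC: "x \<in> nelts U (nset U A) \<Longrightarrow> x \<in> nC U"
  using nset_mono[of A UNIV] by blast

lemma nset_empty [simp]: "nelts U (nset U {}) = {}"
  using nset_Int[of "{}" "- {}"] nset_compl[of _ "{}"] nset_nC[of _ "{}"] by auto

lemma nrel_nC: "nrel U R x y \<Longrightarrow> x \<in> nC U \<and> y \<in> nC U"
proof -
  assume "nrel U R x y"
  then obtain p where p: "p \<in> nelts U (star U (graph2 R))" "is_pair (nmem U) p x y"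
    by (auto simp: nrel_def graph2_def)
  have "\<forall>p\<in>nelts U (star U (graph2 R)). \<exists>x\<in>nC U. \<exists>y\<in>nC U. is_pair (nmem U) p x y"
    using transfer[of "(!) [code U (cnum U ` UNIV), graph2 R]"
      "FBAll 10 1 (FBEx 11 0 (FBEx 12 0 (FPair 50 10 11 12)))"]
    by (auto simp add: star_simps sat_FPair elts_graph2)
  then show ?thesis using p is_pair_inj by metis
qed

lemma nrel3_nC: "nrel3 R x y z \<Longrightarrow> x \<in> nC U \<and> y \<in> nC U \<and> z \<in> nC U"
proof -
  assume "nrel3 R x y z"
  then obtain p where p: "p \<in> nelts U (star U (graph3 R))" "is_triple (nmem U) p x y z"
    by (auto simp: nrel3_def grel3_def)
  have "\<forall>p\<in>nelts U (star U (graph3 R)). \<exists>x\<in>nC U. \<exists>y\<in>nC U. \<exists>z\<in>nC U. is_triple (nmem U) p x y z"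
    using transfer[of "(!) [code U (cnum U ` UNIV), graph3 R]"
      "FBAll 10 1 (FBEx 11 0 (FBEx 12 0 (FBEx 13 0 (FTriple 50 10 11 12 13))))"]
    by (auto simp add: star_simps sat_FTriple elts_graph3)
  then show ?thesis using p is_triple_inj by metis
qed

lemma nrel_fun_ex: "x \<in> nC U \<Longrightarrow> \<exists>y\<in>nC U. nrel U (\<lambda>x y. y = f x) x y"
  using transfer[of "(!) [code U (cnum U ` UNIV), graph2 (\<lambda>x y. y = f x)]"
    "FBAll 10 0 (FBEx 11 0 (FRel 1 10 11))"]
  by (simp add: star_simps)

lemma nrel_fun_unique:
  assumes "nrel U (\<lambda>x y. y = f x) x y" "nrel U (\<lambda>x y. y = f x) x y'"
  shows "y = y'"
  using transfer[of "(!) [code U (cnum U ` UNIV), graph2 (\<lambda>x y. y = f x)]"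
    "FBAll 10 0 (FBAll 11 0 (FBAll 12 0 (FImp (FConj (FRel 1 10 11) (FRel 1 10 12)) (FEq 11 12))))"]
    nrel_nC[OF assms(1)] nrel_nC[OF assms(2)] assms
  by (simp add: star_simps) blast

lemma nrel3_fun_unique:
  assumes "nrel3 (\<lambda>x y z. z = f x y) x y z" "nrel3 (\<lambda>x y z. z = f x y) x y z'"
  shows "z = z'"
  using transfer[of "(!) [code U (cnum U ` UNIV), graph3 (\<lambda>x y z. z = f x y)]"
    "FBAll 10 0 (FBAll 11 0 (FBAll 12 0 (FBAll 13 0
      (FImp (FConj (FRel3 1 10 11 12) (FRel3 1 10 11 13)) (FEq 12 13)))))"]
    nrel3_nC[OF assms(1)] nrel3_nC[OF assms(2)] assms
  by (simp add: star_simps) blast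

lemma nfun_eqI: "nrel U (\<lambda>x y. y = f x) x y \<Longrightarrow> nfun U f x = y"
proof -
  have "graph2 (\<lambda>x y. y = f x) = code U {p. \<exists>x. is_pair (smem U) p (cnum U x) (cnum U (f x))}"
    by (simp add: graph2_def)
  then have "nfun U f x = (THE y. nrel U (\<lambda>x y. y = f x) x y)"
    unfolding nfun_def app_eq by (simp add: grel_star_graph2[symmetric])
  then show "nrel U (\<lambda>x y. y = f x) x y \<Longrightarrow> nfun U f x = y"
    using nrel_fun_unique by auto
qed

lemma nfun2_eqI: "nrel3 (\<lambda>x y z. z = f x y) x y z \<Longrightarrow> nfun2 U f x y = z"
proof -
  have "graph3 (\<lambda>x y z. z = f x y) =
      code U {p. \<exists>x y. is_triple (smem U) p (cnum U x) (cnum U y) (cnum U (f x y))}"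
    by (simp add: graph3_def)
  then have "nfun2 U f x y = (THE z. nrel3 (\<lambda>x y z. z = f x y) x y z)"
    unfolding nfun2_def app2_eq nrel3_def by simp
  then show "nrel3 (\<lambda>x y z. z = f x y) x y z \<Longrightarrow> nfun2 U f x y = z"
    using nrel3_fun_unique by auto
qed

lemma nfun_rel:
  assumes "x \<in> nC U"
  shows "nrel U (\<lambda>x y. y = f x) x (nfun U f x)"
  using nrel_fun_ex[OF assms, of f] nfun_eqI by auto

lemma nfun_nC [simp]: "x \<in> nC U \<Longrightarrow> nfun U f x \<in> nC U"
  using nfun_rel nrel_nC by blast

lemma nfun_nset:
  assumes "w \<in> nC U"
  shows "nfun U f w \<in> nelts U (nset U A) \<longleftrightarrow> w \<in> nelts U (nset U {z. f z \<in> A})"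
  using transfer[of "(!) [code U (cnum U ` UNIV), graph2 (\<lambda>x y. y = f x),
      code U (cnum U ` A), code U (cnum U ` {z. f z \<in> A})]"
    "FBAll 10 0 (FBAll 11 0 (FImp (FRel 1 10 11) (FIff (FMem 11 2) (FMem 10 3))))"]
    nfun_rel[OF assms] assms
  by (simp add: star_simps)

lemma nrel_nfun:
  assumes "w \<in> nC U"
  shows "nrel U R (nfun U f w) (nfun U g w) \<longleftrightarrow> w \<in> nelts U (nset U {z. R (f z) (g z)})"
  using transfer[of "(!) [code U (cnum U ` UNIV), graph2 (\<lambda>x y. y = f x), graph2 (\<lambda>x y. y = g x),
      graph2 R, code U (cnum U ` {z. R (f z) (g z)})]"
    "FBAll 10 0 (FBAll 11 0 (FBAll 12 0 (FImp (FConj (FRel 1 10 11) (FRel 2 10 12))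
      (FIff (FRel 3 11 12) (FMem 10 4)))))"]
    nfun_rel[OF assms] assms
  by (simp add: star_simps)

lemma nfun_eq:
  assumes "w \<in> nC U"
  shows "nfun U f w = nfun U g w \<longleftrightarrow> w \<in> nelts U (nset U {z. f z = g z})"
  using transfer[of "(!) [code U (cnum U ` UNIV), graph2 (\<lambda>x y. y = f x), graph2 (\<lambda>x y. y = g x),
      code U (cnum U ` {z. f z = g z})]"
    "FBAll 10 0 (FBAll 11 0 (FBAll 12 0 (FImp (FConj (FRel 1 10 11) (FRel 2 10 12))
      (FIff (FEq 11 12) (FMem 10 3)))))"]
    nfun_rel[OF assms] assms
  by (simp add: star_simps)

lemma nfun2_nfun:
  assumes "w \<in> nC U"
  shows "nfun2 U k (nfun U f w) (nfun U g w) = nfun U (\<lambda>z. k (f z) (g z)) w"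
  using transfer[of "(!) [code U (cnum U ` UNIV), graph2 (\<lambda>x y. y = f x), graph2 (\<lambda>x y. y = g x),
      graph2 (\<lambda>x y. y = k (f x) (g x)), graph3 (\<lambda>x y z. z = k x y)]"
    "FBAll 10 0 (FBAll 11 0 (FBAll 12 0 (FBAll 13 0
      (FImp (FConj (FRel 1 10 11) (FConj (FRel 2 10 12) (FRel 3 10 13))) (FRel3 4 11 12 13)))))"]
    nfun_rel[OF assms] assms
  by (intro nfun2_eqI) (simp add: star_simps)

lemma nfun_nfun:
  assumes "w \<in> nC U"
  shows "nfun U k (nfun U f w) = nfun U (\<lambda>z. k (f z)) w"
  using transfer[of "(!) [code U (cnum U ` UNIV), graph2 (\<lambda>x y. y = f x),
      graph2 (\<lambda>x y. y = k (f x)), graph2 (\<lambda>x y. y = k x)]"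
    "FBAll 10 0 (FBAll 11 0 (FBAll 12 0
      (FImp (FConj (FRel 1 10 11) (FRel 2 10 12)) (FRel 3 11 12))))"]
    nfun_rel[OF assms] assms
  by (intro nfun_eqI) (simp add: star_simps)

lemma nfun_ident: "w \<in> nC U \<Longrightarrow> nfun U (\<lambda>z. z) w = w"
  using transfer[of "(!) [code U (cnum U ` UNIV), graph2 (\<lambda>x y. y = x)]"
    "FBAll 10 0 (FRel 1 10 10)"]
  by (intro nfun_eqI) (simp add: star_simps)

lemma num_nfun:
  assumes "w \<in> nC U"
  shows "num U c = nfun U (\<lambda>_. c) w"
  using transfer[of "(!) [code U (cnum U ` UNIV), graph2 (\<lambda>x y. y = c), cnum U c]"
    "FBAll 10 0 (FRel 1 10 2)"] assms
  by (intro nfun_eqI[symmetric]) (simp add: star_simps num_def)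

lemma num_nset [simp]: "num U c \<in> nelts U (nset U A) \<longleftrightarrow> c \<in> A"
  using transfer[of "(!) [code U (cnum U ` A), cnum U c]" "FMem 1 0"]
  by (simp add: star_simps num_def image_iff)

text \<open>An infinite set is equinumerous with its square, so a standard bijection
  \<open>pr\<close> codes pairs of complex numbers by one number. Transferring its two coordinates
  makes \<open>x\<close> and \<open>y\<close> standard functions of a common \<open>w\<close>, and
  thus germs along a single ultrafilter.\<close>

lemma pairing_ex:
  assumes "x \<in> nC U" "y \<in> nC U"
  shows "\<exists>w f g. w \<in> nC U \<and> x = nfun U f w \<and> y = nfun U g w"
proof -
  have "infinite (UNIV :: complex set)"
    by (rule infinite_UNIV_char_0)
  then have "|(UNIV :: complex set) \<times> (UNIV :: complex set)| =o |UNIV :: complex set|"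
    by (rule card_of_Times_same_infinite)
  then obtain pr :: "complex \<times> complex \<Rightarrow> complex" where "bij pr"
    by (auto simp flip: card_of_ordIso)
  then have "inj pr" by (simp add: bij_def)
  then have inv: "inv pr (pr (a, b)) = (a, b)" for a b by simp
  have "\<forall>x\<in>nC U. \<forall>y\<in>nC U. \<exists>w\<in>nC U. nrel U (\<lambda>x y. y = fst (inv pr x)) w x \<and>
      nrel U (\<lambda>x y. y = snd (inv pr x)) w y"
    using transfer[of "(!) [code U (cnum U ` UNIV), graph2 (\<lambda>x y. y = fst (inv pr x)),
        graph2 (\<lambda>x y. y = snd (inv pr x))]"
      "FBAll 10 0 (FBAll 11 0 (FBEx 12 0 (FConj (FRel 1 12 10) (FRel 2 12 11))))"]
    by (simp add: star_simps) (metis inv fst_conv snd_conv)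
  then show ?thesis using assms nfun_eqI by metis
qed

end

context nonstd
begin

section \<open>Nonstandard numbers as germs\<close>

text \<open>
  Every element of \<open>*C\<close> is of the form \<open>nfun U f w\<close>, and the standard sets \<open>A\<close> with \<open>w \<in> *A\<close>
  form an ultrafilter; relations between such elements become eventual relations between functions.
\<close>

definition ufil :: "'w \<Rightarrow> complex filter" where
  "ufil w = Abs_filter (\<lambda>P. w \<in> nelts U (nset U {z. P z}))"

lemma eventually_ufil:
  assumes "w \<in> nC U"
  shows "eventually P (ufil w) \<longleftrightarrow> w \<in> nelts U (nset U {z. P z})"
  unfolding ufil_def
proof (rule eventually_Abs_filter, unfold_locales)
  show "w \<in> nelts U (nset U {z. True})" using assms by simp
  show "w \<in> nelts U (nset U {z. P z \<and> Q z})"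
    if "w \<in> nelts U (nset U {z. P z})" "w \<in> nelts U (nset U {z. Q z})" for P Q
    using that by (simp add: Collect_conj_eq nset_Int)
  show "w \<in> nelts U (nset U {z. Q z})"
    if "\<forall>z. P z \<longrightarrow> Q z" "w \<in> nelts U (nset U {z. P z})" for P Q
    using that nset_mono[of "{z. P z}" "{z. Q z}"] by auto
qed

lemma ufil_not:
  assumes "w \<in> nC U"
  shows "eventually (\<lambda>z. \<not> P z) (ufil w) \<longleftrightarrow> \<not> eventually P (ufil w)"
  using nset_compl[OF assms, of "{z. P z}"] assms by (simp add: eventually_ufil Collect_neg_eq)

lemma ufil_neq_bot: "w \<in> nC U \<Longrightarrow> ufil w \<noteq> bot"
  by (simp add: trivial_limit_def eventually_ufil)

text \<open>Compactness of a closed ball gives a cluster point, and an ultrafilter converges to each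
  of its cluster points: a neighbourhood whose preimage is not in the ultrafilter has its complement
  there.\<close>

lemma ufil_convergent:
  assumes w: "w \<in> nC U" and b: "eventually (\<lambda>z. norm (f z) \<le> B) (ufil w)"
  shows "\<exists>c::complex. (f \<longlongrightarrow> c) (ufil w)"
proof -
  have "\<exists>c\<in>cball 0 B. inf (nhds c) (filtermap f (ufil w)) \<noteq> bot"
    using compact_cball[of "0::complex" B] ufil_neq_bot[OF w] b
    unfolding compact_filter
    by (simp add: eventually_filtermap filtermap_bot_iff)
  then obtain c where c: "inf (nhds c) (filtermap f (ufil w)) \<noteq> bot" by blast
  have "eventually (\<lambda>z. f z \<in> S) (ufil w)" if S: "open S" "c \<in> S" for S
  proof (rule ccontr)
    assume "\<not> eventually (\<lambda>z. f z \<in> S) (ufil w)"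
    then have "eventually (\<lambda>z. z \<notin> S) (filtermap f (ufil w))"
      using ufil_not[OF w] by (simp add: eventually_filtermap)
    moreover have "eventually (\<lambda>z. z \<in> S) (nhds c)"
      using S by (rule eventually_nhds_in_open)
    ultimately have "eventually (\<lambda>z. False) (inf (nhds c) (filtermap f (ufil w)))"
      unfolding eventually_inf by blast
    then show False using c by (simp add: trivial_limit_def)
  qed
  then show ?thesis by (auto simp: tendsto_def)
qed

lemma pairing_ex3:
  assumes "x \<in> nC U" "y \<in> nC U" "z \<in> nC U"
  shows "\<exists>w f g h. w \<in> nC U \<and> x = nfun U f w \<and> y = nfun U g w \<and> z = nfun U h w"
proof -
  obtain v f g where v: "v \<in> nC U" "x = nfun U f v" "y = nfun U g v"
    using pairing_ex[OF assms(1,2)] by blast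
  obtain w k h where w: "w \<in> nC U" "v = nfun U k w" "z = nfun U h w"
    using pairing_ex[OF v(1) assms(3)] by blast
  show ?thesis
    using v w by (intro exI[of _ w] exI[of _ "\<lambda>z. f (k z)"] exI[of _ "\<lambda>z. g (k z)"] exI[of _ h])
      (simp add: nfun_nfun)
qed

lemma nset_germ: "w \<in> nC U \<Longrightarrow> nfun U f w \<in> nelts U (nset U A) \<longleftrightarrow> eventually (\<lambda>z. f z \<in> A) (ufil w)"
  by (simp add: nfun_nset eventually_ufil)

lemma nplus_germ: "w \<in> nC U \<Longrightarrow> nplus U (nfun U f w) (nfun U g w) = nfun U (\<lambda>z. f z + g z) w"
  and nminus_germ: "w \<in> nC U \<Longrightarrow> nminus U (nfun U f w) (nfun U g w) = nfun U (\<lambda>z. f z - g z) w"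
  and ntimes_germ: "w \<in> nC U \<Longrightarrow> ntimes U (nfun U f w) (nfun U g w) = nfun U (\<lambda>z. f z * g z) w"
  and ncnj_germ: "w \<in> nC U \<Longrightarrow> ncnj U (nfun U f w) = nfun U (\<lambda>z. cnj (f z)) w"
  and nabs_germ: "w \<in> nC U \<Longrightarrow> nabs U (nfun U f w) = nfun U (\<lambda>z. complex_of_real (cmod (f z))) w"
  by (simp_all add: nplus_def nminus_def ntimes_def ncnj_def nabs_def nfun2_nfun nfun_nfun)

lemma nle_germ: "w \<in> nC U \<Longrightarrow> nle U (nfun U f w) (nfun U g w) \<longleftrightarrow>
    eventually (\<lambda>z. f z \<in> \<real> \<and> g z \<in> \<real> \<and> Re (f z) \<le> Re (g z)) (ufil w)"
  and nless_germ: "w \<in> nC U \<Longrightarrow> nless U (nfun U f w) (nfun U g w) \<longleftrightarrow>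
    eventually (\<lambda>z. f z \<in> \<real> \<and> g z \<in> \<real> \<and> Re (f z) < Re (g z)) (ufil w)"
  by (simp_all add: nle_def nless_def nrel_nfun eventually_ufil)

lemma eq_germ: "w \<in> nC U \<Longrightarrow> nfun U f w = nfun U g w \<longleftrightarrow> eventually (\<lambda>z. f z = g z) (ufil w)"
  by (simp add: nfun_eq eventually_ufil)

lemmas germ_simps = nset_germ nplus_germ nminus_germ ntimes_germ ncnj_germ nabs_germ
  nle_germ nless_germ eq_germ nfun_nfun

lemma nfinite_germ:
  assumes "w \<in> nC U"
  shows "nfinite U (nfun U f w) \<longleftrightarrow> (\<exists>n::nat. eventually (\<lambda>z. cmod (f z) < n) (ufil w))"
  using assms by (simp add: nfinite_def num_nfun[OF assms] germ_simps)

lemma napprox_germ: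
  assumes "w \<in> nC U"
  shows "napprox U (nfun U f w) (nfun U g w) \<longleftrightarrow> ((\<lambda>z. f z - g z) \<longlongrightarrow> 0) (ufil w)"
proof -
  have *: "napprox U (nfun U f w) (nfun U g w) \<longleftrightarrow>
      (\<forall>n::nat. n \<ge> 1 \<longrightarrow> eventually (\<lambda>z. cmod (f z - g z) < 1 / real n) (ufil w))"
    using assms by (simp add: napprox_def num_nfun[OF assms] germ_simps Re_divide_of_nat)
  show ?thesis
  proof
    assume L: "napprox U (nfun U f w) (nfun U g w)"
    show "((\<lambda>z. f z - g z) \<longlongrightarrow> 0) (ufil w)"
    proof (rule tendstoI)
      fix e :: real
      assume "e > 0"
      then obtain n where n: "n \<noteq> 0" "inverse (of_nat n) < e"
        using ex_inverse_of_nat_less by blast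
      then have "eventually (\<lambda>z. cmod (f z - g z) < 1 / real n) (ufil w)"
        using L * by simp
      then show "eventually (\<lambda>z. dist (f z - g z) 0 < e) (ufil w)"
        by (rule eventually_mono) (use n in \<open>simp add: inverse_eq_divide\<close>)
    qed
  next
    assume R: "((\<lambda>z. f z - g z) \<longlongrightarrow> 0) (ufil w)"
    show "napprox U (nfun U f w) (nfun U g w)"
      unfolding * using tendstoD[OF R] by auto
  qed
qed

section \<open>Standard parts\<close>

text \<open>The standard part as a relation, complex valued: it can be combined by
  \<open>apx_nplus\<close> and \<open>apx_ntimes\<close> without first proving finiteness.
  Membership in \<open>nC\<close> is included because the arithmetic operations are unspecified
  elsewhere.\<close>

definition apx :: "'w \<Rightarrow> complex \<Rightarrow> bool" where
  "apx x c \<longleftrightarrow> x \<in> nC U \<and> napprox U x (num U c)"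

lemma apx_nC: "apx x c \<Longrightarrow> x \<in> nC U"
  by (simp add: apx_def)

lemma apx_germ:
  assumes "w \<in> nC U"
  shows "apx (nfun U f w) c \<longleftrightarrow> (f \<longlongrightarrow> c) (ufil w)"
  using assms by (simp add: apx_def num_nfun[OF assms] napprox_germ Lim_null[of f c])

lemma apx_num: "apx (num U c) c"
  using apx_germ[of "num U c" "\<lambda>_. c" c] num_nfun[of "num U c" c] by simp

lemma germ2:
  assumes "x \<in> nC U" "y \<in> nC U"
  obtains w f g where "w \<in> nC U" "x = nfun U f w" "y = nfun U g w"
  using pairing_ex[OF assms] by blast

lemma germ3:
  assumes "x \<in> nC U" "y \<in> nC U" "z \<in> nC U"
  obtains w f g h where "w \<in> nC U" "x = nfun U f w" "y = nfun U g w" "z = nfun U h w"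
  using pairing_ex3[OF assms] by blast

text \<open>Every \<open>x\<close> is the germ of the identity at itself, so its standard part is
  the limit of its own ultrafilter.\<close>

lemma apx_ufil:
  assumes "x \<in> nC U"
  shows "apx x c \<longleftrightarrow> ((\<lambda>z. z) \<longlongrightarrow> c) (ufil x)"
  using apx_germ[OF assms, of "\<lambda>z. z"] assms by (simp add: nfun_ident)

lemma apx_unique:
  assumes "apx x c" "apx x d"
  shows "c = d"
  using tendsto_unique[OF ufil_neq_bot[OF apx_nC[OF assms(1)]]] assms
    apx_ufil[OF apx_nC[OF assms(1)]] by blast

lemma apx_nplus: "apx x c \<Longrightarrow> apx y d \<Longrightarrow> apx (nplus U x y) (c + d)"
  and apx_ntimes: "apx x c \<Longrightarrow> apx y d \<Longrightarrow> apx (ntimes U x y) (c * d)"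
  by (rule germ2[of x y]; auto simp: apx_nC germ_simps apx_germ intro!: tendsto_intros)+

lemma apx_nfun:
  assumes "apx x c" "isCont g c"
  shows "apx (nfun U g x) (g c)"
proof -
  have "x = nfun U (\<lambda>z. z) x" using apx_nC[OF assms(1)] by (simp add: nfun_ident)
  then have "((\<lambda>z. z) \<longlongrightarrow> c) (ufil x)"
    using assms(1) apx_germ[OF apx_nC[OF assms(1)], of "\<lambda>z. z" c] by simp
  then have "((\<lambda>z. g z) \<longlongrightarrow> g c) (ufil x)"
    using assms(2) by (rule isCont_tendsto_compose[rotated])
  then show ?thesis using apx_germ[OF apx_nC[OF assms(1)]] by simp
qed

lemma apx_ncnj: "apx x c \<Longrightarrow> apx (ncnj U x) (cnj c)"
  unfolding ncnj_def by (rule apx_nfun) auto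

lemma nle_nC: "nle U x y \<Longrightarrow> x \<in> nR U \<and> y \<in> nR U"
proof -
  assume *: "nle U x y"
  then have "x \<in> nC U" "y \<in> nC U" using nrel_nC unfolding nle_def by blast+
  then obtain w f g where w: "w \<in> nC U" "x = nfun U f w" "y = nfun U g w" by (rule germ2)
  show ?thesis using * w by (auto simp: germ_simps elim: eventually_mono)
qed

lemma apx_nle:
  assumes "apx x c" "apx y d" "nle U x y"
  shows "Re c \<le> Re d"
proof -
  obtain w f g where w: "w \<in> nC U" "x = nfun U f w" "y = nfun U g w"
    by (rule germ2[OF apx_nC[OF assms(1)] apx_nC[OF assms(2)]])
  have "((\<lambda>z. Re (f z)) \<longlongrightarrow> Re c) (ufil w)" "((\<lambda>z. Re (g z)) \<longlongrightarrow> Re d) (ufil w)"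
    using assms(1,2) w by (auto simp: apx_germ intro!: tendsto_intros)
  moreover have "eventually (\<lambda>z. Re (f z) \<le> Re (g z)) (ufil w)"
    using assms(3) w by (auto simp: germ_simps elim: eventually_mono)
  ultimately show ?thesis
    using tendsto_le[OF ufil_neq_bot[OF w(1)]] by blast
qed

text \<open>Limits remain in closed sets, and \<open>apx_nset_open\<close> goes the other way for
  open ones. Internal conditions are later cut out by open half-planes and read back through their
  closures.\<close>

lemma apx_nset_closed:
  assumes "apx x c" "x \<in> nelts U (nset U A)" "closed A"
  shows "c \<in> A"
proof (rule Lim_in_closed_set)
  have x: "x \<in> nC U" using assms(1) by (rule apx_nC)
  show "closed A" "ufil x \<noteq> bot" "((\<lambda>z. z) \<longlongrightarrow> c) (ufil x)" "eventually (\<lambda>z. z \<in> A) (ufil x)"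
    using assms ufil_neq_bot[OF x] apx_ufil[OF x] eventually_ufil[OF x, of "\<lambda>z. z \<in> A"] by simp_all
qed

lemma apx_nset_open:
  assumes "apx x c" "open A" "c \<in> A"
  shows "x \<in> nelts U (nset U A)"
proof -
  have x: "x \<in> nC U" using assms(1) by (rule apx_nC)
  have "eventually (\<lambda>z. z \<in> A) (ufil x)"
    using topological_tendstoD[OF iffD1[OF apx_ufil[OF x] assms(1)] assms(2,3)] .
  then show ?thesis using eventually_ufil[OF x, of "\<lambda>z. z \<in> A"] by simp
qed

lemma nfinite_iff:
  assumes "x \<in> nC U"
  shows "nfinite U x \<longleftrightarrow> (\<exists>c. apx x c)"
proof -
  have x: "x = nfun U (\<lambda>z. z) x" using assms by (simp add: nfun_ident)
  show ?thesis
  proof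
    assume "nfinite U x"
    then obtain n :: nat where "eventually (\<lambda>z. cmod z < n) (ufil x)"
      using nfinite_germ[OF assms, of "\<lambda>z. z"] x by auto
    then have "eventually (\<lambda>z. cmod z \<le> n) (ufil x)" by (rule eventually_mono) simp
    then show "\<exists>c. apx x c"
      using ufil_convergent[OF assms, of "\<lambda>z. z"] apx_germ[OF assms, of "\<lambda>z. z"] x by auto
  next
    assume "\<exists>c. apx x c"
    then obtain c where c: "((\<lambda>z. z) \<longlongrightarrow> c) (ufil x)"
      using apx_germ[OF assms, of "\<lambda>z. z"] x by auto
    obtain n :: nat where "cmod c < n" using reals_Archimedean2 by blast
    then have "eventually (\<lambda>z. cmod z < n) (ufil x)"
      using order_tendstoD(2)[OF tendsto_norm[OF c]] by blast
    then show "nfinite U x" using nfinite_germ[OF assms, of "\<lambda>z. z"] x by auto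
  qed
qed

lemma standard_part_apx:
  assumes "apx x (complex_of_real t)"
  shows "standard_part U x = t"
  unfolding standard_part_def
proof (rule the_equality)
  show "napprox U x (num U (complex_of_real t))" using assms by (simp add: apx_def)
  show "s = t" if "napprox U x (num U (complex_of_real s))" for s
    using apx_unique[of x s t] that assms by (simp add: apx_def)
qed

lemma napprox_0_iff: "x \<in> nC U \<Longrightarrow> napprox U x (num U 0) \<longleftrightarrow> apx x 0"
  by (simp add: apx_def)

lemma nfinite_dominated:
  assumes "nle U (num U 0) x" "nle U x y" "nfinite U y"
  shows "nfinite U x"
proof -
  have "x \<in> nC U" "y \<in> nC U" using nle_nC[OF assms(2)] nset_nC by blast+
  then obtain w f g where w: "w \<in> nC U" "x = nfun U f w" "y = nfun U g w" by (rule germ2)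
  obtain n :: nat where "eventually (\<lambda>z. cmod (g z) < n) (ufil w)"
    using assms(3) w nfinite_germ by auto
  moreover have "eventually (\<lambda>z. f z \<in> \<real> \<and> g z \<in> \<real> \<and> 0 \<le> Re (f z) \<and> Re (f z) \<le> Re (g z)) (ufil w)"
    using assms(1,2) w by (auto simp: germ_simps num_nfun[OF w(1)] elim: eventually_elim2)
  ultimately have "eventually (\<lambda>z. cmod (f z) < n) (ufil w)"
    by eventually_elim (auto simp: in_Reals_norm)
  then show ?thesis using w nfinite_germ by auto
qed

text \<open>
  The expression below is \<open>\<langle>x + t y, x + t y\<rangle>\<close> for \<open>a = \<langle>x, x\<rangle>\<close>, \<open>b = \<langle>x, y\<rangle>\<close>, \<open>d = \<langle>y, y\<rangle>\<close>;
  \<open>t \<in> {1, -1, \<i>, -\<i>}\<close> bounds \<open>b\<close> in terms of \<open>a\<close> and \<open>d\<close>.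
\<close>

lemma nfinite_polarization:
  assumes "nfinite U a" "nfinite U d" "a \<in> nC U" "b \<in> nC U" "d \<in> nC U"
    and "\<And>t. nle U (num U 0) (nplus U (nplus U a (ntimes U (num U (cnj t)) b))
          (ntimes U (num U t) (nplus U (ncnj U b) (ntimes U (num U (cnj t)) d))))"
  shows "nfinite U b"
proof -
  obtain w f g h where w: "w \<in> nC U" "a = nfun U f w" "b = nfun U g w" "d = nfun U h w"
    using assms(3-5) by (rule germ3)
  obtain m n :: nat where mn: "eventually (\<lambda>z. cmod (f z) < m) (ufil w)"
      "eventually (\<lambda>z. cmod (h z) < n) (ufil w)"
    using assms(1,2) w nfinite_germ by auto
  have pos: "eventually (\<lambda>z. 0 \<le> Re (f z + cnj t * g z + t * (cnj (g z) + cnj t * h z))) (ufil w)" for t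
    using assms(6)[of t] w(1) by (simp add: w(2-) num_nfun[OF w(1)] germ_simps eventually_conj_iff)
  have "eventually (\<lambda>z. cmod (g z) < 2 * (m + n)) (ufil w)"
    using mn pos[of 1] pos[of "-1"] pos[of "\<i>"] pos[of "-\<i>"]
  proof eventually_elim
    case (elim z)
    have "\<bar>Re (f z)\<bar> < m" "\<bar>Re (h z)\<bar> < n"
      using elim abs_Re_le_cmod[of "f z"] abs_Re_le_cmod[of "h z"] by linarith+
    then have "\<bar>Re (g z)\<bar> < m + n" "\<bar>Im (g z)\<bar> < m + n"
      using elim(3-6) by (auto simp: algebra_simps abs_less_iff)
    then show ?case using cmod_le[of "g z"] by simp
  qed
  then have "eventually (\<lambda>z. cmod (g z) < real (2 * (m + n))) (ufil w)" by simp
  then show ?thesis using w(1) unfolding w(3) nfinite_germ[OF w(1)] by blast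
qed

definition csqrt_re :: "complex \<Rightarrow> complex" where
  "csqrt_re z = complex_of_real (sqrt (Re z))"

text \<open>The function \<open>sqrt\<close> is odd and hence continuous on the whole line.
  Continuity at 0 matters for vectors of infinitesimal norm, and no sign condition is
  needed.\<close>

lemma isCont_csqrt_re: "isCont csqrt_re z"
  unfolding csqrt_re_def
  using bounded_linear.isCont[OF bounded_linear_Re continuous_ident, of z]
  by (intro continuous_intros) simp

text \<open>Uniqueness of the nonnegative root, checked pointwise along the ultrafilter. It
  evaluates the description by which \<open>vnorm\<close> is defined.\<close>

lemma nsqrt_iff:
  assumes "nle U (num U 0) r"
  shows "s \<in> nR U \<and> nle U (num U 0) s \<and> ntimes U s s = r \<longleftrightarrow> s = nfun U csqrt_re r"
proof -
  have r: "r \<in> nC U" using nle_nC[OF assms] nset_nC by blast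
  show ?thesis
  proof (cases "s \<in> nC U")
    case True
    then obtain w f g where w: "w \<in> nC U" "r = nfun U f w" "s = nfun U g w" by (rule germ2[OF r])
    have ev: "eventually (\<lambda>z. f z \<in> \<real> \<and> 0 \<le> Re (f z)) (ufil w)"
      using assms w by (simp add: germ_simps num_nfun[OF w(1)])
    have eq: "(g \<in> \<real> \<and> ((0::complex) \<in> \<real> \<and> g \<in> \<real> \<and> 0 \<le> Re g) \<and> g * g = f) \<longleftrightarrow> g = csqrt_re f"
      if "f \<in> \<real> \<and> 0 \<le> Re f" for f g
      using that by (auto simp: csqrt_re_def complex_is_Real_iff complex_eq_iff power2_eq_square
          intro!: real_sqrt_unique[symmetric])
    have "s \<in> nR U \<and> nle U (num U 0) s \<and> ntimes U s s = r \<longleftrightarrow>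
      eventually (\<lambda>z. g z \<in> \<real> \<and> ((0::complex) \<in> \<real> \<and> g z \<in> \<real> \<and> 0 \<le> Re (g z)) \<and> g z * g z = f z) (ufil w)"
      using w(1) by (simp add: w(2-) germ_simps num_nfun[OF w(1)] eventually_conj_iff)
    also have "\<dots> \<longleftrightarrow> eventually (\<lambda>z. g z = csqrt_re (f z)) (ufil w)"
      by (rule eventually_subst[OF eventually_mono[OF ev eq]])
    also have "\<dots> \<longleftrightarrow> s = nfun U csqrt_re r"
      using w(1) by (simp add: w(2-) germ_simps)
    finally show ?thesis .
  next
    case False
    then show ?thesis using r nset_nC by auto
  qed
qed

end

lemma is_fun_app:
  assumes "is_fun E f A B" "x \<in> elts E A"
  shows "app E f x \<in> elts E B" "grel E f x y \<longleftrightarrow> y = app E f x"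
proof -
  have ex: "\<exists>!y. grel E f x y"
    using assms unfolding is_fun_def grel_def by blast
  then have gr: "grel E f x (app E f x)"
    unfolding app_eq by (rule theI')
  then show "grel E f x y \<longleftrightarrow> y = app E f x" using ex by blast
  from gr obtain p where p: "p \<in> elts E f" "is_pair E p x (app E f x)" by (auto simp: grel_def)
  then obtain x' y' where "y' \<in> elts E B" "is_pair E p x' y'"
    using assms(1) unfolding is_fun_def by blast
  then show "app E f x \<in> elts E B" using is_pair_inj p(2) by metis
qed

lemma is_fun2_app2:
  assumes "is_fun2 E f A B C" "x \<in> elts E A" "y \<in> elts E B"
  shows "app2 E f x y \<in> elts E C" "grel3 E f x y z \<longleftrightarrow> z = app2 E f x y"
proof -
  have ex: "\<exists>!z. grel3 E f x y z"
    using assms unfolding is_fun2_def grel3_def by blast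
  then have gr: "grel3 E f x y (app2 E f x y)"
    unfolding app2_eq by (rule theI')
  then show "grel3 E f x y z \<longleftrightarrow> z = app2 E f x y" using ex by blast
  from gr obtain p where p: "p \<in> elts E f" "is_triple E p x y (app2 E f x y)" by (auto simp: grel3_def)
  then obtain x' y' z' where "z' \<in> elts E C" "is_triple E p x' y' z'"
    using assms(1) unfolding is_fun2_def by blast
  then show "app2 E f x y \<in> elts E C" using is_triple_inj p(2) by metis
qed

context nonstd
begin

section \<open>Internal sets\<close>

definition lev :: "nat \<Rightarrow> 'u" where
  "lev n = code U (level (smem U) (indiv U) n)"

lemma elts_lev: "enat n < height U \<Longrightarrow> elts (smem U) (lev n) = level (smem U) (indiv U) n"
  unfolding lev_def by (rule elts_code) auto

lemma star_subset:
  assumes "elts (smem U) a \<subseteq> elts (smem U) b"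
  shows "nelts U (star U a) \<subseteq> nelts U (star U b)"
  using transfer[of "(!) [a, b]" "FBAll 10 0 (FMem 10 1)"] assms by auto

lemma star_lev_mono:
  assumes "m \<le> n" "enat n < height U"
  shows "nelts U (star U (lev m)) \<subseteq> nelts U (star U (lev n))"
proof -
  have "enat m < height U" using assms by (meson enat_ord_simps(1) order_le_less_trans)
  then show ?thesis
    by (intro star_subset) (simp only: elts_lev assms(2) level_mono[OF assms(1)])
qed

text \<open>If \<open>star U s\<close> has an element then so has \<open>s\<close>, and all elements
  of \<open>s\<close> lie in one level below the height. Quantifiers over internal parameters
  thereby acquire a bound.\<close>

lemma internal_lev:
  assumes "internal U a"
  shows "\<exists>n. enat n < height U \<and> a \<in> nelts U (star U (lev n))"
proof -
  obtain s where s: "a \<in> nelts U (star U s)" using assms by (auto simp: internal_def)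
  have "\<exists>x. x \<in> elts (smem U) s"
    using transfer[of "(!) [s]" "FBEx 10 0 (FEq 10 10)"] s by auto
  then obtain n where "enat n < height U" "elts (smem U) s \<subseteq> level (smem U) (indiv U) n"
    using S.elts_subset_level by blast
  then show ?thesis using star_subset[of s "lev n"] s elts_lev by blast
qed

lemma internal_lev_list:
  assumes "\<forall>p\<in>set ps. internal U p"
  shows "\<exists>n. enat n < height U \<and> set ps \<subseteq> nelts U (star U (lev n))"
  using assms
proof (induction ps)
  case Nil
  then show ?case using height[of 0] by auto
next
  case (Cons p ps)
  then obtain m n where mn: "enat n < height U" "set ps \<subseteq> nelts U (star U (lev n))"
      "enat m < height U" "p \<in> nelts U (star U (lev m))"
    using internal_lev[of p] by auto
  then have "enat (max m n) < height U" by (simp add: max_def)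
  then show ?case
    using mn star_lev_mono[of m "max m n"] star_lev_mono[of n "max m n"]
    by (intro exI[of _ "max m n"]) auto
qed

text \<open>
  Internal definition principle: \<open>v 10\<close> is the element, \<open>v 0, v 1, \<dots>\<close> are internal parameters, and
  the remaining variables stand for standard constants. The latter need not be elements
  of a level of the superstructure, hence need not be internal in the sense of the definition.
\<close>

lemma internal_comprehension:
  fixes ps :: "'w list" and s :: "nat \<Rightarrow> 'u"
  defines "e \<equiv> (\<lambda>i. if i < length ps then ps ! i else star U (s i))"
  assumes "ps \<noteq> []" "length ps \<le> 10" "\<forall>p\<in>set ps. internal U p"
  shows "\<exists>Z. internal U Z \<and> nelts U Z = {x\<in>nelts U (ps ! 0). sat (nmem U) (e(10 := x)) \<phi>}"
proof -
  obtain n where n: "enat n < height U" "set ps \<subseteq> nelts U (star U (lev n))"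
    using internal_lev_list[OF assms(4)] by blast
  obtain N where N: "\<And>e e'. (\<forall>i<N. e i = e' i) \<Longrightarrow> sat (nmem U) e \<phi> = sat (nmem U) e' \<phi>"
    using sat_finite_dependence[of "nmem U" \<phi>] by blast
  obtain N' where N': "\<And>e e'. (\<forall>i<N'. e i = e' i) \<Longrightarrow> sat (smem U) e \<phi> = sat (smem U) e' \<phi>"
    using sat_finite_dependence[of "smem U" \<phi>] by blast
  \<comment> \<open>The slots \<open>K\<close> and \<open>K+1\<close> lie beyond every variable of
    \<open>\<phi>\<close>, beyond the parameters and beyond the element variable 10. Two bounds are
    taken since \<open>\<phi>\<close> is evaluated in both universes.\<close>
  define K where "K = max (max N N') 11"
  define L where "L = [0..<length ps]"
  \<comment> \<open>The first conjunct speaks only about elements of \<open>v 0\<close>; the second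
    confines the new set to them.\<close>
  define \<theta> where "\<theta> = FConj (FBAll 10 0 (FIff (FMem 10 (K+1)) \<phi>)) (FBAll 10 (K+1) (FMem 10 0))"
  define \<psi> where "\<psi> = FBEx (K+1) K \<theta>"
  have K: "N \<le> K" "N' \<le> K" "11 \<le> K" by (auto simp: K_def)
  then have KL: "K \<notin> set L" "0 \<in> set L" using assms(2,3) by (auto simp: L_def)
  define e0 :: "nat \<Rightarrow> 'u" where "e0 = s(K := lev n)"
  have "sat (smem U) e0 (FBAlls L K \<psi>)"
    unfolding sat_FBAlls[OF KL(1)]
  proof (intro allI impI)
    fix e' :: "nat \<Rightarrow> 'u"
    assume e': "\<forall>i\<in>set L. e' i \<in> elts (smem U) (e0 K)"
    define f where "f = (\<lambda>i. if i \<in> set L then e' i else e0 i)"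
    have lev: "elts (smem U) (e0 K) = level (smem U) (indiv U) n"
      by (simp add: e0_def elts_lev n)
    have f0: "f 0 \<in> level (smem U) (indiv U) n" using e' KL lev by (simp add: f_def)
    define B where "B = {x\<in>elts (smem U) (f 0). sat (smem U) (f(10 := x)) \<phi>}"
    obtain Z where Z: "Z \<in> level (smem U) (indiv U) n" "elts (smem U) Z = B"
      using S.level_subset_exists[OF f0 order_less_imp_le[OF n(1)], of B] by (auto simp: B_def)
    have "sat (smem U) (f(K+1 := Z, 10 := x)) \<phi> = sat (smem U) (f(10 := x)) \<phi>" for x
      by (rule N') (use K in auto)
    then have "sat (smem U) (f(K+1 := Z)) \<theta>"
      using K by (simp add: \<theta>_def Z(2)) (simp add: B_def)
    moreover have "Z \<in> elts (smem U) (f K)" using Z(1) lev KL by (simp add: f_def)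
    ultimately show "sat (smem U) f \<psi>" unfolding \<psi>_def sat_FBEx by blast
  qed
  then have T: "sat (nmem U) (star U \<circ> e0) (FBAlls L K \<psi>)"
    by (simp only: transfer)
  \<comment> \<open>The transferred sentence ranges over everything in
    \<open>star U (lev n)\<close>, so the internal parameters can now replace the standard
    ones.\<close>
  define g where "g = (\<lambda>i. if i \<in> set L then e i else (star U \<circ> e0) i)"
  have "\<forall>i\<in>set L. e i \<in> nelts U ((star U \<circ> e0) K)"
    using n(2) by (auto simp: e_def e0_def L_def subset_iff)
  then have "sat (nmem U) g \<psi>"
    using T unfolding sat_FBAlls[OF KL(1)] g_def by blast
  then obtain Z where Z: "Z \<in> nelts U (g K)" "sat (nmem U) (g(K+1 := Z)) \<theta>"
    unfolding \<psi>_def sat_FBEx by blast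
  have "sat (nmem U) (g(K+1 := Z, 10 := x)) \<phi> = sat (nmem U) (e(10 := x)) \<phi>" for x
    by (rule N) (use K in \<open>auto simp: g_def e_def e0_def L_def\<close>)
  then have "\<forall>x\<in>nelts U (g 0). x \<in> nelts U Z \<longleftrightarrow> sat (nmem U) (e(10 := x)) \<phi>"
      "\<forall>x\<in>nelts U Z. x \<in> nelts U (g 0)"
    using Z(2) K by (simp_all add: \<theta>_def)
  moreover have "g 0 = ps ! 0" using KL assms(2) by (simp add: g_def e_def)
  ultimately have "nelts U Z = {x\<in>nelts U (ps ! 0). sat (nmem U) (e(10 := x)) \<phi>}"
    by auto
  moreover have "internal U Z" using Z(1) KL(1) by (auto simp: internal_def g_def)
  ultimately show ?thesis by blast
qed

text \<open>Levels are transitive, which is a bounded statement about \<open>lev n\<close> and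
  transfers.\<close>

lemma internal_elem:
  assumes "internal U a" "x \<in> nelts U a"
  shows "internal U x"
proof -
  obtain n where n: "enat n < height U" "a \<in> nelts U (star U (lev n))"
    using internal_lev[OF assms(1)] by blast
  have trans: "x \<in> level (smem U) (indiv U) n"
    if "a \<in> level (smem U) (indiv U) n" "x \<in> elts (smem U) a" for a x
    using that
  proof (induction n)
    case 0
    then show ?case using S.elts_indiv by auto
  qed auto
  then have "sat (smem U) ((!) [lev n]) (FBAll 10 0 (FBAll 11 10 (FMem 11 0)))"
    using n by (auto simp: elts_lev)
  then have "sat (nmem U) (star U \<circ> (!) [lev n]) (FBAll 10 0 (FBAll 11 10 (FMem 11 0)))"
    by (simp only: transfer)
  then show ?thesis using n(2) assms(2) by (auto simp: internal_def)
qed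

lemma internal_nset [simp]: "internal U (nset U A)"
proof -
  obtain a where a: "a \<notin> indiv U" "elts (smem U) a = cnum U ` A" "a \<in> level (smem U) (indiv U) 1"
    using S.set_exists[of 0 "cnum U ` A"] cnum_indiv height[of 0]
    by (auto simp only: level.simps One_nat_def image_subset_iff)
  then have "code U (cnum U ` A) = a"
    unfolding code_def using S.elts_inject by (intro the_equality) auto
  then have "star U (code U (cnum U ` A)) \<in> nelts U (star U (lev 1))"
    using transfer[of "(!) [code U (cnum U ` A), lev 1]" "FMem 0 1"] height[of 1] a(3)
    by (simp add: elts_lev)
  then show ?thesis by (auto simp: internal_def nset_def)
qed

lemma countable_saturation:
  fixes \<kappa> :: "'k rel"
  assumes "saturated U \<kappa>" "natLeq <o \<kappa>" "\<And>n::nat. internal U (A n)"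
    and fip: "\<And>n. \<exists>x. \<forall>m\<le>n. x \<in> nelts U (A m)"
  shows "\<exists>x. \<forall>n. x \<in> nelts U (A n)"
proof -
  have "|range A| \<le>o natLeq"
    using card_of_image card_of_nat ordLeq_ordIso_trans by blast
  then have "|range A| <o \<kappa>" using assms(2) ordLeq_ordLess_trans by blast
  moreover have "(\<Inter>B\<in>G. nelts U B) \<noteq> {}" if G: "G \<subseteq> range A" "finite G" for G
  proof -
    obtain I where I: "finite I" "G = A ` I"
      using finite_subset_image[OF G(2,1)] by blast
    obtain x where "\<forall>m\<le>Max I. x \<in> nelts U (A m)" using fip by blast
    then have "x \<in> (\<Inter>B\<in>G. nelts U B)" using I by auto
    then show ?thesis by blast
  qed
  ultimately have "(\<Inter>B\<in>range A. nelts U B) \<noteq> {}"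
    using assms(1)[unfolded saturated_def, rule_format, of "range A"] assms(3) by simp
  then show ?thesis by auto
qed

lemma nrel3_nfun:
  assumes "w \<in> nC U"
  shows "nrel3 R (nfun U f w) (nfun U g w) (nfun U h w) \<longleftrightarrow> w \<in> nelts U (nset U {z. R (f z) (g z) (h z)})"
  using transfer[of "(!) [code U (cnum U ` UNIV), graph2 (\<lambda>x y. y = f x), graph2 (\<lambda>x y. y = g x),
      graph2 (\<lambda>x y. y = h x), graph3 R, code U (cnum U ` {z. R (f z) (g z) (h z)})]"
    "FBAll 10 0 (FBAll 11 0 (FBAll 12 0 (FBAll 13 0
      (FImp (FConj (FRel 1 10 11) (FConj (FRel 2 10 12) (FRel 3 10 13)))
        (FIff (FRel3 4 11 12 13) (FMem 10 5))))))"]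
    nfun_rel[OF assms] assms
  by (simp add: star_simps)

text \<open>Completeness of the reals speaks about sets. Quantifying over the members of a level
  makes it bounded, so infima exist for internal sets of nonstandard reals, but not for arbitrary
  external ones.\<close>

lemma internal_infimum:
  fixes P
  defines "P \<equiv> {z. z \<in> \<real> \<and> 0 \<le> Re z}"
  assumes "internal U D" "nelts U D \<subseteq> nelts U (nset U P)" "nelts U D \<noteq> {}"
  shows "\<exists>c\<in>nelts U (nset U P). (\<forall>d\<in>nelts U D. nle U c d) \<and>
    (\<forall>c'\<in>nelts U (nset U P). (\<forall>d\<in>nelts U D. nle U c' d) \<longrightarrow> nle U c' c)"
proof -
  obtain n where n: "enat n < height U" "D \<in> nelts U (star U (lev n))"
    using internal_lev[OF assms(2)] by blast
  let ?e = "(!) [lev n, code U (cnum U ` P), graph2 (\<lambda>x y. x \<in> \<real> \<and> y \<in> \<real> \<and> Re x \<le> Re y)]"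
  let ?\<phi> = "FImp (FConj (FBAll 11 10 (FMem 11 1)) (FBEx 11 10 (FEq 11 11)))
    (FBEx 12 1 (FConj (FBAll 11 10 (FRel 2 12 11)) (FBAll 13 1 (FImp (FBAll 11 10 (FRel 2 13 11))
      (FRel 2 13 12)))))"
  have inf: "\<exists>c\<in>P. (\<forall>d\<in>B. c \<in> \<real> \<and> d \<in> \<real> \<and> Re c \<le> Re d) \<and>
      (\<forall>c'\<in>P. (\<forall>d\<in>B. c' \<in> \<real> \<and> d \<in> \<real> \<and> Re c' \<le> Re d) \<longrightarrow> c' \<in> \<real> \<and> c \<in> \<real> \<and> Re c' \<le> Re c)"
    if B: "B \<subseteq> P" "B \<noteq> {}" for B
  proof (intro bexI[of _ "complex_of_real (Inf (Re ` B))"] conjI ballI impI)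
    have ge: "0 \<le> x" if "x \<in> Re ` B" for x using that B by (auto simp: P_def)
    then have "bdd_below (Re ` B)" by (intro bdd_belowI[of _ 0]) auto
    then show "Re (complex_of_real (Inf (Re ` B))) \<le> Re d" if "d \<in> B" for d
      using that by (simp add: cINF_lower)
    show "complex_of_real (Inf (Re ` B)) \<in> P"
      using B ge by (auto simp: P_def intro!: cInf_greatest)
    show "Re c' \<le> Re (complex_of_real (Inf (Re ` B)))"
      if "\<forall>d\<in>B. c' \<in> \<real> \<and> d \<in> \<real> \<and> Re c' \<le> Re d" for c'
      using that B by (auto intro!: cINF_greatest)
  qed (use B in \<open>auto simp: P_def\<close>)
  \<comment> \<open>The quantifier runs over a whole level, so most of its members are not sets of
    nonnegative reals; for those the premise of the implication fails.\<close>
  have "sat (smem U) (?e(10 := a)) ?\<phi>" for a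
  proof (cases "elts (smem U) a \<subseteq> cnum U ` P \<and> elts (smem U) a \<noteq> {}")
    case True
    then obtain B where B: "elts (smem U) a = cnum U ` B" "B \<subseteq> P"
      using subset_image_iff by metis
    then have "B \<noteq> {}" using True by auto
    then show ?thesis using inf[OF B(2)] by (simp add: B(1))
  next
    case False
    then show ?thesis by auto
  qed
  then have "sat (smem U) ?e (FBAll 10 0 ?\<phi>)" unfolding sat.simps(5) by blast
  then have "sat (nmem U) (star U \<circ> ?e) (FBAll 10 0 ?\<phi>)" by (simp only: transfer)
  then have "sat (nmem U) ((star U \<circ> ?e)(10 := D)) ?\<phi>"
    unfolding sat.simps(5) by (rule bspec) (simp add: n(2))
  then have "(\<forall>d\<in>nelts U D. d \<in> nelts U (nset U P)) \<and> (\<exists>d. d \<in> nelts U D) \<longrightarrow> ?thesis"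
    by (simp add: star_simps nle_def ex_in_conv)
  then show ?thesis using assms(3,4) by blast
qed

end

section \<open>The nonstandard hull of an internal Hilbert space\<close>

lemma UN_const_on: "x \<in> A \<Longrightarrow> (\<And>y. y \<in> A \<Longrightarrow> f y = B) \<Longrightarrow> (\<Union>y\<in>A. f y) = B"
  by auto

lemma quadratic_nonneg_discriminant:
  fixes a b c :: real
  assumes "0 \<le> c" "\<And>t. 0 \<le> a + 2 * t * b + t\<^sup>2 * c"
  shows "b\<^sup>2 \<le> a * c"
proof (cases "c = 0")
  case True
  have "b = 0"
  proof (rule ccontr)
    assume "b \<noteq> 0"
    \<comment> \<open>With \<open>c = 0\<close> the polynomial is affine; this \<open>t\<close> is
      where it takes the value -1. In the other case \<open>t = - b / c\<close> is the minimum
      point.\<close>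
    then have "a + 2 * (- (a + 1) / (2 * b)) * b = - 1" by (simp add: field_simps)
    then show False using assms(2)[of "- (a + 1) / (2 * b)"] True by simp
  qed
  then show ?thesis using True by simp
next
  case False
  then have "0 \<le> (a + 2 * (- b / c) * b + (- b / c)\<^sup>2 * c) * c"
    using assms(1) assms(2)[of "- b / c"] by simp
  also have "\<dots> = a * c - b\<^sup>2"
    using False by (simp add: field_simps power2_eq_square)
  finally show ?thesis by simp
qed

context nonstd
begin

lemma ncnj_nC [simp]: "x \<in> nC U \<Longrightarrow> ncnj U x \<in> nC U"
  by (simp add: ncnj_def)

context
  fixes x y
  assumes xy: "x \<in> nC U" "y \<in> nC U"
begin

lemma nplus_nC [simp]: "nplus U x y \<in> nC U"
  and ntimes_nC [simp]: "ntimes U x y \<in> nC U"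
  and ncnj_nplus: "ncnj U (nplus U x y) = nplus U (ncnj U x) (ncnj U y)"
  and ncnj_ntimes: "ncnj U (ntimes U x y) = ntimes U (ncnj U x) (ncnj U y)"
proof -
  obtain w f g where w: "w \<in> nC U" and xy: "x = nfun U f w" "y = nfun U g w"
    using xy by (rule germ2)
  show "nplus U x y \<in> nC U" "ntimes U x y \<in> nC U"
    "ncnj U (nplus U x y) = nplus U (ncnj U x) (ncnj U y)"
    "ncnj U (ntimes U x y) = ntimes U (ncnj U x) (ncnj U y)"
    using w by (simp_all only: xy germ_simps nfun_nC complex_cnj_add complex_cnj_mult UNIV_I simp_thms(6) eventually_True)
qed

end

lemma ntimes_0: "x \<in> nC U \<Longrightarrow> ntimes U (num U 0) x = num U 0"
  and nplus_minus: "x \<in> nC U \<Longrightarrow> nplus U x (ntimes U (num U (-1)) x) = num U 0"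
proof -
  assume xC: "x \<in> nC U"
  obtain w f g where w: "w \<in> nC U" and x: "x = nfun U f w" "x = nfun U g w"
    using xC xC by (rule germ2)
  show "ntimes U (num U 0) x = num U 0" "nplus U x (ntimes U (num U (-1)) x) = num U 0"
    using w unfolding x(1) num_nfun[OF w]
    by (simp_all only: germ_simps nfun_nC mult_zero_left mult_minus1 add.right_inverse simp_thms(6) eventually_True)
qed

lemma ncnj_num [simp]: "ncnj U (num U c) = num U (cnj c)"
proof -
  obtain w where w: "w \<in> nC U" using num_nset[of 0 UNIV] by blast
  show ?thesis unfolding num_nfun[OF w] using w by (simp add: germ_simps)
qed

lemma nplus_num: "nplus U (num U c) (num U d) = num U (c + d)"
proof -
  obtain w where w: "w \<in> nC U" using num_nset[of 0 UNIV] by blast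
  show ?thesis unfolding num_nfun[OF w] using w by (simp add: germ_simps)
qed

end

locale ihilb = nonstd U for U :: "('u, 'w) nsu" +
  fixes H :: "'w ihs"
  assumes hilbert: "internal_hilbert_space U H"
begin

abbreviation "V \<equiv> vecs U H"
abbreviation "add \<equiv> vadd U H"
abbreviation "scl \<equiv> vscale U H"
abbreviation "sub \<equiv> vsub U H"
abbreviation "inr \<equiv> inn U H"
abbreviation "nrm \<equiv> vnorm U H"

lemma ivs: "internal_vector_space U H" and iip: "internal_inner_product U H"
  using hilbert unfolding internal_hilbert_space_def by blast+

lemma funs:
  "is_fun2 (nmem U) (hadd H) (hcar H) (hcar H) (hcar H)"
  "is_fun2 (nmem U) (hscale H) (nset U UNIV) (hcar H) (hcar H)"
  "is_fun2 (nmem U) (hinner H) (hcar H) (hcar H) (nset U UNIV)"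
  using ivs iip unfolding internal_vector_space_def internal_inner_product_def by blast+

lemma internal_ops: "internal U (hcar H)" "internal U (hadd H)" "internal U (hinner H)"
  using ivs iip unfolding internal_vector_space_def internal_inner_product_def by blast+

lemma add_V [simp]: "x \<in> V \<Longrightarrow> y \<in> V \<Longrightarrow> add x y \<in> V"
  using is_fun2_app2(1)[OF funs(1)] by (simp add: vecs_def vadd_def)

lemma scl_V [simp]: "c \<in> nC U \<Longrightarrow> x \<in> V \<Longrightarrow> scl c x \<in> V"
  using is_fun2_app2(1)[OF funs(2)] by (simp add: vecs_def vscale_def)

lemma inn_nC [simp]: "x \<in> V \<Longrightarrow> y \<in> V \<Longrightarrow> inr x y \<in> nC U"
  using is_fun2_app2(1)[OF funs(3)] by (simp add: vecs_def inn_def)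

lemma sub_V [simp]: "x \<in> V \<Longrightarrow> y \<in> V \<Longrightarrow> sub x y \<in> V"
  by (simp add: vsub_def)

lemma grel3_hadd: "x \<in> V \<Longrightarrow> y \<in> V \<Longrightarrow> grel3 (nmem U) (hadd H) x y z \<longleftrightarrow> z = add x y"
  using is_fun2_app2(2)[OF funs(1)] by (simp add: vecs_def vadd_def)

lemma grel3_hinner: "x \<in> V \<Longrightarrow> y \<in> V \<Longrightarrow> grel3 (nmem U) (hinner H) x y z \<longleftrightarrow> z = inr x y"
  using is_fun2_app2(2)[OF funs(3)] by (simp add: vecs_def inn_def)

lemma inn_cnj: "x \<in> V \<Longrightarrow> y \<in> V \<Longrightarrow> inr y x = ncnj U (inr x y)"
  and inn_add_left: "x \<in> V \<Longrightarrow> y \<in> V \<Longrightarrow> z \<in> V \<Longrightarrow> inr (add x y) z = nplus U (inr x z) (inr y z)"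
  and inn_scl_left: "c \<in> nC U \<Longrightarrow> x \<in> V \<Longrightarrow> z \<in> V \<Longrightarrow> inr (scl c x) z = ntimes U c (inr x z)"
  and inn_pos: "x \<in> V \<Longrightarrow> nle U (num U 0) (inr x x)"
  and inn_definite: "x \<in> V \<Longrightarrow> inr x x = num U 0 \<Longrightarrow> y \<in> V \<Longrightarrow> add y x = y"
  using iip unfolding internal_inner_product_def by blast+

lemma inn_add_right: "x \<in> V \<Longrightarrow> y \<in> V \<Longrightarrow> z \<in> V \<Longrightarrow> inr z (add x y) = nplus U (inr z x) (inr z y)"
  by (metis inn_cnj inn_add_left ncnj_nplus add_V inn_nC)

lemma inn_scl_right:
  "c \<in> nC U \<Longrightarrow> x \<in> V \<Longrightarrow> z \<in> V \<Longrightarrow> inr z (scl c x) = ntimes U (ncnj U c) (inr z x)"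
  by (metis inn_cnj inn_scl_left ncnj_ntimes scl_V inn_nC)

lemma add_comm: "x \<in> V \<Longrightarrow> y \<in> V \<Longrightarrow> add x y = add y x"
  and add_assoc: "x \<in> V \<Longrightarrow> y \<in> V \<Longrightarrow> z \<in> V \<Longrightarrow> add (add x y) z = add x (add y z)"
  and scl_nplus: "c \<in> nC U \<Longrightarrow> d \<in> nC U \<Longrightarrow> x \<in> V \<Longrightarrow> scl (nplus U c d) x = add (scl c x) (scl d x)"
  and scl_1: "x \<in> V \<Longrightarrow> scl (num U 1) x = x"
  using ivs unfolding internal_vector_space_def by blast+

lemma V_nonempty: "V \<noteq> {}"
  using ivs unfolding internal_vector_space_def by blast

text \<open>Definiteness says that a vector of inner square 0 is neutral for addition, and
  \<open>scl (num U 0) x\<close> has inner square 0. No zero vector needs to be named.\<close>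

lemma add_scl_0: "x \<in> V \<Longrightarrow> y \<in> V \<Longrightarrow> add y (scl (num U 0) x) = y"
  by (rule inn_definite) (simp_all add: inn_scl_left ntimes_0)

lemma sub_self: "x \<in> V \<Longrightarrow> sub x x = scl (num U 0) x"
proof -
  assume x: "x \<in> V"
  have "scl (nplus U (num U 1) (num U (-1))) x = add (scl (num U 1) x) (scl (num U (-1)) x)"
    using x by (intro scl_nplus) auto
  then show ?thesis using x by (simp add: vsub_def scl_1 nplus_num)
qed

lemma add_sub_cancel: "x \<in> V \<Longrightarrow> y \<in> V \<Longrightarrow> add x (sub y x) = y"
proof -
  assume *: "x \<in> V" "y \<in> V"
  then have "add x (sub y x) = add y (sub x x)"
    by (simp add: vsub_def add_comm[of x] add_assoc)
  then show ?thesis using * by (simp add: sub_self add_scl_0)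
qed

lemma eq_if_inn_eq:
  assumes "y \<in> V" "z \<in> V" "\<And>x. x \<in> V \<Longrightarrow> inr x y = inr x z"
  shows "y = z"
proof -
  have d: "sub y z \<in> V" using assms by simp
  have "inr (sub y z) (sub y z) = nplus U (inr (sub y z) y) (ntimes U (num U (-1)) (inr (sub y z) z))"
    using assms(1,2) d by (simp add: vsub_def inn_add_right inn_scl_right)
  also have "\<dots> = num U 0"
    using assms d by (simp add: nplus_minus)
  finally have "add z (sub y z) = z" using assms d by (intro inn_definite)
  then show ?thesis using add_sub_cancel[OF assms(2,1)] by simp
qed

lemma vnorm_eq: "x \<in> V \<Longrightarrow> nrm x = nfun U csqrt_re (inr x x)"
  unfolding vnorm_def nsqrt_iff[OF inn_pos] by simp

subsection \<open>Vectors of finite norm\<close>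

text \<open>
  \<open>F\<close> is the finite part of \<open>H\<close>; \<open>ip\<close>, \<open>nr\<close> and \<open>dd\<close> are the standard parts of the inner product, the norm
  and the distance, so that \<open>dd x y = 0\<close> means \<open>x \<approx> y\<close>.
\<close>

definition F :: "'w set" where
  "F = {x\<in>V. \<exists>c. apx (inr x x) c}"

definition ip :: "'w \<Rightarrow> 'w \<Rightarrow> complex" where
  "ip x y = (THE c. apx (inr x y) c)"

definition nr :: "'w \<Rightarrow> real" where
  "nr x = sqrt (Re (ip x x))"

lemma F_V [simp]: "x \<in> F \<Longrightarrow> x \<in> V"
  by (simp add: F_def)

lemma F_I: "x \<in> V \<Longrightarrow> apx (inr x x) c \<Longrightarrow> x \<in> F"
  unfolding F_def by blast

lemma ip_eqI: "apx (inr x y) c \<Longrightarrow> ip x y = c"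
  unfolding ip_def using apx_unique by blast

text \<open>Cauchy-Schwarz comes later and only for standard parts. Finiteness of the mixed product
  is drawn from positivity of the inner square of \<open>x + t y\<close>, with standard scalars
  \<open>t\<close>.\<close>

lemma apx_ip:
  assumes "x \<in> F" "y \<in> F"
  shows "apx (inr x y) (ip x y)"
proof -
  have V: "x \<in> V" "y \<in> V" using assms by auto
  have "nfinite U (inr x y)"
  proof (rule nfinite_polarization[of "inr x x" "inr y y"])
    show "nfinite U (inr x x)" "nfinite U (inr y y)"
      using assms V unfolding F_def by (simp_all add: nfinite_iff del: F_V)
    fix t
    show "nle U (num U 0) (nplus U (nplus U (inr x x) (ntimes U (num U (cnj t)) (inr x y)))
          (ntimes U (num U t) (nplus U (ncnj U (inr x y)) (ntimes U (num U (cnj t)) (inr y y)))))"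
      using inn_pos[of "add x (scl (num U t) y)"] V
      by (simp add: inn_add_left inn_scl_left)
        (simp add: inn_add_right inn_scl_right inn_cnj[symmetric])
  qed (use V in auto)
  then obtain c where c: "apx (inr x y) c" using nfinite_iff V by auto
  then show ?thesis using ip_eqI[OF c] by simp
qed

lemma F_add [simp]:
  assumes "x \<in> F" "y \<in> F"
  shows "add x y \<in> F"
proof -
  have "apx (inr (add x y) (add x y)) ((ip x x + ip x y) + (ip y x + ip y y))"
    using assms by (simp add: inn_add_left) (simp add: inn_add_right apx_nplus apx_ip)
  then show ?thesis using assms by (intro F_I) auto
qed

lemma F_scl [simp]:
  assumes "x \<in> F"
  shows "scl (num U c) x \<in> F"
proof -
  have "apx (inr (scl (num U c) x) (scl (num U c) x)) (cnj c * (c * ip x x))"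
    using assms by (simp add: inn_scl_left inn_scl_right apx_ntimes apx_num apx_ip)
  then show ?thesis using assms by (intro F_I) auto
qed

lemma F_sub [simp]: "x \<in> F \<Longrightarrow> y \<in> F \<Longrightarrow> sub x y \<in> F"
  by (simp add: vsub_def)

lemma ip_add_left: "x \<in> F \<Longrightarrow> y \<in> F \<Longrightarrow> z \<in> F \<Longrightarrow> ip (add x y) z = ip x z + ip y z"
  and ip_add_right: "x \<in> F \<Longrightarrow> y \<in> F \<Longrightarrow> z \<in> F \<Longrightarrow> ip z (add x y) = ip z x + ip z y"
  and ip_scl_left: "x \<in> F \<Longrightarrow> z \<in> F \<Longrightarrow> ip (scl (num U c) x) z = c * ip x z"
  and ip_scl_right: "x \<in> F \<Longrightarrow> z \<in> F \<Longrightarrow> ip z (scl (num U c) x) = cnj c * ip z x"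
  by (rule ip_eqI; simp add: inn_add_left inn_add_right inn_scl_left inn_scl_right
      apx_nplus apx_ntimes apx_num apx_ip)+

lemma ip_cnj: "x \<in> F \<Longrightarrow> z \<in> F \<Longrightarrow> ip z x = cnj (ip x z)"
  using apx_ncnj[OF apx_ip, of x z] inn_cnj[of x z] by (intro ip_eqI) simp

lemma ip_sub_left: "x \<in> F \<Longrightarrow> y \<in> F \<Longrightarrow> z \<in> F \<Longrightarrow> ip (sub x y) z = ip x z - ip y z"
  and ip_sub_right: "x \<in> F \<Longrightarrow> y \<in> F \<Longrightarrow> z \<in> F \<Longrightarrow> ip z (sub x y) = ip z x - ip z y"
  by (simp_all add: vsub_def ip_add_left ip_add_right ip_scl_left ip_scl_right)

lemmas ip_simps = ip_add_left ip_add_right ip_scl_left ip_scl_right ip_sub_left ip_sub_right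

lemma ip_nonneg: "x \<in> F \<Longrightarrow> 0 \<le> Re (ip x x)"
  using apx_nle[OF apx_num apx_ip inn_pos] by fastforce

lemma nr_nonneg [simp]: "x \<in> F \<Longrightarrow> 0 \<le> nr x"
  by (simp add: nr_def ip_nonneg)

lemma nr_power2: "x \<in> F \<Longrightarrow> (nr x)\<^sup>2 = Re (ip x x)"
  by (simp add: nr_def ip_nonneg)

lemma apx_nrm: "x \<in> F \<Longrightarrow> apx (nrm x) (complex_of_real (nr x))"
  using apx_nfun[OF apx_ip isCont_csqrt_re, of x x] by (simp add: vnorm_eq csqrt_re_def nr_def)

lemma nfinite_nrm_iff: "x \<in> V \<Longrightarrow> nfinite U (nrm x) \<longleftrightarrow> x \<in> F"
proof
  assume x: "x \<in> V" and "nfinite U (nrm x)"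
  then obtain c where "apx (nrm x) c" by (auto simp: nfinite_iff vnorm_eq)
  then have "apx (ntimes U (nrm x) (nrm x)) (c * c)" by (intro apx_ntimes)
  moreover have "ntimes U (nrm x) (nrm x) = inr x x"
    using nsqrt_iff[OF inn_pos[OF x], of "nrm x"] vnorm_eq[OF x] by blast
  ultimately show "x \<in> F" using x F_I by metis
next
  assume "x \<in> V" "x \<in> F"
  then show "nfinite U (nrm x)" using apx_nrm nfinite_iff apx_nC by blast
qed

text \<open>The discriminant of the nonnegative quadratic \<open>|x + t y|^2\<close> in a real
  variable \<open>t\<close>. Bounding the real part suffices for the triangle inequality; rotations
  by scalars recover the rest in \<open>ip_null\<close>.\<close>

lemma cauchy_schwarz:
  assumes "x \<in> F" "y \<in> F"
  shows "Re (ip x y) \<le> nr x * nr y"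
proof -
  have "0 \<le> Re (ip x x) + 2 * t * Re (ip x y) + t\<^sup>2 * Re (ip y y)" for t
  proof -
    have "0 \<le> Re (ip (add x (scl (num U (complex_of_real t)) y)) (add x (scl (num U (complex_of_real t)) y)))"
      using assms by (intro ip_nonneg) simp
    also have "\<dots> = Re (ip x x) + 2 * t * Re (ip x y) + t\<^sup>2 * Re (ip y y)"
      using assms by (simp add: ip_simps ip_cnj[of x y] power2_eq_square algebra_simps)
    finally show ?thesis .
  qed
  then have "(Re (ip x y))\<^sup>2 \<le> Re (ip x x) * Re (ip y y)"
    by (rule quadratic_nonneg_discriminant[OF ip_nonneg[OF assms(2)]])
  also have "\<dots> = (nr x * nr y)\<^sup>2"
    by (simp only: power_mult_distrib nr_power2[OF assms(1)] nr_power2[OF assms(2)])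
  finally show ?thesis
    using assms by (intro power2_le_imp_le[of "Re (ip x y)" "nr x * nr y"] mult_nonneg_nonneg nr_nonneg)
qed

lemma nr_triangle:
  assumes "x \<in> F" "y \<in> F"
  shows "nr (add x y) \<le> nr x + nr y"
proof -
  have "(nr (add x y))\<^sup>2 = (nr x)\<^sup>2 + 2 * Re (ip x y) + (nr y)\<^sup>2"
    using assms by (simp add: nr_power2 ip_simps ip_cnj[of x y])
  also have "\<dots> \<le> (nr x + nr y)\<^sup>2"
    using cauchy_schwarz[OF assms] by (simp add: power2_sum)
  finally show ?thesis
    using assms by (intro power2_le_imp_le[of "nr (add x y)" "nr x + nr y"] add_nonneg_nonneg nr_nonneg)
qed

lemma nr_scl: "x \<in> F \<Longrightarrow> nr (scl (num U c) x) = cmod c * nr x"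
  unfolding nr_def
  by (simp add: ip_simps mult.assoc[symmetric] complex_mult_cnj cmod_def real_sqrt_mult power2_eq_square
      flip: of_real_add of_real_power)

definition dd :: "'w \<Rightarrow> 'w \<Rightarrow> real" where
  "dd x y = nr (sub x y)"

lemma dd_nonneg [simp]: "x \<in> F \<Longrightarrow> y \<in> F \<Longrightarrow> 0 \<le> dd x y"
  by (simp add: dd_def)

lemma dd_self [simp]: "x \<in> F \<Longrightarrow> dd x x = 0"
  by (simp add: dd_def nr_def ip_simps)

lemma dd_commute: "x \<in> F \<Longrightarrow> y \<in> F \<Longrightarrow> dd x y = dd y x"
  by (simp add: dd_def nr_def ip_simps algebra_simps)

text \<open>The two forms of the difference vector are compared through \<open>ip\<close>: expanding
  squared norms replaces any rearrangement of sums in the space itself. \<open>dd_add\<close>,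
  \<open>dd_scl\<close> and \<open>nr_diff_le\<close> use the same device.\<close>

lemma dd_triangle:
  assumes "x \<in> F" "y \<in> F" "z \<in> F"
  shows "dd x z \<le> dd x y + dd y z"
proof -
  have "dd x z = nr (add (sub x y) (sub y z))"
    using assms by (simp add: dd_def nr_def ip_simps algebra_simps)
  then show ?thesis using assms nr_triangle by (simp add: dd_def)
qed

lemma dd_add:
  assumes "x \<in> F" "y \<in> F" "x' \<in> F" "y' \<in> F"
  shows "dd (add x y) (add x' y') \<le> dd x x' + dd y y'"
proof -
  have "dd (add x y) (add x' y') = nr (add (sub x x') (sub y y'))"
    using assms by (simp add: dd_def nr_def ip_simps algebra_simps)
  then show ?thesis using assms nr_triangle by (simp add: dd_def)
qed

lemma dd_scl:
  assumes "x \<in> F" "y \<in> F"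
  shows "dd (scl (num U c) x) (scl (num U c) y) = cmod c * dd x y"
proof -
  have "dd (scl (num U c) x) (scl (num U c) y) = nr (scl (num U c) (sub x y))"
    using assms by (simp add: dd_def nr_def ip_simps algebra_simps)
  then show ?thesis using assms by (simp add: dd_def nr_scl)
qed

lemma nr_diff_le: "x \<in> F \<Longrightarrow> y \<in> F \<Longrightarrow> nr x \<le> nr y + dd x y"
proof -
  assume *: "x \<in> F" "y \<in> F"
  have "nr x = nr (add y (sub x y))"
    using * by (simp add: nr_def ip_simps algebra_simps)
  then show ?thesis using * nr_triangle[of y "sub x y"] by (simp add: dd_def)
qed

lemma nr_eq: "x \<in> F \<Longrightarrow> y \<in> F \<Longrightarrow> dd x y = 0 \<Longrightarrow> nr x = nr y"
  using nr_diff_le[of x y] nr_diff_le[of y x] by (simp add: dd_commute)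

text \<open>Cauchy-Schwarz makes the real part of every multiple \<open>c * ip x z\<close> at most
  0; the four fourth roots of unity then annihilate the real and the imaginary part.\<close>

lemma ip_null:
  assumes "x \<in> F" "z \<in> F" "nr z = 0"
  shows "ip x z = 0"
proof -
  have *: "Re (c * ip x z) \<le> 0" for c
    using cauchy_schwarz[of "scl (num U c) x" z] assms by (simp add: ip_scl_left)
  show ?thesis using *[of 1] *[of "-1"] *[of "\<i>"] *[of "- \<i>"] by (simp add: complex_eq_iff)
qed

lemma ip_cong_right:
  assumes "x \<in> F" "y \<in> F" "z \<in> F" "dd y z = 0"
  shows "ip x y = ip x z"
  using ip_null[of x "sub y z"] assms by (simp add: dd_def ip_sub_right)

subsection \<open>Classes of vectors\<close>

text \<open>The class is defined inside all of \<open>V\<close>, yet its members are finite, since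
  \<open>y\<close> is \<open>x\<close> plus the infinitesimal vector \<open>sub y x\<close>.\<close>

lemma vhat_eq: "x \<in> F \<Longrightarrow> vhat U H x = {y\<in>F. dd y x = 0}"
proof -
  assume x: "x \<in> F"
  have "napprox U (nrm (sub y x)) (num U 0) \<longleftrightarrow> y \<in> F \<and> dd y x = 0" if y: "y \<in> V" for y
  proof -
    have V: "sub y x \<in> V" using x y by simp
    then have *: "napprox U (nrm (sub y x)) (num U 0) \<longleftrightarrow> apx (nrm (sub y x)) 0"
      by (intro napprox_0_iff) (simp add: vnorm_eq)
    have "y \<in> F" if "apx (nrm (sub y x)) 0"
    proof -
      have "nfinite U (nrm (sub y x))" using that nfinite_iff apx_nC by blast
      then have "sub y x \<in> F" using V by (simp add: nfinite_nrm_iff)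
      then have "add x (sub y x) \<in> F" using x by simp
      then show ?thesis using x y by (simp add: add_sub_cancel)
    qed
    moreover have "apx (nrm (sub y x)) 0 \<longleftrightarrow> dd y x = 0" if "y \<in> F"
      using apx_nrm[of "sub y x"] apx_unique[of "nrm (sub y x)" 0 "complex_of_real (nr (sub y x))"]
        that x by (auto simp: dd_def)
    ultimately show ?thesis using * by blast
  qed
  then show ?thesis unfolding vhat_def hat_def using F_V by blast
qed

lemma vhat_eq_iff:
  assumes "x \<in> F" "y \<in> F"
  shows "vhat U H x = vhat U H y \<longleftrightarrow> dd x y = 0"
proof
  assume *: "vhat U H x = vhat U H y"
  have "x \<in> vhat U H x" unfolding vhat_eq[OF assms(1)] using assms by simp
  then show "dd x y = 0" unfolding * vhat_eq[OF assms(2)] by simp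
next
  assume *: "dd x y = 0"
  have "dd z x = 0 \<longleftrightarrow> dd z y = 0" if "z \<in> F" for z
    using dd_triangle[of z x y] dd_triangle[of z y x] dd_nonneg[of z x] dd_nonneg[of z y]
      * assms that dd_commute[of x y] by auto
  then show "vhat U H x = vhat U H y"
    unfolding vhat_eq[OF assms(1)] vhat_eq[OF assms(2)] by blast
qed

lemma vhat_memI: "x \<in> F \<Longrightarrow> x \<in> vhat U H x"
  by (simp add: vhat_eq)

lemma vhat_memD: "y \<in> vhat U H x \<Longrightarrow> x \<in> F \<Longrightarrow> y \<in> F \<and> dd y x = 0"
  by (simp add: vhat_eq)

lemma Hhull_eq: "Hhull U H = vhat U H ` F"
proof -
  have "fin_part U (vecs U H) (vnorm U H) = F"
    unfolding fin_part_def using nfinite_nrm_iff F_V by blast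
  then show ?thesis by (simp add: Hhull_def nshull_def vhat_def)
qed

lemma hh_add_vhat:
  assumes "x \<in> F" "y \<in> F"
  shows "hh_add U H (vhat U H x) (vhat U H y) = vhat U H (add x y)"
proof -
  have "vhat U H (add x' y') = vhat U H (add x y)" if "x' \<in> vhat U H x" "y' \<in> vhat U H y" for x' y'
  proof -
    have "x' \<in> F" "y' \<in> F" "dd x' x = 0" "dd y' y = 0"
      using vhat_memD that assms by blast+
    then show ?thesis
      using assms dd_add[of x' y' x y] dd_nonneg[of "add x' y'" "add x y"]
      by (simp add: vhat_eq_iff del: dd_nonneg)
  qed
  then show ?thesis
    unfolding hh_add_def using vhat_memI[OF assms(1)] vhat_memI[OF assms(2)]
    by (intro UN_const_on) blast+
qed

lemma hh_scale_vhat: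
  assumes "x \<in> F"
  shows "hh_scale U H c (vhat U H x) = vhat U H (scl (num U c) x)"
proof -
  have "vhat U H (scl (num U c) x') = vhat U H (scl (num U c) x)" if "x' \<in> vhat U H x" for x'
    using vhat_memD[OF that assms] assms dd_scl[of x' x c] by (simp add: vhat_eq_iff)
  then show ?thesis
    unfolding hh_scale_def using vhat_memI[OF assms] by (intro UN_const_on) blast+
qed

lemma hh_norm_vhat:
  assumes "x \<in> F"
  shows "hh_norm U H (vhat U H x) = nr x"
proof -
  have *: "standard_part U (nrm y) = nr x" if "y \<in> vhat U H x" for y
    using vhat_memD[OF that assms] assms standard_part_apx[OF apx_nrm, of y] nr_eq[of y x] by simp
  show ?thesis
    unfolding hh_norm_def
  proof (rule the_equality)
    show "\<forall>y\<in>vhat U H x. nr x = standard_part U (nrm y)" using * by simp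
    show "r = nr x" if "\<forall>y\<in>vhat U H x. r = standard_part U (nrm y)" for r
      using bspec[OF that vhat_memI[OF assms]] *[OF vhat_memI[OF assms]] by simp
  qed
qed

end

section \<open>Internal operators and their norms\<close>

context nonstd
begin

definition nonneg :: "complex set" where
  "nonneg = {z. z \<in> \<real> \<and> 0 \<le> Re z}"

lemma nset_nonneg_iff: "x \<in> nelts U (nset U nonneg) \<longleftrightarrow> nle U (num U 0) x"
proof (cases "x \<in> nC U")
  case True
  then obtain w f g where w: "w \<in> nC U" and x: "x = nfun U f w" "x = nfun U g w"
    using True by (rule germ2)
  show ?thesis
    unfolding x(1) num_nfun[OF w] using w by (simp add: germ_simps nonneg_def)
next
  case False
  then show ?thesis using nle_nC nset_nC by blast
qed

lemma nle_antisym: "nle U x y \<Longrightarrow> nle U y x \<Longrightarrow> x = y"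
proof -
  assume *: "nle U x y" "nle U y x"
  then have "x \<in> nC U" "y \<in> nC U" using nle_nC nset_nC by blast+
  then obtain w f g where w: "w \<in> nC U" and xy: "x = nfun U f w" "y = nfun U g w" by (rule germ2)
  have "eventually (\<lambda>z. f z = g z) (ufil w)"
    using * unfolding xy nle_germ[OF w]
    by eventually_elim (simp add: complex_eq_iff complex_is_Real_iff)
  then show ?thesis unfolding xy eq_germ[OF w] .
qed

text \<open>\<open>|b| \<le> c |a|\<close> in terms of the squared norms \<open>s = |a|\<^sup>2\<close> and \<open>t = |b|\<^sup>2\<close>.\<close>

definition bnd :: "complex \<Rightarrow> complex \<Rightarrow> complex \<Rightarrow> bool" where
  "bnd c s t \<longleftrightarrow> sqrt (Re t) \<le> Re c * sqrt (Re s)"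

text \<open>An inequality between norms becomes one standard relation between squared norms, and
  \<open>graph3 bnd\<close> can then be a constant of a bounded formula.\<close>

lemma nle_csqrt_iff:
  assumes "nle U (num U 0) c" "nle U (num U 0) s" "nle U (num U 0) t"
  shows "nle U (nfun U csqrt_re t) (ntimes U c (nfun U csqrt_re s)) \<longleftrightarrow> nrel3 bnd c s t"
proof -
  have "c \<in> nC U" "s \<in> nC U" "t \<in> nC U" using assms nle_nC nset_nC by blast+
  then obtain w f g h where w: "w \<in> nC U" and x: "c = nfun U f w" "s = nfun U g w" "t = nfun U h w"
    by (rule germ3)
  have c: "eventually (\<lambda>z. f z \<in> \<real>) (ufil w)"
    using assms(1) unfolding x num_nfun[OF w] nle_germ[OF w] by eventually_elim simp
  have "(csqrt_re v \<in> \<real> \<and> u * csqrt_re r \<in> \<real> \<and> Re (csqrt_re v) \<le> Re (u * csqrt_re r)) \<longleftrightarrow> bnd u r v"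
    if "u \<in> \<real>" for u v r
    using that by (auto simp: bnd_def csqrt_re_def complex_is_Real_iff)
  then have "eventually (\<lambda>z. (csqrt_re (h z) \<in> \<real> \<and> f z * csqrt_re (g z) \<in> \<real> \<and>
      Re (csqrt_re (h z)) \<le> Re (f z * csqrt_re (g z))) = bnd (f z) (g z) (h z)) (ufil w)"
    by (rule eventually_mono[OF c])
  then show ?thesis
    unfolding x using w
    by (simp add: germ_simps nrel3_nfun eventually_ufil[symmetric] eventually_subst)
qed

text \<open>The constant in \<open>int_ops\<close> may be negative, while \<open>op_bound\<close>
  asks for a nonnegative one; its absolute value will do.\<close>

lemma nle_abs_bound:
  assumes "C \<in> nR U"
  shows "\<exists>C'. nle U (num U 0) C' \<and> (\<forall>r s. nle U (num U 0) r \<longrightarrow> nle U s (ntimes U C r) \<longrightarrow> nle U s (ntimes U C' r))"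
proof (intro exI[of _ "nfun U (\<lambda>z. complex_of_real \<bar>Re z\<bar>) C"] conjI allI impI)
  have C: "C \<in> nC U" using assms nset_nC by blast
  obtain w f g where w: "w \<in> nC U" and x: "C = nfun U f w" "C = nfun U g w"
    using C C by (rule germ2)
  show "nle U (num U 0) (nfun U (\<lambda>z. complex_of_real \<bar>Re z\<bar>) C)"
    unfolding x(1) num_nfun[OF w] using w by (simp add: germ_simps)
  fix r s
  assume rs: "nle U (num U 0) r" "nle U s (ntimes U C r)"
  have "r \<in> nC U" "s \<in> nC U" using rs nle_nC nset_nC by blast+
  then obtain w f g h where w: "w \<in> nC U" and x: "C = nfun U f w" "r = nfun U g w" "s = nfun U h w"
    using C germ3 by metis
  have "eventually (\<lambda>z. h z \<in> \<real> \<and> complex_of_real \<bar>Re (f z)\<bar> * g z \<in> \<real> \<and>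
      Re (h z) \<le> Re (complex_of_real \<bar>Re (f z)\<bar> * g z)) (ufil w)"
    using rs assms unfolding x num_nfun[OF w] nle_germ[OF w] ntimes_germ[OF w] nset_germ[OF w]
  proof eventually_elim
    case (elim z)
    then have "Re (f z) * Re (g z) \<le> \<bar>Re (f z)\<bar> * Re (g z)"
      by (intro mult_right_mono) auto
    then show ?case using elim by (auto simp: complex_is_Real_iff)
  qed
  then show "nle U s (ntimes U (nfun U (\<lambda>z. complex_of_real \<bar>Re z\<bar>) C) r)"
    unfolding x using w by (simp add: germ_simps)
qed

text \<open>A single vector that violates the bound \<open>c\<close> pushes every true bound above
  some \<open>c' > c\<close>, namely \<open>sqrt t / sqrt s\<close>. If \<open>s = 0\<close>, no
  bound holds at all and \<open>c + 1\<close> is vacuously below all of them.\<close>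

lemma bnd_lower_bound:
  assumes "c \<in> nelts U (nset U nonneg)" "s \<in> nelts U (nset U nonneg)" "t \<in> nelts U (nset U nonneg)"
    and "\<not> nrel3 bnd c s t"
  shows "\<exists>c'\<in>nelts U (nset U nonneg). \<not> nle U c' c \<and>
    (\<forall>d\<in>nelts U (nset U nonneg). nrel3 bnd d s t \<longrightarrow> nle U c' d)"
proof -
  have "\<exists>c'\<in>nonneg. \<not> (c' \<in> \<real> \<and> c \<in> \<real> \<and> Re c' \<le> Re c) \<and>
      (\<forall>d\<in>nonneg. bnd d s t \<longrightarrow> c' \<in> \<real> \<and> d \<in> \<real> \<and> Re c' \<le> Re d)"
    if "c \<in> nonneg" "s \<in> nonneg" "t \<in> nonneg" "\<not> bnd c s t" for c s t
  proof (cases "Re s = 0")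
    case True
    have "\<not> bnd d s t" for d using that True by (simp add: bnd_def)
    then show ?thesis using that by (intro bexI[of _ "c + 1"]) (auto simp: nonneg_def)
  next
    case False
    then have s: "sqrt (Re s) > 0" using that by (simp add: nonneg_def)
    have "0 \<le> sqrt (Re t)" using that by (simp add: nonneg_def)
    then show ?thesis using that s
      by (intro bexI[of _ "complex_of_real (sqrt (Re t) / sqrt (Re s))"])
        (auto simp: nonneg_def bnd_def pos_divide_le_eq simp del: real_sqrt_gt_0_iff)
  qed
  then have "\<forall>c\<in>nonneg. \<forall>s\<in>nonneg. \<forall>t\<in>nonneg. \<not> bnd c s t \<longrightarrow>
     (\<exists>c'\<in>nonneg. \<not> (c' \<in> \<real> \<and> c \<in> \<real> \<and> Re c' \<le> Re c) \<and>
      (\<forall>d\<in>nonneg. bnd d s t \<longrightarrow> c' \<in> \<real> \<and> d \<in> \<real> \<and> Re c' \<le> Re d))"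
    by blast
  then have "sat (smem U) ((!) [code U (cnum U ` nonneg), graph3 bnd,
        graph2 (\<lambda>x y. x \<in> \<real> \<and> y \<in> \<real> \<and> Re x \<le> Re y)])
      (FBAll 10 0 (FBAll 11 0 (FBAll 12 0 (FImp (FNeg (FRel3 1 10 11 12))
        (FBEx 13 0 (FConj (FNeg (FRel 2 13 10)) (FBAll 14 0 (FImp (FRel3 1 14 11 12) (FRel 2 13 14)))))))))"
    by simp
  then show ?thesis
    unfolding transfer using assms by (simp add: star_simps nle_def)
qed

end

context ihilb
begin

lemma int_opsD:
  assumes "a \<in> int_ops U H"
  shows "internal U a" "is_fun (nmem U) a (hcar H) (hcar H)"
    "\<And>x y. x \<in> V \<Longrightarrow> y \<in> V \<Longrightarrow> ap U a (add x y) = add (ap U a x) (ap U a y)"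
    "\<And>c x. c \<in> nC U \<Longrightarrow> x \<in> V \<Longrightarrow> ap U a (scl c x) = scl c (ap U a x)"
    "\<exists>C\<in>nR U. \<forall>x\<in>V. nle U (nrm (ap U a x)) (ntimes U C (nrm x))"
  using assms unfolding int_ops_def by blast+

lemma ap_V: "a \<in> int_ops U H \<Longrightarrow> x \<in> V \<Longrightarrow> ap U a x \<in> V"
  using is_fun_app(1)[OF int_opsD(2)] by (simp add: vecs_def ap_def)

lemma grel_op: "a \<in> int_ops U H \<Longrightarrow> x \<in> V \<Longrightarrow> grel (nmem U) a x y \<longleftrightarrow> y = ap U a x"
  using is_fun_app(2)[OF int_opsD(2)] by (simp add: vecs_def ap_def)

lemma ap_sub: "a \<in> int_ops U H \<Longrightarrow> x \<in> V \<Longrightarrow> y \<in> V \<Longrightarrow> ap U a (sub x y) = sub (ap U a x) (ap U a y)"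
  by (simp add: vsub_def int_opsD(3,4))

lemma nrm_nonneg: "x \<in> V \<Longrightarrow> nle U (num U 0) (nrm x)"
  using nsqrt_iff[OF inn_pos, of x "nrm x"] vnorm_eq by blast

lemma nrm_bound_iff:
  assumes "a \<in> int_ops U H" "x \<in> V" "nle U (num U 0) c"
  shows "nle U (nrm (ap U a x)) (ntimes U c (nrm x)) \<longleftrightarrow> nrel3 bnd c (inr x x) (inr (ap U a x) (ap U a x))"
  using nle_csqrt_iff[OF assms(3) inn_pos[OF assms(2)] inn_pos[OF ap_V[OF assms(1,2)]]]
    vnorm_eq[OF assms(2)] vnorm_eq[OF ap_V[OF assms(1,2)]] by simp

lemma op_bound_iff:
  assumes "a \<in> int_ops U H"
  shows "op_bound U H a c \<longleftrightarrow> c \<in> nelts U (nset U nonneg) \<and>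
    (\<forall>x\<in>V. nrel3 bnd c (inr x x) (inr (ap U a x) (ap U a x)))"
proof -
  have "c \<in> nR U \<and> nle U (num U 0) c \<longleftrightarrow> c \<in> nelts U (nset U nonneg)"
    using nle_nC nset_nonneg_iff by blast
  then show ?thesis
    unfolding op_bound_def using nrm_bound_iff[OF assms] nset_nonneg_iff by blast
qed

lemma op_bounds_internal:
  assumes "a \<in> int_ops U H"
  shows "\<exists>D. internal U D \<and> nelts U D = {c. op_bound U H a c}"
proof -
  \<comment> \<open>Slots 0 to 3 hold the internal parameters; the standard constants sit at 20 and
    21, clear of the bound variables 10 to 14.\<close>
  let ?s = "\<lambda>i::nat. if i = 20 then code U (cnum U ` UNIV) else graph3 bnd"
  let ?ps = "[nset U nonneg, hcar H, a, hinner H]"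
  let ?\<phi> = "FBAll 11 1 (FBAll 12 1 (FBAll 13 20 (FBAll 14 20
      (FImp (FConj (FRel 2 11 12) (FConj (FRel3 3 11 11 13) (FRel3 3 12 12 14))) (FRel3 21 10 13 14)))))"
  obtain D where D: "internal U D" "nelts U D = {c \<in> nelts U (?ps ! 0).
      sat (nmem U) ((\<lambda>i. if i < length ?ps then ?ps ! i else star U (?s i))(10 := c)) ?\<phi>}"
    using internal_comprehension[of ?ps ?s ?\<phi>] internal_ops int_opsD(1)[OF assms] by auto
  have "sat (nmem U) ((\<lambda>i. if i < length ?ps then ?ps ! i else star U (?s i))(10 := c)) ?\<phi> \<longleftrightarrow>
     (\<forall>x\<in>V. \<forall>y\<in>V. \<forall>s\<in>nC U. \<forall>t\<in>nC U. grel (nmem U) a x y \<and> grel3 (nmem U) (hinner H) x x s \<and>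
       grel3 (nmem U) (hinner H) y y t \<longrightarrow> nrel3 bnd c s t)" for c
    by (simp add: star_simps vecs_def)
  also have "\<dots> c \<longleftrightarrow> (\<forall>x\<in>V. nrel3 bnd c (inr x x) (inr (ap U a x) (ap U a x)))" for c
    using grel_op[OF assms] grel3_hinner ap_V[OF assms] inn_nC by (metis (no_types, lifting))
  finally have "nelts U D = {c. op_bound U H a c}"
    unfolding D(2) op_bound_iff[OF assms] by auto
  then show ?thesis using D(1) by blast
qed

text \<open>The infimum of the internal set of bounds is itself a bound: a violating vector would
  give a larger lower bound by \<open>bnd_lower_bound\<close>. With antisymmetry this makes the
  description \<open>op_norm\<close> meaningful.\<close>

lemma op_norm_bound:
  assumes "a \<in> int_ops U H"
  shows "op_bound U H a (op_norm U H a)" "op_bound U H a C \<Longrightarrow> nle U (op_norm U H a) C"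
proof -
  obtain D where D: "internal U D" "nelts U D = {c. op_bound U H a c}"
    using op_bounds_internal[OF assms] by blast
  obtain C0 where C0: "C0 \<in> nR U" "\<forall>x\<in>V. nle U (nrm (ap U a x)) (ntimes U C0 (nrm x))"
    using int_opsD(5)[OF assms] by blast
  obtain C1 where C1: "nle U (num U 0) C1"
      "\<And>r s. nle U (num U 0) r \<Longrightarrow> nle U s (ntimes U C0 r) \<Longrightarrow> nle U s (ntimes U C1 r)"
    using nle_abs_bound[OF C0(1)] by blast
  have "op_bound U H a C1"
    unfolding op_bound_def using C1 C0(2) nrm_nonneg nle_nC by blast
  then have "nelts U D \<noteq> {}" using D(2) by blast
  moreover have sub: "nelts U D \<subseteq> nelts U (nset U nonneg)"
    using D(2) op_bound_iff[OF assms] by blast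
  ultimately obtain c where c: "c \<in> nelts U (nset U nonneg)" "\<And>d. d \<in> nelts U D \<Longrightarrow> nle U c d"
      "\<And>c'. c' \<in> nelts U (nset U nonneg) \<Longrightarrow> (\<forall>d\<in>nelts U D. nle U c' d) \<Longrightarrow> nle U c' c"
    using internal_infimum[OF D(1)] unfolding nonneg_def by blast
  have "op_bound U H a c"
    unfolding op_bound_iff[OF assms]
  proof (intro conjI ballI c(1), rule ccontr)
    fix x
    assume x: "x \<in> V" and "\<not> nrel3 bnd c (inr x x) (inr (ap U a x) (ap U a x))"
    then obtain c' where c': "c' \<in> nelts U (nset U nonneg)" "\<not> nle U c' c"
      "\<And>d. d \<in> nelts U (nset U nonneg) \<Longrightarrow> nrel3 bnd d (inr x x) (inr (ap U a x) (ap U a x)) \<Longrightarrow> nle U c' d"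
      using bnd_lower_bound[of c "inr x x" "inr (ap U a x) (ap U a x)"] c(1)
        nset_nonneg_iff inn_pos ap_V[OF assms] by blast
    have "nle U c' d" if "d \<in> nelts U D" for d
      using that D(2) op_bound_iff[OF assms] c'(3) x by blast
    then show False using c(3) c'(1,2) by blast
  qed
  moreover have "nle U c d" if "op_bound U H a d" for d using c(2) D(2) that by blast
  ultimately have "op_norm U H a = c"
    unfolding op_norm_def using nle_antisym by (intro the_equality) blast+
  then show "op_bound U H a (op_norm U H a)" "op_bound U H a C \<Longrightarrow> nle U (op_norm U H a) C"
    using \<open>op_bound U H a c\<close> \<open>\<And>d. op_bound U H a d \<Longrightarrow> nle U c d\<close> by blast+
qed

lemma op_norm_nC: "a \<in> int_ops U H \<Longrightarrow> op_norm U H a \<in> nC U"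
  using op_norm_bound(1) unfolding op_bound_def using nset_nC by blast

lemma op_norm_finite:
  assumes "a \<in> int_ops U H" "apx (op_norm U H a) c" "x \<in> F"
  shows "ap U a x \<in> F \<and> nr (ap U a x) \<le> Re c * nr x"
proof -
  have V: "x \<in> V" "ap U a x \<in> V" using assms ap_V by auto
  have le: "nle U (nrm (ap U a x)) (ntimes U (op_norm U H a) (nrm x))"
    using op_norm_bound(1)[OF assms(1)] V(1) unfolding op_bound_def by blast
  have ap: "apx (ntimes U (op_norm U H a) (nrm x)) (c * complex_of_real (nr x))"
    by (intro apx_ntimes assms apx_nrm)
  then have "nfinite U (ntimes U (op_norm U H a) (nrm x))" using nfinite_iff apx_nC by blast
  then have "nfinite U (nrm (ap U a x))"
    using nfinite_dominated[OF nrm_nonneg[OF V(2)] le] by blast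
  then have F: "ap U a x \<in> F" using nfinite_nrm_iff[OF V(2)] by blast
  then show ?thesis using apx_nle[OF apx_nrm[OF F] ap le] by simp
qed

lemma op_norm_zero:
  assumes "a \<in> int_ops U H" "\<And>x. x \<in> V \<Longrightarrow> inr (ap U a x) (ap U a x) = num U 0"
  shows "op_norm U H a = num U 0"
proof -
  have 0: "nle U (num U 0) (num U 0)" using nset_nonneg_iff[of "num U 0"] by (simp add: nonneg_def)
  have "nrm (ap U a x) = num U 0" if "x \<in> V" for x
  proof -
    obtain w where w: "w \<in> nC U" using num_nset[of 0 UNIV] by blast
    have "nfun U csqrt_re (num U 0) = num U 0"
      unfolding num_nfun[OF w] using w by (simp add: germ_simps csqrt_re_def)
    then show ?thesis using vnorm_eq[OF ap_V[OF assms(1) that]] assms(2)[OF that] by simp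
  qed
  then have "op_bound U H a (num U 0)"
    unfolding op_bound_def using 0 by (simp add: ntimes_0 vnorm_eq)
  then have "nle U (op_norm U H a) (num U 0)" by (rule op_norm_bound(2)[OF assms(1)])
  moreover have "nle U (num U 0) (op_norm U H a)"
    using op_norm_bound(1)[OF assms(1)] unfolding op_bound_def by blast
  ultimately show ?thesis by (rule nle_antisym)
qed

text \<open>Operators are sets of coded pairs, and a pair has only one code. The value at some
  \<open>x0\<close> provides the member that extensionality requires.\<close>

lemma op_ext:
  assumes "a \<in> int_ops U H" "b \<in> int_ops U H" "\<And>x. x \<in> V \<Longrightarrow> ap U a x = ap U b x"
  shows "a = b"
proof -
  obtain x0 where x0: "x0 \<in> V" using V_nonempty by blast
  have *: "elts (nmem U) c \<subseteq> elts (nmem U) d"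
    if c: "c \<in> int_ops U H" and d: "d \<in> int_ops U H" and cd: "\<And>x. x \<in> V \<Longrightarrow> ap U c x = ap U d x" for c d
  proof
    fix p
    assume p: "p \<in> elts (nmem U) c"
    then obtain x y where xy: "x \<in> V" "is_pair (nmem U) p x y"
      using int_opsD(2)[OF c] unfolding is_fun_def vecs_def by blast
    then have "grel (nmem U) c x y" using p by (auto simp: grel_def)
    then have "grel (nmem U) d x y" using grel_op[OF c xy(1)] grel_op[OF d xy(1)] cd[OF xy(1)] by simp
    then obtain q where "q \<in> elts (nmem U) d" "is_pair (nmem U) q x y" by (auto simp: grel_def)
    then show "p \<in> elts (nmem U) d" using N.is_pair_unique[OF xy(2)] by simp
  qed
  have "grel (nmem U) a x0 (ap U a x0)" using grel_op[OF assms(1) x0] by simp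
  then obtain p where "p \<in> elts (nmem U) a" by (auto simp: grel_def)
  moreover have "elts (nmem U) a = elts (nmem U) b"
    using *[OF assms] *[OF assms(2,1)] assms(3) by (intro subset_antisym) auto
  ultimately show ?thesis by (rule N.elts_eqI[rotated])
qed

lemma op_ofI:
  assumes "c \<in> int_ops U H" "\<And>x. x \<in> V \<Longrightarrow> ap U c x = f x"
  shows "op_of U H f = c"
  unfolding op_of_def using assms op_ext by (intro the_equality) auto

lemma op_adjI:
  assumes "a \<in> int_ops U H" "b \<in> int_ops U H" "is_adj U H a b"
  shows "op_adj U H a = b"
  unfolding op_adj_def
proof (rule the_equality)
  fix d
  assume d: "d \<in> int_ops U H \<and> is_adj U H a d"
  have eq: "ap U d y = ap U b y" if "y \<in> V" for y
  proof (rule eq_if_inn_eq)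
    show "inr x (ap U d y) = inr x (ap U b y)" if "x \<in> V" for x
      using d assms(3) that \<open>y \<in> V\<close> unfolding is_adj_def by metis
  qed (use d assms that ap_V in auto)
  show "d = b" by (rule op_ext) (use d assms eq in blast)+
qed (use assms in simp)

end

context nonstd
begin

subsection \<open>Internal sets of vectors and operators\<close>

definition internal_set :: "'w set \<Rightarrow> bool" where
  "internal_set X \<longleftrightarrow> (\<exists>Z. internal U Z \<and> nelts U Z = X)"

lemma internal_set_Int:
  assumes "internal_set X" "internal_set Y"
  shows "internal_set (X \<inter> Y)"
proof -
  obtain A B where AB: "internal U A" "nelts U A = X" "internal U B" "nelts U B = Y"
    using assms by (auto simp: internal_set_def)
  let ?ps = "[A, B]"
  let ?e = "\<lambda>i. if i < length ?ps then ?ps ! i else star U undefined"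
  obtain Z where Z: "internal U Z" "nelts U Z = {x \<in> nelts U (?ps ! 0). sat (nmem U) (?e(10 := x)) (FMem 10 1)}"
    using internal_comprehension[of ?ps "\<lambda>_. undefined" "FMem 10 1"] AB by auto
  then have "nelts U Z = X \<inter> Y" using AB by auto
  then show ?thesis using Z(1) by (auto simp: internal_set_def)
qed

lemma internal_set_saturation:
  fixes \<kappa> :: "'k rel"
  assumes "saturated U \<kappa>" "natLeq <o \<kappa>" "\<And>n::nat. internal_set (X n)"
    and "\<And>n. \<exists>x. \<forall>m\<le>n. x \<in> X m"
  shows "\<exists>x. \<forall>n. x \<in> X n"
proof -
  have "\<forall>n. \<exists>Z. internal U Z \<and> nelts U Z = X n"
    using assms(3) unfolding internal_set_def by blast
  then obtain A where A: "\<And>n. internal U (A n)" "\<And>n. nelts U (A n) = X n"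
    unfolding choice_iff by blast
  have "\<exists>x. \<forall>n. x \<in> nelts U (A n)"
    by (rule countable_saturation[OF assms(1,2) A(1)]) (unfold A(2), rule assms(4))
  then show ?thesis unfolding A(2) .
qed

text \<open>For a nonnegative number an upper bound on the real part already bounds the modulus;
  half-planes are thus enough to express finiteness internally.\<close>

lemma nfinite_if_less:
  assumes "nle U (num U 0) r" "r \<in> nelts U (nset U {z. Re z < B})"
  shows "nfinite U r"
proof -
  have "r \<in> nC U" using assms(2) by (rule nset_nC)
  then obtain w f g where w: "w \<in> nC U" and r: "r = nfun U f w" "r = nfun U g w"
    using germ2[of r r] by metis
  obtain n :: nat where n: "B < n" using reals_Archimedean2 by blast
  have "eventually (\<lambda>z. cmod (f z) < n) (ufil w)"
    using assms unfolding r(1) num_nfun[OF w] nle_germ[OF w] nset_germ[OF w]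
    by eventually_elim (use n in \<open>simp add: in_Reals_norm\<close>)
  then show ?thesis using nfinite_germ[OF w] r(1) by auto
qed

end

context ihilb
begin

lemma hcar_V: "nelts U (hcar H) = V"
  by (simp add: vecs_def)

lemma internal_V: "x \<in> V \<Longrightarrow> internal U x"
  using internal_elem[OF internal_ops(1)] by (simp add: vecs_def)

lemma internal_set_norm: "internal_set {x\<in>V. inr x x \<in> nelts U (nset U S)}"
proof -
  let ?s = "\<lambda>i::nat. code U (cnum U ` S)"
  let ?ps = "[hcar H, hinner H]"
  let ?\<phi> = "FBEx 11 20 (FRel3 1 10 10 11)"
  let ?e = "\<lambda>i. if i < length ?ps then ?ps ! i else star U (?s i)"
  obtain Z where Z: "internal U Z" "nelts U Z = {x \<in> nelts U (?ps ! 0). sat (nmem U) (?e(10 := x)) ?\<phi>}"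
    using internal_comprehension[of ?ps ?s ?\<phi>] internal_ops by auto
  have "sat (nmem U) (?e(10 := x)) ?\<phi> \<longleftrightarrow> inr x x \<in> nelts U (nset U S)" if "x \<in> V" for x
    using that by (simp add: star_simps grel3_hinner)
  then have "nelts U Z = {x\<in>V. inr x x \<in> nelts U (nset U S)}"
    unfolding Z(2) nth_Cons_0 hcar_V by blast
  then show ?thesis using Z(1) unfolding internal_set_def by blast
qed

lemma internal_set_op_norm:
  assumes "a \<in> int_ops U H"
  shows "internal_set {x\<in>V. inr (ap U a x) (ap U a x) \<in> nelts U (nset U S)}"
proof -
  let ?s = "\<lambda>i::nat. code U (cnum U ` S)"
  let ?ps = "[hcar H, a, hinner H]"
  let ?\<phi> = "FBEx 11 0 (FBEx 12 20 (FConj (FRel 1 10 11) (FRel3 2 11 11 12)))"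
  let ?e = "\<lambda>i. if i < length ?ps then ?ps ! i else star U (?s i)"
  obtain Z where Z: "internal U Z" "nelts U Z = {x \<in> nelts U (?ps ! 0). sat (nmem U) (?e(10 := x)) ?\<phi>}"
    using internal_comprehension[of ?ps ?s ?\<phi>] internal_ops int_opsD(1)[OF assms] by auto
  have "sat (nmem U) (?e(10 := x)) ?\<phi> \<longleftrightarrow> inr (ap U a x) (ap U a x) \<in> nelts U (nset U S)" if "x \<in> V" for x
    using that ap_V[OF assms that]
    by (simp add: star_simps hcar_V grel_op[OF assms]) (auto simp: grel3_hinner)
  then have "nelts U Z = {x\<in>V. inr (ap U a x) (ap U a x) \<in> nelts U (nset U S)}"
    unfolding Z(2) nth_Cons_0 hcar_V by blast
  then show ?thesis using Z(1) unfolding internal_set_def by blast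
qed

end

section \<open>The nonstandard hull of an internal C*-algebra\<close>

locale icstar = ihilb U H for U :: "('u, 'w) nsu" and H :: "'w ihs" +
  fixes M :: 'w
  assumes cstar: "internal_cstar_algebra U H M"
begin

abbreviation "E \<equiv> nelts U M"

lemma internal_M: "internal U M"
  and E_int: "a \<in> E \<Longrightarrow> a \<in> int_ops U H"
  and E_add: "a \<in> E \<Longrightarrow> b \<in> E \<Longrightarrow> \<exists>c\<in>E. \<forall>x\<in>V. ap U c x = add (ap U a x) (ap U b x)"
  and E_scl: "t \<in> nC U \<Longrightarrow> a \<in> E \<Longrightarrow> \<exists>c\<in>E. \<forall>x\<in>V. ap U c x = scl t (ap U a x)"
  and E_mult: "a \<in> E \<Longrightarrow> b \<in> E \<Longrightarrow> \<exists>c\<in>E. \<forall>x\<in>V. ap U c x = ap U a (ap U b x)"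
  and E_adj: "a \<in> E \<Longrightarrow> \<exists>b\<in>E. is_adj U H a b"
  using cstar unfolding internal_cstar_algebra_def by blast+

lemma E_V [simp]: "a \<in> E \<Longrightarrow> x \<in> V \<Longrightarrow> ap U a x \<in> V"
  by (rule ap_V[OF E_int])

lemma internal_set_op_dist:
  assumes "x \<in> V" "v \<in> V"
  shows "internal_set {b\<in>E. inr (add (ap U b x) v) (add (ap U b x) v) \<in> nelts U (nset U S)}"
proof -
  let ?s = "\<lambda>i::nat. code U (cnum U ` S)"
  let ?ps = "[M, hcar H, hadd H, hinner H, x, v]"
  let ?\<phi> = "FBEx 11 1 (FBEx 12 1 (FBEx 13 20
      (FConj (FRel 10 4 11) (FConj (FRel3 2 11 5 12) (FRel3 3 12 12 13)))))"
  let ?e = "\<lambda>i. if i < length ?ps then ?ps ! i else star U (?s i)"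
  obtain Z where Z: "internal U Z" "nelts U Z = {x \<in> nelts U (?ps ! 0). sat (nmem U) (?e(10 := x)) ?\<phi>}"
    using internal_comprehension[of ?ps ?s ?\<phi>] internal_ops internal_M internal_V assms by auto
  have "sat (nmem U) (?e(10 := b)) ?\<phi> \<longleftrightarrow>
      inr (add (ap U b x) v) (add (ap U b x) v) \<in> nelts U (nset U S)" if "b \<in> E" for b
  proof -
    have "sat (nmem U) (?e(10 := b)) ?\<phi> \<longleftrightarrow> (\<exists>y\<in>V. \<exists>z\<in>V. \<exists>r\<in>nelts U (nset U S).
        grel (nmem U) b x y \<and> grel3 (nmem U) (hadd H) y v z \<and> grel3 (nmem U) (hinner H) z z r)"
      by (simp add: star_simps hcar_V)
    also have "\<dots> \<longleftrightarrow> (\<exists>y\<in>V. \<exists>z\<in>V. \<exists>r\<in>nelts U (nset U S).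
        y = ap U b x \<and> z = add y v \<and> r = inr z z)"
      using grel_op[OF E_int[OF that] assms(1)] grel3_hadd grel3_hinner assms(2)
      by (intro bex_cong refl) simp
    also have "\<dots> \<longleftrightarrow> inr (add (ap U b x) v) (add (ap U b x) v) \<in> nelts U (nset U S)"
      using E_V[OF that assms(1)] add_V assms(2) by blast
    finally show ?thesis .
  qed
  then have "nelts U Z = {b\<in>E. inr (add (ap U b x) v) (add (ap U b x) v) \<in> nelts U (nset U S)}"
    unfolding Z(2) nth_Cons_0 by blast
  then show ?thesis using Z(1) unfolding internal_set_def by blast
qed

text \<open>This is the set of operators of norm at most \<open>c\<close>, for real
  \<open>c \<ge> 0\<close>, expressed by a quantifier over vectors because \<open>op_norm\<close>
  cannot occur in a formula.\<close>

lemma internal_set_op_bounded: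
  "internal_set {b\<in>E. \<forall>x\<in>V. nrel3 bnd (num U c) (inr x x) (inr (ap U b x) (ap U b x))}"
proof -
  let ?s = "\<lambda>i::nat. if i = 20 then code U (cnum U ` UNIV) else if i = 21 then graph3 bnd else cnum U c"
  let ?ps = "[M, hcar H, hinner H]"
  let ?\<phi> = "FBAll 11 1 (FBAll 12 1 (FBAll 13 20 (FBAll 14 20
      (FImp (FConj (FRel 10 11 12) (FConj (FRel3 2 11 11 13) (FRel3 2 12 12 14))) (FRel3 21 22 13 14)))))"
  let ?e = "\<lambda>i. if i < length ?ps then ?ps ! i else star U (?s i)"
  obtain Z where Z: "internal U Z" "nelts U Z = {x \<in> nelts U (?ps ! 0). sat (nmem U) (?e(10 := x)) ?\<phi>}"
    using internal_comprehension[of ?ps ?s ?\<phi>] internal_ops internal_M by auto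
  have "sat (nmem U) (?e(10 := b)) ?\<phi> \<longleftrightarrow>
      (\<forall>x\<in>V. nrel3 bnd (num U c) (inr x x) (inr (ap U b x) (ap U b x)))" if "b \<in> E" for b
  proof -
    have "sat (nmem U) (?e(10 := b)) ?\<phi> \<longleftrightarrow>
     (\<forall>x\<in>V. \<forall>y\<in>V. \<forall>s\<in>nC U. \<forall>t\<in>nC U. grel (nmem U) b x y \<and> grel3 (nmem U) (hinner H) x x s \<and>
       grel3 (nmem U) (hinner H) y y t \<longrightarrow> nrel3 bnd (num U c) s t)"
      by (simp add: star_simps hcar_V num_def[symmetric])
    also have "\<dots> \<longleftrightarrow> (\<forall>x\<in>V. nrel3 bnd (num U c) (inr x x) (inr (ap U b x) (ap U b x)))"
      using grel_op[OF E_int[OF that]] grel3_hinner E_V[OF that] inn_nC by (metis (no_types, lifting))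
    finally show ?thesis .
  qed
  then have "nelts U Z = {b\<in>E. \<forall>x\<in>V. nrel3 bnd (num U c) (inr x x) (inr (ap U b x) (ap U b x))}"
    unfolding Z(2) nth_Cons_0 by blast
  then show ?thesis using Z(1) unfolding internal_set_def by blast
qed

lemma E_sub: "a \<in> E \<Longrightarrow> b \<in> E \<Longrightarrow> op_sub U H a b \<in> E \<and> (\<forall>x\<in>V. ap U (op_sub U H a b) x = sub (ap U a x) (ap U b x))"
proof -
  assume a: "a \<in> E" and b: "b \<in> E"
  obtain d where d: "d \<in> E" "\<forall>x\<in>V. ap U d x = scl (num U (-1)) (ap U b x)"
    using E_scl[of "num U (-1)" b] b by auto
  obtain c where c: "c \<in> E" "\<forall>x\<in>V. ap U c x = add (ap U a x) (ap U d x)"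
    using E_add[OF a d(1)] by blast
  then have *: "ap U c x = sub (ap U a x) (ap U b x)" if "x \<in> V" for x
    using d that by (simp add: vsub_def)
  have "op_sub U H a b = c"
    unfolding op_sub_def by (rule op_ofI[OF E_int[OF c(1)] *])
  then show ?thesis using c(1) * by simp
qed

lemma E_op_mult: "a \<in> E \<Longrightarrow> b \<in> E \<Longrightarrow> op_mult U H a b \<in> E \<and> (\<forall>x\<in>V. ap U (op_mult U H a b) x = ap U a (ap U b x))"
proof -
  assume "a \<in> E" "b \<in> E"
  then obtain c where c: "c \<in> E" "\<forall>x\<in>V. ap U c x = ap U a (ap U b x)"
    using E_mult by blast
  have "op_mult U H a b = c"
    unfolding op_mult_def using c by (intro op_ofI E_int) auto
  then show ?thesis using c by simp
qed

lemma E_op_adj: "a \<in> E \<Longrightarrow> op_adj U H a \<in> E \<and> is_adj U H a (op_adj U H a)"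
  using E_adj op_adjI E_int by metis

definition FM :: "'w set" where
  "FM = {a\<in>E. nfinite U (op_norm U H a)}"

lemma FM_E: "a \<in> FM \<Longrightarrow> a \<in> E"
  by (simp add: FM_def)

lemma FM_bounded:
  assumes "a \<in> FM"
  shows "\<exists>C\<ge>0. \<forall>x\<in>F. ap U a x \<in> F \<and> nr (ap U a x) \<le> C * nr x"
proof -
  have a: "a \<in> int_ops U H" using assms FM_E E_int by blast
  obtain c where c: "apx (op_norm U H a) c"
    using assms nfinite_iff[OF op_norm_nC[OF a]] by (auto simp: FM_def)
  have "0 \<le> Re c"
    using apx_nle[OF apx_num c, of 0] op_norm_bound(1)[OF a] unfolding op_bound_def by simp
  then show ?thesis using op_norm_finite[OF a c] by blast
qed

lemma FM_F [simp]: "a \<in> FM \<Longrightarrow> x \<in> F \<Longrightarrow> ap U a x \<in> F"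
  using FM_bounded by blast

lemma FM_add: "a \<in> FM \<Longrightarrow> x \<in> F \<Longrightarrow> y \<in> F \<Longrightarrow> ap U a (add x y) = add (ap U a x) (ap U a y)"
  and FM_scl: "a \<in> FM \<Longrightarrow> x \<in> F \<Longrightarrow> ap U a (scl (num U c) x) = scl (num U c) (ap U a x)"
  and FM_sub: "a \<in> FM \<Longrightarrow> x \<in> F \<Longrightarrow> y \<in> F \<Longrightarrow> ap U a (sub x y) = sub (ap U a x) (ap U a y)"
  using int_opsD(3,4)[OF E_int[OF FM_E]] ap_sub[OF E_int[OF FM_E]] by auto

lemma FM_cong:
  assumes "a \<in> FM" "x \<in> F" "y \<in> F" "dd x y = 0"
  shows "dd (ap U a x) (ap U a y) = 0"
proof -
  obtain C where "nr (ap U a (sub x y)) \<le> C * nr (sub x y)" "ap U a (sub x y) \<in> F"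
    using FM_bounded[OF assms(1)] F_sub[OF assms(2,3)] by blast
  then show ?thesis
    using assms nr_nonneg[of "ap U a (sub x y)"] by (simp add: dd_def FM_sub del: nr_nonneg)
qed

lemma ahat_eq: "ahat U H M a = {b\<in>E. napprox U (op_norm U H (op_sub U H b a)) (num U 0)}"
  by (simp add: ahat_def hat_def)

text \<open>Nothing is assumed about the norm of \<open>b\<close>: finiteness of \<open>b x\<close>
  comes from writing it as \<open>a x + (b - a) x\<close>, where \<open>b - a\<close> has
  infinitesimal norm.\<close>

lemma ahat_memD:
  assumes "b \<in> ahat U H M a" "a \<in> FM" "x \<in> F"
  shows "b \<in> E" "ap U b x \<in> F" "dd (ap U b x) (ap U a x) = 0"
proof -
  show b: "b \<in> E" using assms(1) by (simp add: ahat_eq)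
  have a: "a \<in> E" using assms(2) by (rule FM_E)
  let ?c = "op_sub U H b a"
  have c: "?c \<in> E" "ap U ?c x = sub (ap U b x) (ap U a x)"
    using E_sub[OF b a] assms(3) by auto
  have "apx (op_norm U H ?c) 0"
    using assms(1) op_norm_nC[OF E_int[OF c(1)]] by (simp add: ahat_eq napprox_0_iff)
  then have *: "sub (ap U b x) (ap U a x) \<in> F" "nr (sub (ap U b x) (ap U a x)) \<le> 0"
    using op_norm_finite[OF E_int[OF c(1)] _ assms(3), of 0] c(2) by auto
  have "add (ap U a x) (sub (ap U b x) (ap U a x)) \<in> F"
    using * assms by (intro F_add FM_F)
  then show "ap U b x \<in> F" using a b assms(3) by (simp add: add_sub_cancel)
  show "dd (ap U b x) (ap U a x) = 0"
    using * nr_nonneg[of "sub (ap U b x) (ap U a x)"] by (simp add: dd_def del: nr_nonneg)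
qed

lemma ahat_self:
  assumes "a \<in> E"
  shows "a \<in> ahat U H M a"
proof -
  have c: "op_sub U H a a \<in> E" "\<And>x. x \<in> V \<Longrightarrow> ap U (op_sub U H a a) x = sub (ap U a x) (ap U a x)"
    using E_sub[OF assms assms] by auto
  have "op_norm U H (op_sub U H a a) = num U 0"
    using assms by (intro op_norm_zero E_int c(1)) (simp add: c(2) sub_self inn_scl_left ntimes_0)
  then show ?thesis using assms apx_num[of 0] by (simp add: ahat_eq apx_def)
qed

lemma Mhull_eq: "Mhull U H M = ahat U H M ` FM"
  by (simp add: Mhull_def nshull_def ahat_def FM_def fin_part_def)

lemma rep_ahat:
  assumes "a \<in> FM" "x \<in> F"
  shows "rep U H (ahat U H M a) (vhat U H x) = vhat U H (ap U a x)"
proof -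
  have *: "vhat U H (ap U b y) = vhat U H (ap U a x)"
    if "b \<in> ahat U H M a" "y \<in> vhat U H x" for b y
  proof -
    have y: "y \<in> F" "dd y x = 0" using vhat_memD that assms by blast+
    have "vhat U H (ap U b y) = vhat U H (ap U a y)"
      using ahat_memD[OF that(1) assms(1) y(1)] assms y by (simp add: vhat_eq_iff)
    also have "\<dots> = vhat U H (ap U a x)"
      using FM_cong[OF assms(1) y(1) assms(2) y(2)] assms y by (simp add: vhat_eq_iff)
    finally show ?thesis .
  qed
  have "vhat U H x \<in> Hhull U H" using assms by (simp add: Hhull_eq)
  then have "rep U H (ahat U H M a) (vhat U H x) =
      (\<Union>b\<in>ahat U H M a. \<Union>y\<in>vhat U H x. vhat U H (ap U b y))"
    by (simp add: rep_def)
  also have "\<dots> = vhat U H (ap U a x)"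
    using ahat_self[OF FM_E[OF assms(1)]] vhat_memI[OF assms(2)] *
    by (intro UN_const_on) blast+
  finally show ?thesis .
qed

lemma hull_range_ahat:
  assumes "a \<in> FM"
  shows "hull_range U H (ahat U H M a) = (\<lambda>x. vhat U H (ap U a x)) ` F"
  unfolding hull_range_def Hhull_eq image_image using rep_ahat[OF assms] by (intro image_cong) auto

text \<open>Hull operations are unions over representatives, so the projection equations only place
  \<open>op_mult U H a a\<close> and \<open>op_adj U H a\<close> in the class of \<open>a\<close>.
  Idempotence and self-adjointness of \<open>a\<close> thus hold up to infinitesimals.\<close>

lemma Mhull_projectionD:
  assumes "Mhull_projection U H M P"
  obtains a where "a \<in> FM" "P = ahat U H M a"
    "\<And>x. x \<in> F \<Longrightarrow> dd (ap U a (ap U a x)) (ap U a x) = 0"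
    "\<And>x y. x \<in> F \<Longrightarrow> y \<in> F \<Longrightarrow> ip (ap U a x) y = ip x (ap U a y)"
proof -
  have P: "P \<in> Mhull U H M" "mh_mult U H M P P = P" "mh_adj U H M P = P"
    using assms by (auto simp: Mhull_projection_def)
  obtain a where a: "a \<in> FM" "P = ahat U H M a" using P(1) by (auto simp: Mhull_eq)
  have aE: "a \<in> E" using a(1) by (rule FM_E)
  have aP: "a \<in> P" using ahat_self[OF aE] a(2) by simp
  have "op_mult U H a a \<in> mh_mult U H M P P"
    unfolding mh_mult_def using aP ahat_self E_op_mult[OF aE aE] by blast
  then have m: "op_mult U H a a \<in> ahat U H M a" using P(2) a(2) by simp
  have "op_adj U H a \<in> mh_adj U H M P"
    unfolding mh_adj_def using aP ahat_self E_op_adj[OF aE] by blast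
  then have s: "op_adj U H a \<in> ahat U H M a" using P(3) a(2) by simp
  show ?thesis
  proof (rule that[OF a])
    fix x
    assume x: "x \<in> F"
    then show "dd (ap U a (ap U a x)) (ap U a x) = 0"
      using ahat_memD(3)[OF m a(1) x] E_op_mult[OF aE aE] by simp
    fix y
    assume y: "y \<in> F"
    have adj: "ap U (op_adj U H a) y \<in> F" "dd (ap U (op_adj U H a) y) (ap U a y) = 0"
      using ahat_memD(2,3)[OF s a(1) y] by blast+
    have "inr (ap U a x) y = inr x (ap U (op_adj U H a) y)"
      using E_op_adj[OF aE] x y unfolding is_adj_def by simp
    then have "ip (ap U a x) y = ip x (ap U (op_adj U H a) y)" by (simp add: ip_def)
    also have "\<dots> = ip x (ap U a y)"
      using x y a(1) adj by (intro ip_cong_right) auto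
    finally show "ip (ap U a x) y = ip x (ap U a y)" .
  qed
qed

end

section \<open>Increasing sequences of projections\<close>

text \<open>
  Agreement on finite sets of coordinates puts \<open>T\<close> into the closure whatever the topology of the
  factors is.
\<close>

lemma closedin_product_finite_agreement:
  assumes closed: "closedin (subtopology (product_topology (\<lambda>_. \<tau>) I) S) R"
    and T: "T \<in> S" "T \<in> extensional I"
    and agree: "\<And>J. finite J \<Longrightarrow> J \<subseteq> I \<Longrightarrow> \<exists>r\<in>R. \<forall>i\<in>J. r i = T i"
  shows "T \<in> R"
proof (rule ccontr)
  let ?P = "product_topology (\<lambda>_. \<tau>) I"
  assume "T \<notin> R"
  have R: "R \<subseteq> S" "\<And>r i. r \<in> R \<Longrightarrow> i \<in> I \<Longrightarrow> r i \<in> topspace \<tau>"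
    using closedin_subset[OF closed] by (auto simp: PiE_iff)
  \<comment> \<open>Nothing is known about the points of \<open>\<tau>\<close>; membership is
    inherited from an element of \<open>R\<close> that agrees with \<open>T\<close> at
    \<open>i\<close>.\<close>
  have "T i \<in> topspace \<tau>" if "i \<in> I" for i
    using agree[of "{i}"] R(2)[OF _ that] that by (metis empty_subsetI finite.emptyI finite.insertI insertI1 insert_subset)
  then have "T \<in> topspace ?P" using T(2) by (simp add: PiE_iff)
  moreover obtain W where W: "openin ?P W" "topspace (subtopology ?P S) - R = W \<inter> S"
    using closed by (auto simp: closedin_def openin_subtopology)
  ultimately have "T \<in> W" using T(1) \<open>T \<notin> R\<close> by auto
  then obtain B where B: "finite {i \<in> I. B i \<noteq> topspace \<tau>}" "T \<in> Pi\<^sub>E I B" "Pi\<^sub>E I B \<subseteq> W"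
    using W(1) unfolding openin_product_topology_alt by blast
  obtain r where r: "r \<in> R" "\<And>i. i \<in> I \<Longrightarrow> B i \<noteq> topspace \<tau> \<Longrightarrow> r i = T i"
    using agree[OF B(1)] by auto
  have "r \<in> extensional I"
    using closedin_subset[OF closed] r(1) by (auto simp: PiE_iff)
  moreover have "r i \<in> B i" if "i \<in> I" for i
    using B(2) r R(2) that by (cases "B i = topspace \<tau>") (auto simp: PiE_iff)
  ultimately have "r \<in> Pi\<^sub>E I B" by (simp add: PiE_iff)
  then have "r \<in> W" using B(3) by blast
  then show False using W(2) r(1) R(1) by blast
qed

section \<open>Exact internal bounds from estimates in the hull\<close>

context ihilb
begin

text \<open>Estimates in the hull see only finite vectors, whereas an internal bound concerns all
  \<open>x\<close>, infinitesimal or infinite. Scaling by \<open>1 / |x|\<close> connects the two: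
  if the scaled value of \<open>t\<close> stays below \<open>4 = 2^2\<close>, then 2 bounds exactly
  at \<open>x\<close>. The bound \<open>c0\<close> covers the null vector, where it forces
  \<open>t\<close> to vanish.\<close>

lemma unit_scaling:
  assumes "x \<in> V"
  shows "\<exists>c\<in>nC U. scl c x \<in> F \<and> nr (scl c x) \<le> 1 \<and>
    (\<forall>t c0. nle U (num U 0) t \<longrightarrow> nrel3 bnd c0 (inr x x) t \<longrightarrow>
      ntimes U (ncnj U c) (ntimes U c t) \<in> nelts U (nset U {z. Re z < 4}) \<longrightarrow> nrel3 bnd (num U 2) (inr x x) t)"
proof -
  \<comment> \<open>Division by zero makes \<open>c\<close> vanish when \<open>x\<close> does.\<close>
  define c where "c = nfun U (\<lambda>z. complex_of_real (1 / sqrt (Re z))) (inr x x)"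
  have s: "inr x x \<in> nC U" "nle U (num U 0) (inr x x)" using assms inn_pos by auto
  have c: "c \<in> nC U" using s by (simp add: c_def)
  have eq: "inr (scl c x) (scl c x) = ntimes U (ncnj U c) (ntimes U c (inr x x))"
    using c assms by (simp add: inn_scl_left inn_scl_right)
  obtain w f g where w: "w \<in> nC U" and f: "inr x x = nfun U f w" "inr x x = nfun U g w"
    using s(1) s(1) by (rule germ2)
  have ev: "eventually (\<lambda>z. cnj (complex_of_real (1 / sqrt (Re (f z)))) *
      (complex_of_real (1 / sqrt (Re (f z))) * f z) \<in> {z. z \<in> \<real> \<and> Re z \<le> 1}) (ufil w)"
    using s(2) unfolding f(1) num_nfun[OF w] nle_germ[OF w]
  proof eventually_elim
    case (elim z)
    obtain r where r: "f z = complex_of_real r" "0 \<le> r"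
      using elim by (metis Re_complex_of_real complex_is_Real_iff complex_eq_iff Im_complex_of_real zero_complex.simps(1))
    then have "cnj (complex_of_real (1 / sqrt (Re (f z)))) * (complex_of_real (1 / sqrt (Re (f z))) * f z)
        = complex_of_real (1 / sqrt r * (1 / sqrt r * r))"
      by (simp only: r(1) Re_complex_of_real complex_cnj_complex_of_real of_real_mult)
    moreover have "1 / sqrt r * (1 / sqrt r * r) \<le> 1"
      using r(2) by (cases "r = 0") (simp_all add: field_simps)
    ultimately show ?case by simp
  qed
  have c': "c = nfun U (\<lambda>z. complex_of_real (1 / sqrt (Re (f z)))) w"
    by (simp only: c_def f(1) nfun_nfun[OF w])
  have in1: "inr (scl c x) (scl c x) \<in> nelts U (nset U {z. z \<in> \<real> \<and> Re z \<le> 1})"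
    unfolding eq unfolding c' f(1) ncnj_germ[OF w] ntimes_germ[OF w] nset_germ[OF w] by (rule ev)
  then have "inr (scl c x) (scl c x) \<in> nelts U (nset U {z. Re z < 2})"
    by (rule rev_subsetD[OF _ nset_mono]) auto
  then have "nfinite U (inr (scl c x) (scl c x))"
    by (rule nfinite_if_less[OF inn_pos[OF scl_V[OF c assms]]])
  then obtain d where d: "apx (inr (scl c x) (scl c x)) d"
    unfolding nfinite_iff[OF inn_nC[OF scl_V[OF c assms] scl_V[OF c assms]]] by blast
  have F: "scl c x \<in> F" by (rule F_I[OF _ d]) (simp add: c assms)
  have "closed {z. z \<in> \<real> \<and> Re z \<le> 1}"
    using closed_Int[OF closed_complex_Reals closed_halfspace_Re_le[of 1]] by (simp add: Int_def)
  then have "ip (scl c x) (scl c x) \<in> {z. z \<in> \<real> \<and> Re z \<le> 1}"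
    using apx_nset_closed[OF apx_ip[OF F F] in1] by blast
  then have "(nr (scl c x))\<^sup>2 \<le> 1\<^sup>2" using nr_power2[OF F] by simp
  then have "nr (scl c x) \<le> 1" by (rule power2_le_imp_le) simp
  moreover have "nrel3 bnd (num U 2) (inr x x) t"
    if t: "nle U (num U 0) t" "nrel3 bnd c0 (inr x x) t"
      "ntimes U (ncnj U c) (ntimes U c t) \<in> nelts U (nset U {z. Re z < 4})" for t c0
  proof -
    have "t \<in> nC U" "c0 \<in> nC U" using nrel3_nC[OF t(2)] by blast+
    then obtain w f g h where w: "w \<in> nC U" and f: "inr x x = nfun U f w" "t = nfun U g w" "c0 = nfun U h w"
      using germ3[OF s(1)] by metis
    have "eventually (\<lambda>z. bnd 2 (f z) (g z)) (ufil w)"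
      using t s(2) unfolding c_def f num_nfun[OF w] nrel3_nfun[OF w] eventually_ufil[OF w, symmetric]
        nfun_nfun[OF w] ncnj_germ[OF w] ntimes_germ[OF w] nset_germ[OF w] nle_germ[OF w]
    proof eventually_elim
      case (elim z)
      show ?case
      proof (cases "Re (f z) = 0")
        case True
        then show ?thesis using elim by (simp add: bnd_def)
      next
        case False
        then have "Re (f z) > 0" using elim by simp
        then have "Re (g z) / Re (f z) < 4"
          using elim by (simp add: power2_eq_square[symmetric] field_simps flip: of_real_mult of_real_power)
        then have "Re (g z) \<le> 4 * Re (f z)" using \<open>Re (f z) > 0\<close> by (simp add: field_simps)
        then have "sqrt (Re (g z)) \<le> sqrt (2\<^sup>2 * Re (f z))" by (intro real_sqrt_le_mono) simp
        then show ?thesis by (simp add: bnd_def real_sqrt_mult)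
      qed
    qed
    then show ?thesis
      unfolding f num_nfun[OF w] nrel3_nfun[OF w] eventually_ufil[OF w, symmetric] .
  qed
  ultimately show ?thesis using c F by blast
qed

end

section \<open>Algebra of the projections through their representatives\<close>

locale hull_projections = icstar U H M for U :: "('u, 'w) nsu" and H :: "'w ihs" and M :: 'w +
  fixes \<kappa> :: "'k rel" and a :: "nat \<Rightarrow> 'w"
  assumes sat: "saturated U \<kappa>" "natLeq <o \<kappa>"
    and a_FM [simp]: "a n \<in> FM"
    and idem: "x \<in> F \<Longrightarrow> dd (ap U (a n) (ap U (a n) x)) (ap U (a n) x) = 0"
    and self_adjoint: "x \<in> F \<Longrightarrow> y \<in> F \<Longrightarrow> ip (ap U (a n) x) y = ip x (ap U (a n) y)"
    and range_strict: "hull_range U H (ahat U H M (a n)) \<subset> hull_range U H (ahat U H M (a (Suc n)))"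
begin

lemma ip_proj: "x \<in> F \<Longrightarrow> ip (ap U (a n) x) (ap U (a n) x) = ip x (ap U (a n) x)"
  using ip_cong_right[of x, OF _ _ _ idem] by (simp add: self_adjoint)

lemma nr_proj_le: "x \<in> F \<Longrightarrow> nr (ap U (a n) x) \<le> nr x"
proof (cases "nr (ap U (a n) x) = 0")
  case False
  assume x: "x \<in> F"
  then have pos: "nr (ap U (a n) x) > 0" using False nr_nonneg[of "ap U (a n) x"] by (simp add: less_le)
  have "nr (ap U (a n) x) * nr (ap U (a n) x) = Re (ip x (ap U (a n) x))"
    using x by (simp add: ip_proj nr_power2 flip: power2_eq_square)
  also have "\<dots> \<le> nr x * nr (ap U (a n) x)" using x by (intro cauchy_schwarz) auto
  finally show ?thesis using pos by simp
qed simp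

text \<open>On unit vectors the norm of the image is at most 1 up to an infinitesimal, hence exactly
  less than 2. All \<open>a n\<close> therefore lie in one internal set of bounded operators, as
  saturation requires.\<close>

lemma proj_bounded:
  assumes "x \<in> V"
  shows "nrel3 bnd (num U 2) (inr x x) (inr (ap U (a n) x) (ap U (a n) x))"
proof -
  have E: "a n \<in> E" by (rule FM_E) simp
  obtain c where c: "c \<in> nC U" "scl c x \<in> F" "nr (scl c x) \<le> 1"
    and bound: "\<And>t c0. nle U (num U 0) t \<Longrightarrow> nrel3 bnd c0 (inr x x) t \<Longrightarrow>
      ntimes U (ncnj U c) (ntimes U c t) \<in> nelts U (nset U {z. Re z < 4}) \<Longrightarrow> nrel3 bnd (num U 2) (inr x x) t"
    using unit_scaling[OF assms] by blast
  let ?y = "ap U (a n) (scl c x)"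
  have y: "?y \<in> F" using c by simp
  have "(nr ?y)\<^sup>2 \<le> 1\<^sup>2"
    using nr_proj_le[OF c(2), of n] c(3) y by (intro power_mono) auto
  then have "Re (ip ?y ?y) < 4" using nr_power2[OF y] by simp
  then have "inr ?y ?y \<in> nelts U (nset U {z. Re z < 4})"
    by (intro apx_nset_open[OF apx_ip[OF y y]]) (auto intro: open_halfspace_Re_lt)
  moreover have "inr ?y ?y = ntimes U (ncnj U c) (ntimes U c (inr (ap U (a n) x) (ap U (a n) x)))"
    using assms c(1) int_opsD(4)[OF E_int[OF E] c(1) assms] E
    by (simp add: inn_scl_left inn_scl_right)
  ultimately have less: "ntimes U (ncnj U c) (ntimes U c (inr (ap U (a n) x) (ap U (a n) x)))
      \<in> nelts U (nset U {z. Re z < 4})" by simp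
  \<comment> \<open>The operator norm plays the role of \<open>c0\<close>.\<close>
  have "op_bound U H (a n) (op_norm U H (a n))" by (rule op_norm_bound(1)[OF E_int[OF E]])
  then have "nrel3 bnd (op_norm U H (a n)) (inr x x) (inr (ap U (a n) x) (ap U (a n) x))"
    unfolding op_bound_iff[OF E_int[OF E]] using assms by simp
  then show ?thesis by (rule bound[OF inn_pos[OF E_V[OF E assms]] _ less])
qed

lemma proj_mono:
  assumes "m \<le> n" "x \<in> F"
  shows "dd (ap U (a n) (ap U (a m) x)) (ap U (a m) x) = 0"
proof -
  have "hull_range U H (ahat U H M (a m)) \<subseteq> hull_range U H (ahat U H M (a n))"
    by (rule lift_Suc_mono_le[of "\<lambda>n. hull_range U H (ahat U H M (a n))", OF _ assms(1)])
      (rule psubset_imp_subset[OF range_strict])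
  moreover have "vhat U H (ap U (a m) x) \<in> hull_range U H (ahat U H M (a m))"
    unfolding hull_range_ahat[OF a_FM] using assms(2) by blast
  ultimately obtain y where y: "y \<in> F" "vhat U H (ap U (a m) x) = vhat U H (ap U (a n) y)"
    unfolding hull_range_ahat[OF a_FM] by blast
  have F: "ap U (a m) x \<in> F" "ap U (a n) y \<in> F" "ap U (a n) (ap U (a m) x) \<in> F"
    "ap U (a n) (ap U (a n) y) \<in> F"
    using assms(2) y(1) by simp_all
  have d: "dd (ap U (a m) x) (ap U (a n) y) = 0" using y(2) vhat_eq_iff[OF F(1,2)] by simp
  have "dd (ap U (a n) (ap U (a m) x)) (ap U (a n) (ap U (a n) y)) = 0"
    by (rule FM_cong[OF a_FM F(1,2) d])
  moreover have "dd (ap U (a n) (ap U (a n) y)) (ap U (a n) y) = 0" by (rule idem[OF y(1)])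
  ultimately have "dd (ap U (a n) (ap U (a m) x)) (ap U (a m) x) \<le> 0"
    using dd_triangle[OF F(3,4,1)] dd_triangle[OF F(4,2,1)] dd_commute[OF F(1,2)] d by linarith
  then show ?thesis using dd_nonneg[OF F(3,1)] by linarith
qed

text \<open>The adjoint form of \<open>proj_mono\<close>. No adjoint is formed: in the inner square
  of the difference \<open>?w\<close>, self-adjointness moves the projections onto the other factor,
  where \<open>proj_mono\<close> applies.\<close>

lemma proj_mono':
  assumes "m \<le> n" "x \<in> F"
  shows "dd (ap U (a m) (ap U (a n) x)) (ap U (a m) x) = 0"
proof -
  let ?w = "sub (ap U (a m) (ap U (a n) x)) (ap U (a m) x)"
  have w: "?w \<in> F" using assms by simp
  have "ip ?w ?w = ip x (ap U (a n) (ap U (a m) ?w)) - ip x (ap U (a m) ?w)"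
    using assms w by (simp add: ip_sub_left[of _ _ ?w] self_adjoint)
  also have "\<dots> = 0"
    using assms w proj_mono[OF assms(1) w] ip_cong_right[of x] by simp
  finally show ?thesis by (simp add: dd_def nr_def)
qed

lemma proj_pythagoras:
  assumes "m \<le> n" "x \<in> F"
  shows "(dd (ap U (a n) x) (ap U (a m) x))\<^sup>2 = (nr (ap U (a n) x))\<^sup>2 - (nr (ap U (a m) x))\<^sup>2"
proof -
  let ?y = "ap U (a n) x" and ?z = "ap U (a m) x"
  have F: "?y \<in> F" "?z \<in> F" using assms by auto
  have "ip ?y ?z = ip x (ap U (a n) ?z)" using assms by (simp add: self_adjoint)
  also have "\<dots> = ip x ?z" using assms proj_mono[OF assms] F by (intro ip_cong_right) auto
  also have "\<dots> = ip ?z ?z" using ip_proj assms by simp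
  finally have "ip ?y ?z = ip ?z ?z" .
  then show ?thesis
    using F by (simp add: dd_def nr_power2 ip_simps ip_cnj[of ?y ?z])
qed

text \<open>The squared norms increase and are bounded by that of \<open>x\<close>, so they form a
  Cauchy sequence; by \<open>proj_pythagoras\<close> their differences are squared distances, whence
  the tolerance \<open>e^2\<close>.\<close>

lemma proj_Cauchy:
  assumes "x \<in> F" "e > 0"
  shows "\<exists>N. \<forall>m\<ge>N. \<forall>n\<ge>N. dd (ap U (a m) x) (ap U (a n) x) < e"
proof -
  let ?s = "\<lambda>n. (nr (ap U (a n) x))\<^sup>2"
  have "incseq ?s"
    unfolding incseq_def
  proof (intro allI impI)
    fix m n :: nat
    assume "m \<le> n"
    then have "0 \<le> (nr (ap U (a n) x))\<^sup>2 - (nr (ap U (a m) x))\<^sup>2"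
      using proj_pythagoras[OF _ assms(1), of m n] zero_le_power2 by metis
    then show "?s m \<le> ?s n" by simp
  qed
  moreover have "?s n \<le> (nr x)\<^sup>2" for n
    using nr_proj_le[OF assms(1), of n] assms(1) by (intro power_mono) auto
  ultimately obtain l where "?s \<longlonglongrightarrow> l"
    using incseq_convergent[of ?s "(nr x)\<^sup>2"] by blast
  then have "Cauchy ?s" by (rule LIMSEQ_imp_Cauchy)
  then obtain N where N: "\<And>m n. m \<ge> N \<Longrightarrow> n \<ge> N \<Longrightarrow> dist (?s m) (?s n) < e\<^sup>2"
    using assms(2) unfolding Cauchy_def by (meson zero_less_power)
  have *: "dd (ap U (a n) x) (ap U (a m) x) < e" if "m \<ge> N" "m \<le> n" for m n
  proof -
    have "(dd (ap U (a n) x) (ap U (a m) x))\<^sup>2 < e\<^sup>2"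
      using N[of n m] that unfolding proj_pythagoras[OF that(2) assms(1)] dist_real_def by linarith
    then show ?thesis using assms(2) by (intro power2_less_imp_less[of _ e]) auto
  qed
  have "dd (ap U (a m) x) (ap U (a n) x) < e" if "m \<ge> N" "n \<ge> N" for m n
    using *[of m n] *[of n m] that dd_commute[of "ap U (a m) x" "ap U (a n) x"] assms(1)
    by (cases "m \<le> n") auto
  then show ?thesis by blast
qed

end

section \<open>Internal inequalities and standard parts of norms\<close>

context ihilb
begin

lemma internal_set_finite_Int:
  assumes "finite I" "internal_set B" "\<And>i. i \<in> I \<Longrightarrow> internal_set (A i)"
  shows "internal_set {b\<in>B. \<forall>i\<in>I. b \<in> A i}"
  using assms
proof (induction I rule: finite_induct)
  case empty
  then show ?case by simp
next
  case (insert i I)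
  have "{b\<in>B. \<forall>j\<in>insert i I. b \<in> A j} = A i \<inter> {b\<in>B. \<forall>i\<in>I. b \<in> A i}" by auto
  then show ?case using insert internal_set_Int by simp
qed

text \<open>A strict inequality between standard parts persists internally, but an internal strict
  inequality can degenerate to equality of standard parts. The two directions therefore differ in
  strictness.\<close>

lemma nr_less_iff:
  assumes "x \<in> F" "0 \<le> e"
  shows "nr x < e \<Longrightarrow> inr x x \<in> nelts U (nset U {z. Re z < e\<^sup>2})"
    and "inr x x \<in> nelts U (nset U {z. Re z < e\<^sup>2}) \<Longrightarrow> nr x \<le> e"
proof -
  assume "nr x < e"
  then have "(nr x)\<^sup>2 < e\<^sup>2" by (rule power_strict_mono) (simp_all add: assms)
  then have "ip x x \<in> {z. Re z < e\<^sup>2}" by (simp add: nr_power2[OF assms(1)])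
  then show "inr x x \<in> nelts U (nset U {z. Re z < e\<^sup>2})"
    by (rule apx_nset_open[OF apx_ip[OF assms(1,1)] open_halfspace_Re_lt])
next
  assume "inr x x \<in> nelts U (nset U {z. Re z < e\<^sup>2})"
  then have "inr x x \<in> nelts U (nset U {z. Re z \<le> e\<^sup>2})"
    by (rule rev_subsetD[OF _ nset_mono]) auto
  then have "ip x x \<in> {z. Re z \<le> e\<^sup>2}"
    by (rule apx_nset_closed[OF apx_ip[OF assms(1,1)] _ closed_halfspace_Re_le])
  then have "(nr x)\<^sup>2 \<le> e\<^sup>2" by (simp add: nr_power2[OF assms(1)])
  then show "nr x \<le> e" by (rule power2_le_imp_le) (rule assms(2))
qed

lemma nr_greater_iff:
  assumes "x \<in> F" "0 \<le> e"
  shows "e < nr x \<Longrightarrow> inr x x \<in> nelts U (nset U {z. e\<^sup>2 < Re z})"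
    and "inr x x \<in> nelts U (nset U {z. e\<^sup>2 < Re z}) \<Longrightarrow> e \<le> nr x"
proof -
  assume "e < nr x"
  then have "e\<^sup>2 < (nr x)\<^sup>2" by (rule power_strict_mono) (simp_all add: assms)
  then have "ip x x \<in> {z. e\<^sup>2 < Re z}" by (simp add: nr_power2[OF assms(1)])
  then show "inr x x \<in> nelts U (nset U {z. e\<^sup>2 < Re z})"
    by (rule apx_nset_open[OF apx_ip[OF assms(1,1)] open_halfspace_Re_gt])
next
  assume "inr x x \<in> nelts U (nset U {z. e\<^sup>2 < Re z})"
  then have "inr x x \<in> nelts U (nset U {z. e\<^sup>2 \<le> Re z})"
    by (rule rev_subsetD[OF _ nset_mono]) auto
  then have "ip x x \<in> {z. e\<^sup>2 \<le> Re z}"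
    by (rule apx_nset_closed[OF apx_ip[OF assms(1,1)] _ closed_halfspace_Re_ge])
  then have "e\<^sup>2 \<le> (nr x)\<^sup>2" by (simp add: nr_power2[OF assms(1)])
  then show "e \<le> nr x" by (rule power2_le_imp_le) (simp add: assms(1))
qed

lemma F_if_less:
  assumes "x \<in> V" "inr x x \<in> nelts U (nset U {z. Re z < B})"
  shows "x \<in> F"
proof -
  have "nfinite U (inr x x)" by (rule nfinite_if_less[OF inn_pos[OF assms(1)] assms(2)])
  then obtain d where "apx (inr x x) d"
    unfolding nfinite_iff[OF inn_nC[OF assms(1,1)]] by blast
  then show ?thesis by (rule F_I[OF assms(1)])
qed

end

context icstar
begin

lemma FM_if_bounded:
  assumes "b \<in> E" "\<forall>x\<in>V. nrel3 bnd (num U 2) (inr x x) (inr (ap U b x) (ap U b x))"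
  shows "b \<in> FM"
proof -
  have b: "b \<in> int_ops U H" by (rule E_int[OF assms(1)])
  have "op_bound U H b (num U 2)"
    unfolding op_bound_iff[OF b] using assms(2) by (simp add: nonneg_def)
  then have "nle U (op_norm U H b) (num U 2)" by (rule op_norm_bound(2)[OF b])
  moreover have "nle U (num U 0) (op_norm U H b)"
    using op_norm_bound(1)[OF b] unfolding op_bound_def by blast
  moreover have "num U 2 \<in> nC U" by simp
  then have "nfinite U (num U 2)" using nfinite_iff apx_num by blast
  ultimately have "nfinite U (op_norm U H b)" using nfinite_dominated by blast
  then show ?thesis using assms(1) by (simp add: FM_def)
qed

end

section \<open>The strong limit and its absence from the hull\<close>

context hull_projections
begin

text \<open>
  The strong limit of the projections is taken pointwise; by saturation it agrees on any finite
  set of vectors with the action of a single element of the algebra.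
\<close>

definition lim_at :: "'w \<Rightarrow> 'w \<Rightarrow> bool" where
  "lim_at x z \<longleftrightarrow> z \<in> F \<and> (\<lambda>n. dd z (ap U (a n) x)) \<longlonglongrightarrow> 0"

lemma uniform_Cauchy_index:
  assumes "finite I" "I \<subseteq> F" "e > 0"
  shows "\<exists>N. \<forall>x\<in>I. \<forall>m\<ge>N. \<forall>n\<ge>N. dd (ap U (a m) x) (ap U (a n) x) < e"
  using assms(1,2)
proof (induction I rule: finite_induct)
  case empty
  then show ?case by simp
next
  case (insert x I)
  then obtain N1 where N1: "\<forall>x\<in>I. \<forall>m\<ge>N1. \<forall>n\<ge>N1. dd (ap U (a m) x) (ap U (a n) x) < e" by blast
  obtain N2 where N2: "\<forall>m\<ge>N2. \<forall>n\<ge>N2. dd (ap U (a m) x) (ap U (a n) x) < e"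
    using proj_Cauchy[OF _ assms(3)] insert by blast
  show ?case
    by (rule exI[of _ "max N1 N2"]) (use N1 N2 in auto)
qed

text \<open>The conditions are indexed by \<open>k\<close> alone, with all vectors of
  \<open>I\<close> treated together. Each asks that \<open>b\<close> be within \<open>e k\<close> of
  \<open>a (N k)\<close> on \<open>I\<close>; satisfying all of them leaves only an infinitesimal
  error. The bound in \<open>B\<close> keeps the solution inside \<open>FM\<close>.\<close>

lemma finite_limit_exists:
  assumes "finite I" "I \<subseteq> F"
  shows "\<exists>b\<in>FM. \<forall>x\<in>I. lim_at x (ap U b x)"
proof -
  define e :: "nat \<Rightarrow> real" where "e k = 1 / (real k + 1)" for k
  have e: "e k > 0" for k by (simp add: e_def)
  have "\<forall>k. \<exists>N. \<forall>x\<in>I. \<forall>m\<ge>N. \<forall>n\<ge>N. dd (ap U (a m) x) (ap U (a n) x) < e k"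
    using uniform_Cauchy_index[OF assms e] by blast
  then obtain N where N: "\<And>k x m n. x \<in> I \<Longrightarrow> m \<ge> N k \<Longrightarrow> n \<ge> N k \<Longrightarrow> dd (ap U (a m) x) (ap U (a n) x) < e k"
    by metis
  let ?v = "\<lambda>k x. scl (num U (-1)) (ap U (a (N k)) x)"
  define B where "B = {b\<in>E. \<forall>x\<in>V. nrel3 bnd (num U 2) (inr x x) (inr (ap U b x) (ap U b x))}"
  define A where "A k x = {b\<in>E. inr (add (ap U b x) (?v k x)) (add (ap U b x) (?v k x))
      \<in> nelts U (nset U {z. Re z < (e k)\<^sup>2})}" for k x
  have aB: "a n \<in> B" for n
    unfolding B_def using proj_bounded FM_E[OF a_FM] by blast
  have dd_eq: "dd (ap U b x) (ap U (a (N k)) x) = nr (add (ap U b x) (?v k x))" for b k x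
    by (simp add: dd_def vsub_def)
  have "\<exists>b. \<forall>k. b \<in> {b\<in>B. \<forall>x\<in>I. b \<in> A k x}"
  proof (rule internal_set_saturation[OF sat])
    show "internal_set {b\<in>B. \<forall>x\<in>I. b \<in> A k x}" for k
    proof (rule internal_set_finite_Int[OF assms(1)])
      show "internal_set B" unfolding B_def by (rule internal_set_op_bounded)
      fix x
      assume "x \<in> I"
      then have "x \<in> F" using assms(2) by blast
      then have "x \<in> V" "?v k x \<in> V" by simp_all
      then show "internal_set (A k x)" unfolding A_def by (rule internal_set_op_dist)
    qed
    fix n
    \<comment> \<open>One late projection meets the first conditions simultaneously, its index being
      past every \<open>N k\<close> with \<open>k \<le> n\<close>.\<close>
    have "a (Max (N ` {..n})) \<in> A k x" if k: "k \<le> n" and x: "x \<in> I" for k x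
    proof -
      have xF: "x \<in> F" using x assms(2) by blast
      have "N k \<le> Max (N ` {..n})" using k by (intro Max_ge) auto
      then have "dd (ap U (a (Max (N ` {..n}))) x) (ap U (a (N k)) x) < e k"
        using N[OF x] by simp
      then have "inr (add (ap U (a (Max (N ` {..n}))) x) (?v k x)) (add (ap U (a (Max (N ` {..n}))) x) (?v k x))
          \<in> nelts U (nset U {z. Re z < (e k)\<^sup>2})"
        unfolding dd_eq by (rule nr_less_iff(1)[rotated 2]) (simp_all add: xF less_imp_le[OF e])
      then show ?thesis unfolding A_def using FM_E[OF a_FM] by blast
    qed
    then show "\<exists>b. \<forall>k\<le>n. b \<in> {b\<in>B. \<forall>x\<in>I. b \<in> A k x}" using aB by blast
  qed
  then obtain b where b: "b \<in> B" "\<And>k x. x \<in> I \<Longrightarrow> b \<in> A k x" by blast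
  have bFM: "b \<in> FM" using b(1) FM_if_bounded unfolding B_def by blast
  have "lim_at x (ap U b x)" if x: "x \<in> I" for x
    unfolding lim_at_def
  proof (intro conjI LIMSEQ_I)
    have xF: "x \<in> F" using x assms(2) by blast
    then show bx: "ap U b x \<in> F" using bFM by simp
    fix r :: real
    assume "r > 0"
    then obtain k :: nat where k: "inverse (of_nat (Suc k)) < r / 2" using reals_Archimedean[of "r/2"] by auto
    then have k: "e k < r / 2" by (simp add: e_def inverse_eq_divide add.commute)
    \<comment> \<open>Strictness is lost here; \<open>e k < r / 2\<close> absorbs this together with
      the Cauchy error.\<close>
    have 1: "dd (ap U b x) (ap U (a (N k)) x) \<le> e k"
      unfolding dd_eq
      by (rule nr_less_iff(2)) (use b(2)[OF x, of k] xF bFM less_imp_le[OF e] in \<open>simp_all add: A_def\<close>)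
    show "\<exists>no. \<forall>n\<ge>no. norm (dd (ap U b x) (ap U (a n) x) - 0) < r"
    proof (intro exI[of _ "N k"] allI impI)
      fix n
      assume n: "n \<ge> N k"
      have F: "ap U (a (N k)) x \<in> F" "ap U (a n) x \<in> F" using xF by simp_all
      have "dd (ap U (a (N k)) x) (ap U (a n) x) < e k" using N[OF x] n by simp
      then have "dd (ap U b x) (ap U (a n) x) < r"
        using 1 k dd_triangle[OF bx F] by linarith
      then show "norm (dd (ap U b x) (ap U (a n) x) - 0) < r"
        using dd_nonneg[OF bx F(2)] by simp
    qed
  qed
  then show ?thesis using bFM by blast
qed

lemma lim_at_unique:
  assumes "lim_at x z" "lim_at x' z'" "x \<in> F" "x' \<in> F" "dd x x' = 0"
  shows "vhat U H z = vhat U H z'"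
proof -
  have z: "z \<in> F" "z' \<in> F" using assms by (auto simp: lim_at_def)
  have "dd z z' \<le> dd z (ap U (a n) x) + dd z' (ap U (a n) x')" for n
  proof -
    have F: "ap U (a n) x \<in> F" "ap U (a n) x' \<in> F" using assms by simp_all
    have "dd (ap U (a n) x) (ap U (a n) x') = 0" by (rule FM_cong[OF a_FM assms(3-5)])
    then show ?thesis
      using dd_triangle[OF z(1) F(1) z(2)] dd_triangle[OF F z(2)] dd_commute[OF F(2) z(2)] by linarith
  qed
  moreover have "(\<lambda>n. dd z (ap U (a n) x) + dd z' (ap U (a n) x')) \<longlonglongrightarrow> 0 + 0"
    using assms(1,2) unfolding lim_at_def by (intro tendsto_add) auto
  ultimately have "dd z z' \<le> 0 + 0" by (intro LIMSEQ_le_const exI[of _ 0]) auto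
  then have "dd z z' = 0" using dd_nonneg[OF z] by linarith
  then show ?thesis using vhat_eq_iff[OF z] by simp
qed

text \<open>Both a representative and a limit vector are chosen arbitrarily;
  \<open>lim_at_unique\<close> makes the resulting class independent of them.\<close>

definition T :: "'w set \<Rightarrow> 'w set" where
  "T = (\<lambda>X\<in>Hhull U H. vhat U H (SOME z. \<exists>x\<in>F. X = vhat U H x \<and> lim_at x z))"

lemma T_vhat:
  assumes "x \<in> F" "lim_at x z"
  shows "T (vhat U H x) = vhat U H z"
proof -
  let ?P = "\<lambda>z. \<exists>y\<in>F. vhat U H x = vhat U H y \<and> lim_at y z"
  have "?P z" using assms by blast
  then have "?P (SOME z. ?P z)" by (rule someI)
  then obtain y where y: "y \<in> F" "vhat U H x = vhat U H y" "lim_at y (SOME z. ?P z)" by blast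
  then have "dd y x = 0" using vhat_eq_iff[OF y(1) assms(1)] by simp
  then have "vhat U H (SOME z. ?P z) = vhat U H z"
    by (rule lim_at_unique[OF y(3) assms(2) y(1) assms(1)])
  moreover have "vhat U H x \<in> Hhull U H" using assms(1) by (simp add: Hhull_eq)
  ultimately show ?thesis by (simp add: T_def)
qed

text \<open>The majorant \<open>s\<close> is the constant \<open>nr x\<close> when \<open>T\<close>
  is shown to be bounded, and a null sequence in the final contradiction.\<close>

lemma nr_lim_le:
  assumes "lim_at x z" "x \<in> F" "\<And>n. nr (ap U (a n) x) \<le> s n" "s \<longlonglongrightarrow> l"
  shows "nr z \<le> l"
proof -
  have z: "z \<in> F" "(\<lambda>n. dd z (ap U (a n) x)) \<longlonglongrightarrow> 0" using assms by (auto simp: lim_at_def)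
  have "nr z \<le> s n + dd z (ap U (a n) x)" for n
    using nr_diff_le[OF z(1), of "ap U (a n) x"] assms(2) assms(3)[of n] by simp
  moreover have "(\<lambda>n. s n + dd z (ap U (a n) x)) \<longlonglongrightarrow> l + 0"
    by (intro tendsto_add assms z)
  ultimately have "nr z \<le> l + 0" by (intro LIMSEQ_le_const exI[of _ 0]) auto
  then show ?thesis by simp
qed

lemma T_agree:
  assumes "finite J" "J \<subseteq> Hhull U H"
  shows "\<exists>r\<in>rep U H ` Mhull U H M. \<forall>X\<in>J. r X = T X"
proof -
  obtain I where I: "finite I" "I \<subseteq> F" "J = vhat U H ` I"
    using finite_subset_image[OF assms[unfolded Hhull_eq]] by blast
  obtain b where b: "b \<in> FM" "\<And>x. x \<in> I \<Longrightarrow> lim_at x (ap U b x)"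
    using finite_limit_exists[OF I(1,2)] by blast
  have "rep U H (ahat U H M b) X = T X" if "X \<in> J" for X
  proof -
    obtain x where x: "x \<in> I" "X = vhat U H x" using \<open>X \<in> J\<close> unfolding I(3) by (rule imageE)
    then have "x \<in> F" using I(2) by blast
    then show ?thesis using T_vhat[OF _ b(2)[OF x(1)]] rep_ahat[OF b(1)] x(2) by simp
  qed
  then show ?thesis using b(1) by (auto simp: Mhull_eq)
qed

text \<open>Additivity and homogeneity each involve finitely many vectors, on which \<open>T\<close>
  coincides with the class of one operator \<open>b\<close> that is exactly linear.\<close>

lemma T_hh_ops: "T \<in> hh_ops U H"
proof -
  have lim: "\<exists>z. lim_at x z" if "x \<in> F" for x
    using finite_limit_exists[of "{x}"] that by auto
  have map: "T \<in> Hhull U H \<rightarrow>\<^sub>E Hhull U H"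
  proof (rule PiE_I)
    fix X
    assume "X \<in> Hhull U H"
    then obtain x where x: "x \<in> F" "X = vhat U H x" by (auto simp: Hhull_eq)
    obtain z where z: "lim_at x z" using lim[OF x(1)] by blast
    then have "T X = vhat U H z" "z \<in> F" using T_vhat[OF x(1) z] x(2) by (simp_all add: lim_at_def)
    then show "T X \<in> Hhull U H" by (simp add: Hhull_eq)
  qed (simp add: T_def)
  have add: "T (hh_add U H X Y) = hh_add U H (T X) (T Y)"
    if XY: "X \<in> Hhull U H" "Y \<in> Hhull U H" for X Y
  proof -
    obtain x y where x: "x \<in> F" "X = vhat U H x" and y: "y \<in> F" "Y = vhat U H y"
      using XY by (auto simp: Hhull_eq)
    obtain b where b: "b \<in> FM" "\<forall>w\<in>{x, y, add x y}. lim_at w (ap U b w)"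
      using finite_limit_exists[of "{x, y, add x y}"] x y by auto
    have l: "lim_at x (ap U b x)" "lim_at y (ap U b y)" "lim_at (add x y) (ap U b (add x y))"
      using b(2) by simp_all
    show ?thesis
      using b(1) x y T_vhat[OF _ l(1)] T_vhat[OF _ l(2)] T_vhat[OF _ l(3)]
      by (simp add: hh_add_vhat FM_add)
  qed
  have scale: "T (hh_scale U H c X) = hh_scale U H c (T X)" if X: "X \<in> Hhull U H" for X c
  proof -
    obtain x where x: "x \<in> F" "X = vhat U H x" using X by (auto simp: Hhull_eq)
    obtain b where b: "b \<in> FM" "\<forall>w\<in>{x, scl (num U c) x}. lim_at w (ap U b w)"
      using finite_limit_exists[of "{x, scl (num U c) x}"] x by auto
    have l: "lim_at x (ap U b x)" "lim_at (scl (num U c) x) (ap U b (scl (num U c) x))"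
      using b(2) by simp_all
    show ?thesis
      using b(1) x T_vhat[OF _ l(1)] T_vhat[OF _ l(2)] by (simp add: hh_scale_vhat FM_scl)
  qed
  have bound: "hh_norm U H (T X) \<le> 1 * hh_norm U H X" if X: "X \<in> Hhull U H" for X
  proof -
    obtain x where x: "x \<in> F" "X = vhat U H x" using X by (auto simp: Hhull_eq)
    obtain z where z: "lim_at x z" using lim[OF x(1)] by blast
    then have zF: "z \<in> F" by (simp add: lim_at_def)
    have "nr z \<le> nr x"
      by (rule nr_lim_le[OF z x(1) nr_proj_le[OF x(1)]]) simp
    then show ?thesis using T_vhat[OF x(1) z] x zF by (simp add: hh_norm_vhat)
  qed
  have "\<exists>C. \<forall>X\<in>Hhull U H. hh_norm U H (T X) \<le> C * hh_norm U H X"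
    using bound by (intro exI[of _ 1] ballI)
  then show ?thesis
    unfolding hh_ops_def mem_Collect_eq by (intro conjI ballI allI map add scale)
qed

text \<open>Take \<open>u\<close> in the range of the projection \<open>n+1\<close> but outside that
  of \<open>n\<close>, and normalise \<open>v = u - p n u\<close>. Lower projections annihilate
  \<open>v\<close> by \<open>proj_mono'\<close>; higher ones fix both \<open>u\<close> and
  \<open>p n u\<close>.\<close>

lemma gap_vector:
  "\<exists>z\<in>F. nr z = 1 \<and> (\<forall>m\<le>n. nr (ap U (a m) z) = 0) \<and> (\<forall>m>n. dd (ap U (a m) z) z = 0)"
proof -
  have "\<exists>X. X \<in> hull_range U H (ahat U H M (a (Suc n))) \<and> X \<notin> hull_range U H (ahat U H M (a n))"
    using range_strict[of n] by blast
  then obtain y where y: "y \<in> F"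
      "vhat U H (ap U (a (Suc n)) y) \<notin> (\<lambda>x. vhat U H (ap U (a n) x)) ` F"
    unfolding hull_range_ahat[OF a_FM] by blast
  define u where "u = ap U (a (Suc n)) y"
  define v where "v = sub u (ap U (a n) u)"
  have F: "u \<in> F" "ap U (a n) u \<in> F" "v \<in> F" using y(1) by (simp_all add: u_def v_def)
  \<comment> \<open>Otherwise the class of \<open>u\<close> would be the image of that of
    \<open>u\<close> under the projection \<open>n\<close>, against the choice of
    \<open>y\<close>.\<close>
  have "dd u (ap U (a n) u) \<noteq> 0"
    using y(2) F vhat_eq_iff[OF F(1,2)] unfolding u_def[symmetric] by blast
  then have v0: "nr v \<noteq> 0" by (simp add: dd_def v_def)
  have low: "nr (ap U (a m) v) = 0" if "m \<le> n" for m
  proof -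
    have "dd (ap U (a m) (ap U (a n) u)) (ap U (a m) u) = 0" by (rule proj_mono'[OF that F(1)])
    then show ?thesis
      using F dd_commute[of "ap U (a m) u" "ap U (a m) (ap U (a n) u)"]
      by (simp add: v_def FM_sub dd_def)
  qed
  have high: "dd (ap U (a m) v) v = 0" if "m > n" for m
  proof -
    have "dd (ap U (a m) u) u = 0" unfolding u_def using proj_mono[of "Suc n" m y] that y(1) by simp
    moreover have "dd (ap U (a m) (ap U (a n) u)) (ap U (a n) u) = 0"
      using proj_mono[of n m u] that F by simp
    moreover have "dd (ap U (a m) v) v \<le> dd (ap U (a m) u) u + dd (ap U (a m) (ap U (a n) u)) (ap U (a n) u)"
      using dd_add[of "ap U (a m) u" "scl (num U (-1)) (ap U (a m) (ap U (a n) u))" u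
          "scl (num U (-1)) (ap U (a n) u)"] F
      by (simp add: v_def FM_sub vsub_def[symmetric] dd_scl)
    moreover have "dd (ap U (a m) v) v \<ge> 0" using F by simp
    ultimately show ?thesis by linarith
  qed
  let ?c = "complex_of_real (1 / nr v)"
  have c: "cmod ?c * nr v = 1" using v0 nr_nonneg[OF F(3)] by (simp add: norm_divide)
  show ?thesis
  proof (intro bexI[of _ "scl (num U ?c) v"] conjI allI impI)
    show "nr (scl (num U ?c) v) = 1" using c nr_scl[OF F(3)] by simp
    show "nr (ap U (a m) (scl (num U ?c) v)) = 0" if "m \<le> n" for m
      using low[OF that] F by (simp add: FM_scl nr_scl)
    show "dd (ap U (a m) (scl (num U ?c) v)) (scl (num U ?c) v) = 0" if "m > n" for m
      using high[OF that] F by (simp add: FM_scl dd_scl)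
  qed (use F in simp)
qed

lemma T_not_in_Mhull: "T \<notin> rep U H ` Mhull U H M"
proof
  assume "T \<in> rep U H ` Mhull U H M"
  then obtain c where c: "c \<in> FM" "T = rep U H (ahat U H M c)" by (auto simp: Mhull_eq)
  have Tc: "vhat U H (ap U c x) = vhat U H z" if "x \<in> F" "lim_at x z" for x z
    using T_vhat[OF that] rep_ahat[OF c(1) that(1)] c(2) by simp
  define e :: "nat \<Rightarrow> real" where "e k = 1 / (real k + 1)" for k
  have e: "e k > 0" for k by (simp add: e_def)
  \<comment> \<open>The first condition keeps \<open>x\<close> finite. The thresholds 2 and 1/2 lie
    on either side of the value 1 that a gap vector gives for both norms.\<close>
  define X where "X m = {x\<in>V. inr x x \<in> nelts U (nset U {z. Re z < 2\<^sup>2})} \<inter>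
      {x\<in>V. inr (ap U c x) (ap U c x) \<in> nelts U (nset U {z. (1/2)\<^sup>2 < Re z})} \<inter>
      {x\<in>V. inr (ap U (a m) x) (ap U (a m) x) \<in> nelts U (nset U {z. Re z < (e m)\<^sup>2})}" for m
  have "\<exists>x. \<forall>m. x \<in> X m"
  proof (rule internal_set_saturation[OF sat])
    show "internal_set (X m)" for m
      unfolding X_def using E_int[OF FM_E] c(1)
      by (intro internal_set_Int internal_set_norm internal_set_op_norm) simp_all
    fix n
    obtain z where z: "z \<in> F" "nr z = 1" "\<And>m. m \<le> n \<Longrightarrow> nr (ap U (a m) z) = 0"
        "\<And>m. m > n \<Longrightarrow> dd (ap U (a m) z) z = 0"
      using gap_vector[of n] by blast
    \<comment> \<open>All projections past \<open>n\<close> fix \<open>z\<close> up to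
      infinitesimals, so \<open>z\<close> is its own limit and
      \<open>c z \<approx> z\<close>.\<close>
    have "eventually (\<lambda>m. dd z (ap U (a m) z) = 0) sequentially"
      using eventually_gt_at_top[of n] by eventually_elim (use z dd_commute in simp)
    then have "lim_at z z" using z(1) by (simp add: lim_at_def tendsto_eventually)
    then have "vhat U H (ap U c z) = vhat U H z" by (rule Tc[OF z(1)])
    then have "nr (ap U c z) = 1" using nr_eq[of "ap U c z" z] vhat_eq_iff z c(1) by simp
    then have "inr (ap U c z) (ap U c z) \<in> nelts U (nset U {z. (1/2)\<^sup>2 < Re z})"
      by (intro nr_greater_iff(1)) (use z c(1) in simp_all)
    moreover have "inr z z \<in> nelts U (nset U {z. Re z < 2\<^sup>2})"
      by (intro nr_less_iff(1)) (use z in simp_all)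
    moreover have "inr (ap U (a m) z) (ap U (a m) z) \<in> nelts U (nset U {z. Re z < (e m)\<^sup>2})"
      if "m \<le> n" for m
      by (intro nr_less_iff(1)) (use z that e[of m] in simp_all)
    ultimately have "z \<in> X m" if "m \<le> n" for m
      unfolding X_def using F_V[OF z(1)] that by blast
    then show "\<exists>x. \<forall>m\<le>n. x \<in> X m" by blast
  qed
  then obtain x where x: "\<And>m. x \<in> X m" by blast
  have "x \<in> V" "inr x x \<in> nelts U (nset U {z. Re z < 2\<^sup>2})" using x[of 0] by (auto simp: X_def)
  then have xF: "x \<in> F" by (rule F_if_less)
  obtain z where z: "lim_at x z" using finite_limit_exists[of "{x}"] xF by auto
  then have zF: "z \<in> F" by (simp add: lim_at_def)
  have "nr (ap U (a m) x) \<le> e m" for m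
    by (rule nr_less_iff(2)) (use x[of m] xF e[of m] in \<open>simp_all add: X_def\<close>)
  moreover have "e \<longlonglongrightarrow> 0"
    using LIMSEQ_inverse_real_of_nat by (simp add: e_def[abs_def] inverse_eq_divide add.commute)
  ultimately have "nr z \<le> 0" by (rule nr_lim_le[OF z xF])
  moreover have "1/2 \<le> nr (ap U c x)"
    by (rule nr_greater_iff(2)) (use x[of 0] xF c(1) in \<open>simp_all add: X_def\<close>)
  moreover have "nr (ap U c x) = nr z"
    using Tc[OF xF z] vhat_eq_iff[of "ap U c x" z] nr_eq[of "ap U c x" z] xF zF c(1) by simp
  ultimately show False by simp
qed

lemma not_von_neumann: "\<not> Mhull_von_neumann U H M"
proof
  assume "Mhull_von_neumann U H M"
  then have "T \<in> rep U H ` Mhull U H M"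
    unfolding Mhull_von_neumann_def hh_sot_def
  proof (rule closedin_product_finite_agreement)
    show "T \<in> hh_ops U H" by (rule T_hh_ops)
    show "T \<in> extensional (Hhull U H)" by (simp add: T_def)
  qed (rule T_agree)
  then show False using T_not_in_Mhull by blast
qed

end

theorem proposition13:
  fixes U :: "('u, 'w) nsu" and \<kappa> :: "'k rel"
    and H :: "'w ihs" and M :: 'w and p :: "nat \<Rightarrow> 'w set"
  assumes "nonstandard_universe U"
    and "Card_order \<kappa>" and "natLeq <o \<kappa>" and "saturated U \<kappa>"
    and "internal_hilbert_space U H"
    and "internal_cstar_algebra U H M"
    and "\<And>n. Mhull_projection U H M (p n)"
    and "\<And>n. hull_range U H (p n) \<subset> hull_range U H (p (Suc n))"
  shows "\<not> Mhull_von_neumann U H M"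
proof -
  interpret icstar U H M
    using assms by unfold_locales
  have "\<forall>n. \<exists>a. a \<in> FM \<and> p n = ahat U H M a \<and>
      (\<forall>x\<in>F. dd (ap U a (ap U a x)) (ap U a x) = 0) \<and>
      (\<forall>x\<in>F. \<forall>y\<in>F. ip (ap U a x) y = ip x (ap U a y))"
    using Mhull_projectionD[OF assms(7)] by metis
  then obtain a where a: "\<And>n. a n \<in> FM" "\<And>n. p n = ahat U H M (a n)"
      "\<And>n x. x \<in> F \<Longrightarrow> dd (ap U (a n) (ap U (a n) x)) (ap U (a n) x) = 0"
      "\<And>n x y. x \<in> F \<Longrightarrow> y \<in> F \<Longrightarrow> ip (ap U (a n) x) y = ip x (ap U (a n) y)"
    unfolding choice_iff by blast
  interpret hull_projections U H M \<kappa> a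
    by unfold_locales (use assms(3,4) a assms(8)[unfolded a(2)] in simp_all)
  show ?thesis by (rule not_von_neumann)
qed

end
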